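(* Let $n=2$. For $j=1,2$ let $\varepsilon\mapsto\omega_{j,\varepsilon}>0$ be $C^\infty$ near $\varepsilon=0$, with first-order expansion $\omega_{j,\varepsilon}=\omega_{j,0}+\varepsilon\,\omega_{j,1}+\mathcal{O}(\varepsilon^2)$, and assume the near Fermi resonance $1\approx2$, i.e. $\omega_{2,0}=2\omega_{1,0}$. Let $H_{2,\varepsilon}=\sum_{j=1}^2\frac{\omega_{j,\varepsilon}}{2}(\xi_j^2+x_j^2)+\mathcal{O}(\varepsilon^\infty\|x\|^2)$, and let $R_\varepsilon(x)$ be a smooth real function of $(x,\varepsilon)$, $x=(x_1,x_2)$, with $R_\varepsilon(x)=\mathcal{O}(x^3)$ at the origin, uniformly in $\varepsilon$. Let $R_{3,0}$ be the homogeneous part of degree $3$ of the Taylor expansion of $R_0$ at $x=0$. Then the quantum $\varepsilon$-Birkhoff-Gustavson normal form of $H_{2,\varepsilon}+R_\varepsilon(x)$ is equal to $H_{2,0}+K_{3,\varepsilon}+\mathcal{O}_4$ with, for $z_j=x_j+i\xi_j$, $$K_{3,\varepsilon}=\frac{\omega_{1,1}}{2}\varepsilon|z_1|^2+\frac{\omega_{2,1}}{2}\varepsilon|z_2|^2+\mu\,\mathrm{Re}(z_1^2\bar z_2),\qquad \mu=\frac18\frac{\partial^3R_{3,0}(0)}{\partial x_1^2\partial x_2}.$$ Moreover, the remainder in $\mathcal{O}_4$ also belongs to $\mathcal{O}_2(x,\xi,\hbar)$.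
   Context: $\mathcal{E}=\mathbb{C}[[x_1,x_2,\xi_1,\xi_2,\varepsilon,\hbar]]$, where the monomial $x^\alpha\xi^\beta\varepsilon^m\hbar^\ell$ has degree $|\alpha|+|\beta|+m+2\ell$. $\mathcal{O}_N$ is the subspace of series with no term of degree $<N$; $\mathcal{O}_N(x,\xi,\hbar)$ is the subspace of series containing only monomials with $|\alpha|+|\beta|+2\ell\ge N$. Smooth functions are identified with their Taylor series at the origin in $(x,\xi,\varepsilon,\hbar)$. $\mathcal{O}(\varepsilon^\infty\|x\|^2)$ denotes a function that is $\mathcal{O}(\varepsilon^N\|x\|^2)$ for every $N$ (its Taylor series vanishes). The Weyl bracket $[f,g]_W$ on $\mathcal{E}$ is given by Moyal's formula $i[f,g]_W=2\sin(\frac\hbar2\square)\big(f(x_1,\xi_1)g(x_2,\xi_2)\big)$ restricted to $x_1=x_2=x$, $\xi_1=\xi_2=\xi$ (here $x_1,x_2,\xi_1,\xi_2$ denote two copies of the phase-space variables $x,\xi\in\mathbb{R}^2$), with $\square=\sum_j(\partial_{\xi_1^j}\partial_{x_2^j}-\partial_{x_1^j}\partial_{\xi_2^j})$; $\varepsilon,\hbar$ are central. $\mathrm{ad}_A(P)=[A,P]_W$, and for $A\in\mathcal{O}_3$, $e^{i\hbar^{-1}\mathrm{ad}_A}=\sum_\ell\frac1{\ell!}(\frac i\hbar\mathrm{ad}_A)^\ell$ converges formally. $H_{2,0}=\frac{\omega_{1,0}}2(\xi_1^2+x_1^2)+\frac{\omega_{2,0}}2(\xi_2^2+x_2^2)$.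 For $L_\varepsilon\in\mathcal{O}_3$, the quantum $\varepsilon$-Birkhoff-Gustavson normal form of $H_{2,0}+L_\varepsilon$ is the series $H_{2,0}+K_\varepsilon$ with $K_\varepsilon\in\mathcal{O}_3$, $[H_{2,0},K_\varepsilon]_W=0$ and $e^{i\hbar^{-1}\mathrm{ad}_{A_\varepsilon}}(H_{2,0}+L_\varepsilon)=H_{2,0}+K_\varepsilon$ for some $A_\varepsilon\in\mathcal{O}_3$. Here it is applied with $L_\varepsilon=H_{2,\varepsilon}-H_{2,0}+R_\varepsilon$. *)

theory Defs
  imports "HOL-Analysis.Analysis" "HOL-Library.Landau_Symbols"
begin

section \<open>Formal power series in finitely many variables\<close>

text \<open>A series is its family of coefficients, indexed by the exponent functions
  \<^typ>\<open>'v \<Rightarrow> nat\<close>.\<close>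

typedef 'v mfps = "UNIV :: (('v \<Rightarrow> nat) \<Rightarrow> complex) set"
  morphisms mcoeff Abs_mfps ..

lemma mfps_eqI: "(\<And>m. mcoeff f m = mcoeff g m) \<Longrightarrow> f = g"
  by (metis ext mcoeff_inject)

lemma mcoeff_Abs [simp]: "mcoeff (Abs_mfps c) = c"
  by (simp add: Abs_mfps_inverse)

definition splits :: "('v \<Rightarrow> nat) \<Rightarrow> (('v \<Rightarrow> nat) \<times> ('v \<Rightarrow> nat)) set" where
  "splits m = {(a, b). (\<lambda>v. a v + b v) = m}"

lemma finite_splits [simp]: "finite (splits (m :: 'v::finite \<Rightarrow> nat))"
proof -
  have fin: "finite {a :: 'v \<Rightarrow> nat. \<forall>v. a v \<in> {..m v}}"
    using finite_PiE[of "UNIV :: 'v set" "\<lambda>v. {..m v}"] by (simp add: PiE_UNIV_domain Pi_def)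
  have "splits m \<subseteq> {a. \<forall>v. a v \<in> {..m v}} \<times> {a. \<forall>v. a v \<in> {..m v}}"
    by (auto simp: splits_def)
  then show ?thesis
    using finite_subset fin by blast
qed

instantiation mfps :: (finite) comm_ring_1
begin

definition zero_mfps :: "'a mfps" where "0 = Abs_mfps (\<lambda>m. 0)"
definition one_mfps :: "'a mfps" where "1 = Abs_mfps (\<lambda>m. if m = (\<lambda>_. 0) then 1 else 0)"
definition plus_mfps :: "'a mfps \<Rightarrow> 'a mfps \<Rightarrow> 'a mfps"
  where "f + g = Abs_mfps (\<lambda>m. mcoeff f m + mcoeff g m)"
definition minus_mfps :: "'a mfps \<Rightarrow> 'a mfps \<Rightarrow> 'a mfps"
  where "f - g = Abs_mfps (\<lambda>m. mcoeff f m - mcoeff g m)"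
definition uminus_mfps :: "'a mfps \<Rightarrow> 'a mfps"
  where "- f = Abs_mfps (\<lambda>m. - mcoeff f m)"
definition times_mfps :: "'a mfps \<Rightarrow> 'a mfps \<Rightarrow> 'a mfps"
  where "f * g = Abs_mfps (\<lambda>m. \<Sum>(a, b)\<in>splits m. mcoeff f a * mcoeff g b)"

instance
proof
  fix a b c :: "'a mfps"
  show "a + b + c = a + (b + c)"
    by (rule mfps_eqI) (simp only: plus_mfps_def mcoeff_Abs add.assoc)
  show "a + b = b + a"
    by (rule mfps_eqI) (simp only: plus_mfps_def mcoeff_Abs add.commute)
  show "0 + a = a"
    by (rule mfps_eqI) (simp only: plus_mfps_def zero_mfps_def mcoeff_Abs add_0)
  show "- a + a = 0"
    by (rule mfps_eqI) (simp only: plus_mfps_def uminus_mfps_def zero_mfps_def mcoeff_Abs ab_left_minus)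
  show "a - b = a + - b"
    by (rule mfps_eqI)
      (simp only: plus_mfps_def uminus_mfps_def minus_mfps_def mcoeff_Abs diff_conv_add_uminus)
  show "(0::'a mfps) \<noteq> 1"
  proof
    assume "(0::'a mfps) = 1"
    then have "mcoeff (0::'a mfps) (\<lambda>_. 0) = mcoeff 1 (\<lambda>_. 0)"
      by (rule arg_cong)
    then show False
      by (simp add: zero_mfps_def one_mfps_def)
  qed
  show "(a + b) * c = a * c + b * c"
    by (rule mfps_eqI,
        simp only: plus_mfps_def times_mfps_def mcoeff_Abs case_prod_unfold distrib_right sum.distrib)
  show "a * b = b * a"
  proof (rule mfps_eqI)
    fix m
    show "mcoeff (a * b) m = mcoeff (b * a) m"
      unfolding times_mfps_def mcoeff_Abs
      by (rule sum.reindex_bij_witness[of _ prod.swap prod.swap])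
        (auto simp: splits_def add.commute)
  qed
  show "1 * a = a"
  proof (rule mfps_eqI)
    fix m
    have "mcoeff (1 * a) m = (\<Sum>(p, q)\<in>{((\<lambda>_. 0), m)}. mcoeff 1 p * mcoeff a q)"
      unfolding times_mfps_def mcoeff_Abs
      by (rule sum.mono_neutral_right, rule finite_splits)
        (auto simp: splits_def one_mfps_def split: if_splits)
    then show "mcoeff (1 * a) m = mcoeff a m"
      by (simp add: one_mfps_def)
  qed
  show "a * b * c = a * (b * c)"
  proof (rule mfps_eqI)
    fix m
    have "mcoeff (a * b * c) m =
        (\<Sum>(s, r)\<in>splits m. \<Sum>(p, q)\<in>splits s. mcoeff a p * mcoeff b q * mcoeff c r)"
      by (simp add: times_mfps_def sum_distrib_right case_prod_unfold)
    also have "\<dots> = (\<Sum>x\<in>Sigma (splits m) (\<lambda>sr. splits (fst sr)).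
        mcoeff a (fst (snd x)) * mcoeff b (snd (snd x)) * mcoeff c (snd (fst x)))"
      by (simp add: sum.Sigma case_prod_unfold)
    also have "\<dots> = (\<Sum>x\<in>Sigma (splits m) (\<lambda>ps. splits (snd ps)).
        mcoeff a (fst (fst x)) * (mcoeff b (fst (snd x)) * mcoeff c (snd (snd x))))"
      by (rule sum.reindex_bij_witness[of _
            "\<lambda>((p, s), (q, r)). (((\<lambda>v. p v + q v), r), (p, q))"
            "\<lambda>((s, r), (p, q)). ((p, (\<lambda>v. q v + r v)), (q, r))"])
        (auto simp: splits_def add.assoc mult.assoc)
    also have "\<dots> = (\<Sum>(p, s)\<in>splits m. \<Sum>(q, r)\<in>splits s. mcoeff a p * (mcoeff b q * mcoeff c r))"
      by (simp add: sum.Sigma case_prod_unfold)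
    also have "\<dots> = mcoeff (a * (b * c)) m"
      by (simp add: times_mfps_def sum_distrib_left case_prod_unfold)
    finally show "mcoeff (a * b * c) m = mcoeff (a * (b * c)) m" .
  qed
qed

end

definition mconst :: "complex \<Rightarrow> 'v mfps" where
  "mconst c = Abs_mfps (\<lambda>m. if m = (\<lambda>_. 0) then c else 0)"

definition mvar :: "'v \<Rightarrow> 'v mfps" where
  "mvar v = Abs_mfps (\<lambda>m. if m = (\<lambda>_. 0)(v := 1) then 1 else 0)"

definition mderiv :: "'v \<Rightarrow> 'v mfps \<Rightarrow> 'v mfps" where
  "mderiv v f = Abs_mfps (\<lambda>m. of_nat (Suc (m v)) * mcoeff f (m(v := Suc (m v))))"

text \<open>Exact division of a multiple of the variable \<open>v\<close> by \<open>v\<close>.\<close>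

definition mdiv_var :: "'v \<Rightarrow> 'v mfps \<Rightarrow> 'v mfps" where
  "mdiv_var v f = Abs_mfps (\<lambda>m. mcoeff f (m(v := Suc (m v))))"

lemma mcoeff_mconst_mult: "mcoeff (mconst c * f) m = c * mcoeff f (m :: 'v::finite \<Rightarrow> nat)"
proof -
  have "mcoeff (mconst c * f) m = (\<Sum>(p, q)\<in>{((\<lambda>_::'v. 0), m)}. mcoeff (mconst c) p * mcoeff f q)"
    unfolding times_mfps_def mcoeff_Abs
    by (rule sum.mono_neutral_right, rule finite_splits)
        (auto simp: splits_def mconst_def split: if_splits)
  then show ?thesis
    by (simp add: mconst_def)
qed

lemma mcoeff_mvar_mult:
  "mcoeff (mvar v * f) m = (if m v = 0 then 0 else mcoeff f ((m :: 'v::finite \<Rightarrow> nat)(v := m v - 1)))"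
proof (cases "m v = 0")
  case True
  then have "mcoeff (mvar v * f) m = 0"
    unfolding times_mfps_def mcoeff_Abs
    by (intro sum.neutral) (auto simp: splits_def mvar_def split: if_splits)
  with True show ?thesis by simp
next
  case False
  have "mcoeff (mvar v * f) m
      = (\<Sum>(p, q)\<in>{((\<lambda>_. 0)(v := 1), m(v := m v - 1))}. mcoeff (mvar v) p * mcoeff f q)"
    unfolding times_mfps_def mcoeff_Abs
    by (rule sum.mono_neutral_right, rule finite_splits)
      (use False in \<open>auto simp: splits_def mvar_def split: if_splits\<close>)
  with False show ?thesis
    by (simp add: mvar_def)
qed

lemma mvar_mult_mdiv_var:
  assumes "\<And>m. m v = 0 \<Longrightarrow> mcoeff f (m :: 'v::finite \<Rightarrow> nat) = 0"
  shows "mvar v * mdiv_var v f = f"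
  by (rule mfps_eqI) (use assms in \<open>auto simp: mcoeff_mvar_mult mdiv_var_def\<close>)

text \<open>Complex conjugation for real variables.\<close>

definition mcnj :: "'v mfps \<Rightarrow> 'v mfps" where
  "mcnj f = Abs_mfps (\<lambda>m. cnj (mcoeff f m))"

definition mRe :: "'v::finite mfps \<Rightarrow> 'v mfps" where
  "mRe f = mconst (1/2) * (f + mcnj f)"

section \<open>The graded space of symbols\<close>

datatype coord = X1 | X2 | Xi1 | Xi2 | Eps | Hbar

lemma UNIV_coord: "UNIV = {X1, X2, Xi1, Xi2, Eps, Hbar}"
  by (auto intro: coord.exhaust)

instance coord :: finite
  by standard (simp add: UNIV_coord)

definition deg :: "(coord \<Rightarrow> nat) \<Rightarrow> nat" where
  "deg m = m X1 + m X2 + m Xi1 + m Xi2 + m Eps + 2 * m Hbar"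

definition deg_xh :: "(coord \<Rightarrow> nat) \<Rightarrow> nat" where
  "deg_xh m = m X1 + m X2 + m Xi1 + m Xi2 + 2 * m Hbar"

definition ord_ge :: "nat \<Rightarrow> coord mfps set" where
  "ord_ge N = {f. \<forall>m. mcoeff f m \<noteq> 0 \<longrightarrow> N \<le> deg m}"

definition ord_ge_xh :: "nat \<Rightarrow> coord mfps set" where
  "ord_ge_xh N = {f. \<forall>m. mcoeff f m \<noteq> 0 \<longrightarrow> N \<le> deg_xh m}"

section \<open>The Weyl bracket\<close>

text \<open>\<open>box_pow k f g\<close> is the restriction to the diagonal of the \<open>k\<close>-th power of
  \<open>\<square>\<close> applied to the tensor product of \<open>f\<close> and \<open>g\<close>: each factor of \<open>\<square>\<close>
  replaces \<open>f \<otimes> g\<close> by the sum over \<open>j\<close> of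
  \<open>\<partial>\<xi>\<^sub>j f \<otimes> \<partial>x\<^sub>j g - \<partial>x\<^sub>j f \<otimes> \<partial>\<xi>\<^sub>j g\<close>.\<close>

fun box_pow :: "nat \<Rightarrow> coord mfps \<Rightarrow> coord mfps \<Rightarrow> coord mfps" where
  "box_pow 0 f g = f * g"
| "box_pow (Suc k) f g =
     (box_pow k (mderiv Xi1 f) (mderiv X1 g) - box_pow k (mderiv X1 f) (mderiv Xi1 g)) +
     (box_pow k (mderiv Xi2 f) (mderiv X2 g) - box_pow k (mderiv X2 f) (mderiv Xi2 g))"

text \<open>\<open>\<i> [f, g] = 2 sin (\<hbar>/2 \<square>) (f \<otimes> g)\<close>. The sum over \<open>k\<close> is finite in each coefficient
  because of the factor \<open>\<hbar>^k\<close>.\<close>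

definition weyl_bracket :: "coord mfps \<Rightarrow> coord mfps \<Rightarrow> coord mfps" where
  "weyl_bracket f g = mconst (- \<i>) * Abs_mfps (\<lambda>m. \<Sum>k.
     mcoeff (mconst (2 * of_real (sin_coeff k)) * (mconst (1/2) * mvar Hbar) ^ k * box_pow k f g) m)"

lemma hbar_dvd_weyl_bracket:
  assumes "m Hbar = 0"
  shows "mcoeff (weyl_bracket f g) m = 0"
proof -
  have "mcoeff (mconst (2 * of_real (sin_coeff k)) * (mconst (1/2) * mvar Hbar) ^ k * box_pow k f g) m = 0"
    for k
  proof (cases k)
    case 0
    then show ?thesis
      by (simp add: mult.assoc mcoeff_mconst_mult)
  next
    case (Suc j)
    have "mconst (2 * of_real (sin_coeff k)) * (mconst (1/2) * mvar Hbar) ^ k * box_pow k f g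
        = mvar Hbar * (mconst (2 * of_real (sin_coeff k)) * mconst (1/2)
            * (mconst (1/2) * mvar Hbar) ^ j * box_pow k f g)"
      by (simp add: Suc mult_ac)
    with assms show ?thesis
      by (simp add: mcoeff_mvar_mult)
  qed
  then show ?thesis
    by (simp add: weyl_bracket_def mcoeff_mconst_mult)
qed

definition ad_over_hbar :: "coord mfps \<Rightarrow> coord mfps \<Rightarrow> coord mfps" where
  "ad_over_hbar A P = mdiv_var Hbar (mconst \<i> * weyl_bracket A P)"

lemma hbar_mult_ad_over_hbar: "mvar Hbar * ad_over_hbar A P = mconst \<i> * weyl_bracket A P"
  unfolding ad_over_hbar_def
  by (rule mvar_mult_mdiv_var) (simp add: mcoeff_mconst_mult hbar_dvd_weyl_bracket)

text \<open>For \<open>A \<in> ord_ge 3\<close> each application of \<open>ad_over_hbar A\<close> raises the degree, so the sum is finite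
  in each coefficient.\<close>

definition exp_ad :: "coord mfps \<Rightarrow> coord mfps \<Rightarrow> coord mfps" where
  "exp_ad A P = Abs_mfps (\<lambda>m. \<Sum>l. mcoeff ((ad_over_hbar A ^^ l) P) m / fact l)"

definition H20 :: "real \<Rightarrow> real \<Rightarrow> coord mfps" where
  "H20 a b = mconst (of_real (a/2)) * (mvar Xi1 ^ 2 + mvar X1 ^ 2)
           + mconst (of_real (b/2)) * (mvar Xi2 ^ 2 + mvar X2 ^ 2)"

definition quantum_BGNF :: "real \<Rightarrow> real \<Rightarrow> coord mfps \<Rightarrow> coord mfps \<Rightarrow> bool" where
  "quantum_BGNF a b P Q \<longleftrightarrow> (\<exists>L\<in>ord_ge 3. \<exists>K\<in>ord_ge 3.
     P = H20 a b + L \<and> Q = H20 a b + K \<and> weyl_bracket (H20 a b) K = 0 \<and>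
     (\<exists>A\<in>ord_ge 3. exp_ad A (H20 a b + L) = H20 a b + K))"

section \<open>Smooth functions and Taylor series\<close>

definition ddir :: "'a \<Rightarrow> ('a::euclidean_space \<Rightarrow> real) \<Rightarrow> 'a \<Rightarrow> real" where
  "ddir b f = (\<lambda>p. frechet_derivative f (at p) b)"

text \<open>Meant for open \<open>U\<close>.\<close>

primrec Ck_on :: "nat \<Rightarrow> ('a::euclidean_space \<Rightarrow> real) \<Rightarrow> 'a set \<Rightarrow> bool" where
  "Ck_on 0 f U \<longleftrightarrow> continuous_on U f"
| "Ck_on (Suc k) f U \<longleftrightarrow> f differentiable_on U \<and> (\<forall>b\<in>Basis. Ck_on k (ddir b f) U)"

definition smooth_near_0 :: "('a::euclidean_space \<Rightarrow> real) \<Rightarrow> bool" where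
  "smooth_near_0 f \<longleftrightarrow> (\<exists>U. open U \<and> 0 \<in> U \<and> (\<forall>k. Ck_on k f U))"

definition mpartial :: "(coord \<Rightarrow> nat) \<Rightarrow> (real ^ coord \<Rightarrow> real) \<Rightarrow> real ^ coord \<Rightarrow> real" where
  "mpartial m f =
     (ddir (axis X1 1) ^^ m X1) ((ddir (axis X2 1) ^^ m X2)
     ((ddir (axis Xi1 1) ^^ m Xi1) ((ddir (axis Xi2 1) ^^ m Xi2)
     ((ddir (axis Eps 1) ^^ m Eps) ((ddir (axis Hbar 1) ^^ m Hbar) f)))))"

definition taylor :: "(real ^ coord \<Rightarrow> real) \<Rightarrow> coord mfps" where
  "taylor f = Abs_mfps (\<lambda>m. of_real (mpartial m f 0 / (\<Prod>v\<in>UNIV. fact (m v))))"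

definition taylor_hom2 :: "nat \<Rightarrow> (real \<times> real \<Rightarrow> real) \<Rightarrow> real \<times> real \<Rightarrow> real" where
  "taylor_hom2 k f = (\<lambda>(x1, x2). \<Sum>a\<le>k.
     (ddir (1, 0) ^^ a) ((ddir (0, 1) ^^ (k - a)) f) (0, 0) / (fact a * fact (k - a))
       * x1 ^ a * x2 ^ (k - a))"

section \<open>The Hamiltonian and its cubic normal form\<close>

definition H2 :: "(real \<Rightarrow> real) \<Rightarrow> (real \<Rightarrow> real) \<Rightarrow> (real \<Rightarrow> real \<times> real \<Rightarrow> real \<times> real \<Rightarrow> real)
    \<Rightarrow> real ^ coord \<Rightarrow> real" where
  "H2 w1 w2 \<rho> p = w1 (p $ Eps) / 2 * ((p $ Xi1)\<^sup>2 + (p $ X1)\<^sup>2)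
                + w2 (p $ Eps) / 2 * ((p $ Xi2)\<^sup>2 + (p $ X2)\<^sup>2)
                + \<rho> (p $ Eps) (p $ X1, p $ X2) (p $ Xi1, p $ Xi2)"

definition z1 :: "coord mfps" where "z1 = mvar X1 + mconst \<i> * mvar Xi1"
definition z2 :: "coord mfps" where "z2 = mvar X2 + mconst \<i> * mvar Xi2"

definition K3 :: "real \<Rightarrow> real \<Rightarrow> real \<Rightarrow> coord mfps" where
  "K3 w11 w21 \<mu> = mconst (of_real (w11/2)) * mvar Eps * (z1 * mcnj z1)
                + mconst (of_real (w21/2)) * mvar Eps * (z2 * mcnj z2)
                + mconst (of_real \<mu>) * mRe (z1 ^ 2 * mcnj z2)"

end

theory Submission
  imports Defs
begin

text \<open>
  Conjugation by \<open>exp (i/\<hbar> ad A)\<close> changes \<open>H + L\<close>, to first order, by \<open>D A\<close>, where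
  \<open>D = \<omega>\<^sub>1 (x\<^sub>1 \<partial>\<xi>\<^sub>1 - \<xi>\<^sub>1 \<partial>x\<^sub>1) + \<omega>\<^sub>2 (x\<^sub>2 \<partial>\<xi>\<^sub>2 - \<xi>\<^sub>2 \<partial>x\<^sub>2)\<close> is diagonal on the monomials in
  \<open>z\<^sub>j\<close> and their conjugates. Hence every series is the sum of an element of the image and one of the
  kernel of \<open>D\<close>, which gives the normal form degree by degree; and since image and kernel meet in 0,
  the part of degree 3 is forced to be the resonant part of the cubic Taylor polynomial, that is, the
  terms in \<open>|z\<^sub>j|\<^sup>2\<close> and \<open>z\<^sub>1\<^sup>2\<close> times the conjugate of \<open>z\<^sub>2\<close>.

  For the remainder, \<open>A\<close> has no term linear in \<open>(x, \<xi>)\<close>: since \<open>D\<close> is injective on linear terms,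
  the one of lowest order in \<open>\<epsilon>\<close> would produce a linear term of the normal form, which \<open>D\<close> does
  not annihilate. So conjugation by \<open>A\<close> preserves \<open>O\<^sub>2(x, \<xi>, \<hbar>)\<close>.

  The Taylor coefficients are read off from the asymptotic hypotheses by Maclaurin's theorem along
  lines and the symmetry of second derivatives.
\<close>

section \<open>Formal power series\<close>

text \<open>The obstacle for the remainder is that the generator is arbitrary in
  \<open>ord_ge 3\<close>: it may contain a term such as \<epsilon>^2 x_1, and bracketing with a
  linear term lowers the degree in (x, \<xi>, \<hbar>) by one. All estimates are made for one family
  of weights a (|\<alpha>| + |\<beta>| + 2 l) + b m. The choice (1, 1) is the total degree, (1, 0)
  is the filtration \<open>ord_ge_xh\<close>, and (k - 1, 1) places the linear terms with factor
  \<epsilon>^k on the lowest level. In each of them an application of (\<i>/\<hbar>) ad costs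
  exactly 2a.

  Since H is quadratic, (\<i>/\<hbar>) [A, H] equals D A without quantum correction, so none reaches
  the cubic part. The constant 1/8 is 1/2 times 1/4: the Taylor coefficient of x_1^2 x_2 is half the
  third derivative, and the resonant part of x_1^2 x_2 is a quarter of the real part of z_1^2 times
  the conjugate of z_2.\<close>

lemma mcoeff_simps [simp]:
  fixes f g :: "'v::finite mfps"
  shows "mcoeff (0::'v mfps) m = 0"
    and "mcoeff (f + g) m = mcoeff f m + mcoeff g m"
    and "mcoeff (f - g) m = mcoeff f m - mcoeff g m"
    and "mcoeff (- f) m = - mcoeff f m"
    and "mcoeff (mderiv v f) m = of_nat (Suc (m v)) * mcoeff f (m(v := Suc (m v)))"
  by (simp_all add: zero_mfps_def plus_mfps_def minus_mfps_def uminus_mfps_def mderiv_def)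

lemma mconst_0 [simp]: "mconst 0 = (0 :: 'v::finite mfps)"
  by (simp add: mconst_def zero_mfps_def)

lemma mconst_1 [simp]: "mconst 1 = (1 :: 'v::finite mfps)"
  by (simp add: mconst_def one_mfps_def)

lemma mconst_add: "mconst (a + b) = mconst a + (mconst b :: 'v::finite mfps)"
  by (rule mfps_eqI) (simp add: mconst_def)

lemma mconst_minus: "mconst (- a) = - (mconst a :: 'v::finite mfps)"
  by (rule mfps_eqI) (simp add: mconst_def)

lemma mconst_mult: "mconst (a * b) = mconst a * (mconst b :: 'v::finite mfps)"
  by (rule mfps_eqI) (simp only: mcoeff_mconst_mult, simp add: mconst_def)

lemma mconst_mult_assoc: "mconst a * (mconst b * f) = mconst (a * b) * (f :: 'v::finite mfps)"
  by (simp add: mconst_mult mult.assoc)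

lemma mconst_power: "mconst a ^ n = (mconst (a ^ n) :: 'v::finite mfps)"
  by (induction n) (simp_all add: mconst_mult)

lemma mconst_numeral: "mconst (numeral n) = (numeral n :: 'v::finite mfps)"
  by (induction n) (simp_all only: mconst_add numeral.simps mconst_1)

lemma mcoeff_sum: "mcoeff (sum f A) m = (\<Sum>x\<in>A. mcoeff (f x :: 'v::finite mfps) m)"
  by (induction A rule: infinite_finite_induct) simp_all

lemma mcoeff_mvar_power_mult:
  "mcoeff (mvar v ^ k * f) m
     = (if m v < k then 0 else mcoeff f ((m :: 'v::finite \<Rightarrow> nat)(v := m v - k)))"
proof (induction k arbitrary: m)
  case (Suc k)
  have "mcoeff (mvar v ^ Suc k * f) m = mcoeff (mvar v * (mvar v ^ k * f)) m"
    by (simp add: mult.assoc)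
  moreover have "mcoeff (mvar v * (mvar v ^ k * f)) m
      = (if m v < Suc k then 0 else mcoeff f (m(v := m v - Suc k)))"
    unfolding mcoeff_mvar_mult Suc.IH by (cases "m v") simp_all
  ultimately show ?case
    by (simp only:)
qed simp

lemma mderiv_add: "mderiv v (f + g) = mderiv v f + mderiv v (g :: 'v::finite mfps)"
  by (rule mfps_eqI) (simp add: algebra_simps)

lemma mderiv_diff: "mderiv v (f - g) = mderiv v f - mderiv v (g :: 'v::finite mfps)"
  by (rule mfps_eqI) (simp add: algebra_simps)

lemma mderiv_0 [simp]: "mderiv v 0 = (0 :: 'v::finite mfps)"
  by (rule mfps_eqI) simp

lemma mderiv_mconst_mult: "mderiv v (mconst c * f) = mconst c * mderiv v (f :: 'v::finite mfps)"
  by (rule mfps_eqI) (simp add: mcoeff_mconst_mult)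

lemma mderiv_mconst [simp]: "mderiv v (mconst c) = (0 :: 'v::finite mfps)"
  by (rule mfps_eqI) (auto simp: mconst_def fun_eq_iff)

lemma mderiv_mvar: "mderiv v (mvar u) = (if v = u then 1 else 0 :: 'v::finite mfps)"
proof (rule mfps_eqI)
  fix m
  have "m(v := Suc (m v)) = (\<lambda>_. 0)(u := 1) \<longleftrightarrow> v = u \<and> m = (\<lambda>_. 0)"
    by (auto simp: fun_eq_iff split: if_splits)
  then show "mcoeff (mderiv v (mvar u)) m = mcoeff (if v = u then 1 else 0) m"
    by (simp add: mvar_def one_mfps_def)
qed

text \<open>The core of the Leibniz rule: splittings with \<open>a v = 0\<close> are killed by the
  factor \<open>of_nat (a v)\<close>, and the others are the splittings of m with one unit of v
  added to the first part.\<close>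

lemma sum_splits_Suc:
  fixes f g :: "('v::finite \<Rightarrow> nat) \<Rightarrow> complex"
  shows "(\<Sum>(a, b)\<in>splits (m(v := Suc (m v))). of_nat (a v) * f a * g b)
       = (\<Sum>(a, b)\<in>splits m. of_nat (Suc (a v)) * f (a(v := Suc (a v))) * g b)"
proof -
  let ?S = "{(a, b). (a, b) \<in> splits (m(v := Suc (m v))) \<and> a v \<noteq> 0}"
  have "(\<Sum>(a, b)\<in>splits (m(v := Suc (m v))). of_nat (a v) * f a * g b)
      = (\<Sum>(a, b)\<in>?S. of_nat (a v) * f a * g b)"
    by (rule sum.mono_neutral_right) auto
  also have "\<dots> = (\<Sum>(a, b)\<in>splits m. of_nat (Suc (a v)) * f (a(v := Suc (a v))) * g b)"
    by (rule sum.reindex_bij_witness[of _ "\<lambda>(a, b). (a(v := Suc (a v)), b)"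
          "\<lambda>(a, b). (a(v := a v - 1), b)"])
      (auto simp: splits_def fun_eq_iff split: if_splits)
  finally show ?thesis .
qed

lemma mderiv_mult: "mderiv v (f * g) = mderiv v f * g + f * mderiv v (g :: 'v::finite mfps)"
proof (rule mfps_eqI)
  fix m
  let ?m = "m(v := Suc (m v))"
  let ?h = "\<lambda>f g :: 'v mfps. \<Sum>(a, b)\<in>splits ?m. of_nat (a v) * mcoeff f a * mcoeff g b"
  have h: "?h f g = mcoeff (mderiv v f * g) m" for f g
    unfolding sum_splits_Suc by (simp add: times_mfps_def)
  have "?h g f = (\<Sum>(a, b)\<in>splits ?m. of_nat (b v) * mcoeff f a * mcoeff g b)"
    by (rule sum.reindex_bij_witness[of _ prod.swap prod.swap]) (auto simp: splits_def add.commute)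
  \<comment> \<open>In every splitting \<open>a v + b v = Suc (m v)\<close>, so the two weighted
    sums combine to the factor that \<open>mderiv\<close> produces.\<close>
  then have "mcoeff (mderiv v f * g) m + mcoeff (mderiv v g * f) m
      = (\<Sum>(a, b)\<in>splits ?m. of_nat (a v + b v) * mcoeff f a * mcoeff g b)"
    unfolding h[symmetric] by (simp add: sum.distrib[symmetric] case_prod_unfold algebra_simps)
  also have "\<dots> = (\<Sum>(a, b)\<in>splits ?m. of_nat (Suc (m v)) * (mcoeff f a * mcoeff g b))"
    by (rule sum.cong) (auto simp: splits_def fun_eq_iff simp flip: of_nat_add of_nat_Suc)
  also have "\<dots> = mcoeff (mderiv v (f * g)) m"
    by (simp add: times_mfps_def sum_distrib_left case_prod_unfold)
  finally show "mcoeff (mderiv v (f * g)) m = mcoeff (mderiv v f * g + f * mderiv v g) m"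
    by (simp add: mult.commute)
qed

section \<open>Weights\<close>

definition wt :: "nat \<Rightarrow> nat \<Rightarrow> (coord \<Rightarrow> nat) \<Rightarrow> nat" where
  "wt a b m = a * deg_xh m + b * m Eps"

definition wt_ge :: "nat \<Rightarrow> nat \<Rightarrow> nat \<Rightarrow> coord mfps set" where
  "wt_ge a b N = {f. \<forall>m. mcoeff f m \<noteq> 0 \<longrightarrow> N \<le> wt a b m}"

lemma ord_ge_eq_wt_ge: "ord_ge = wt_ge 1 1"
  by (simp add: fun_eq_iff ord_ge_def wt_ge_def wt_def deg_def deg_xh_def add_ac)

lemma ord_ge_xh_eq_wt_ge: "ord_ge_xh = wt_ge 1 0"
  by (simp add: fun_eq_iff ord_ge_xh_def wt_ge_def wt_def)

lemma wt_geI: "(\<And>m. wt a b m < N \<Longrightarrow> mcoeff f m = 0) \<Longrightarrow> f \<in> wt_ge a b N"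
  by (force simp: wt_ge_def)

lemma wt_geD: "f \<in> wt_ge a b N \<Longrightarrow> wt a b m < N \<Longrightarrow> mcoeff f m = 0"
  by (force simp: wt_ge_def)

lemma wt_ge_0 [simp]: "f \<in> wt_ge a b 0"
  by (simp add: wt_ge_def)

lemma zero_wt_ge [simp]: "0 \<in> wt_ge a b N"
  by (simp add: wt_ge_def)

lemma wt_ge_add: "f \<in> wt_ge a b N \<Longrightarrow> g \<in> wt_ge a b N \<Longrightarrow> f + g \<in> wt_ge a b N"
  by (intro wt_geI) (simp add: wt_geD)

lemma wt_ge_diff: "f \<in> wt_ge a b N \<Longrightarrow> g \<in> wt_ge a b N \<Longrightarrow> f - g \<in> wt_ge a b N"
  by (intro wt_geI) (simp add: wt_geD)

lemma wt_ge_diffD: "f - g \<in> wt_ge a b N \<Longrightarrow> g \<in> wt_ge a b N \<Longrightarrow> f \<in> wt_ge a b N"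
  using wt_ge_add[of "f - g" a b N g] by simp

lemma wt_ge_mconst_mult: "f \<in> wt_ge a b N \<Longrightarrow> mconst c * f \<in> wt_ge a b N"
  by (intro wt_geI) (simp add: wt_geD mcoeff_mconst_mult)

lemma wt_ge_mono: "f \<in> wt_ge a b N \<Longrightarrow> M \<le> N \<Longrightarrow> f \<in> wt_ge a b M"
  by (intro wt_geI) (simp add: wt_geD)

lemma wt_ge_mult:
  assumes "f \<in> wt_ge a b N" "g \<in> wt_ge a b M"
  shows "f * g \<in> wt_ge a b (N + M)"
proof (rule wt_geI)
  fix m assume m: "wt a b m < N + M"
  have "mcoeff f p * mcoeff g q = 0" if "(p, q) \<in> splits m" for p q
  proof -
    have "wt a b m = wt a b p + wt a b q"
      using that by (auto simp: splits_def wt_def deg_xh_def algebra_simps)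
    then have "wt a b p < N \<or> wt a b q < M"
      using m by linarith
    then show ?thesis
      using assms wt_geD by auto
  qed
  then show "mcoeff (f * g) m = 0"
    by (simp add: times_mfps_def sum.neutral case_prod_unfold)
qed

text \<open>The first equation has sums on both sides, so that lowering the exponent of \<hbar>
  involves no truncated subtraction.\<close>

lemma wt_upd:
  "wt a b (m(Hbar := n)) + 2 * a * m Hbar = wt a b m + 2 * a * n"
  "v \<in> {X1, X2, Xi1, Xi2} \<Longrightarrow> wt a b (m(v := Suc (m v))) = wt a b m + a"
  by (auto simp: wt_def deg_xh_def algebra_simps)

lemma wt_ge_mderiv:
  assumes "f \<in> wt_ge a b N" "v \<in> {X1, X2, Xi1, Xi2}"
  shows "mderiv v f \<in> wt_ge a b (N - a)"
  using assms by (intro wt_geI) (auto simp: wt_upd(2) intro!: wt_geD)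

text \<open>Each factor of the box differentiates both arguments once in a phase space variable, at
  the price a for each.\<close>

lemma wt_ge_box_pow:
  assumes "f \<in> wt_ge a b N" "g \<in> wt_ge a b M"
  shows "box_pow k f g \<in> wt_ge a b (N + M - 2 * a * k)"
  using assms
proof (induction k arbitrary: f g N M)
  case 0
  then show ?case by (simp add: wt_ge_mult)
next
  case (Suc k)
  have *: "box_pow k (mderiv u f) (mderiv v g) \<in> wt_ge a b (N + M - 2 * a * Suc k)"
    if "u \<in> {X1, X2, Xi1, Xi2}" "v \<in> {X1, X2, Xi1, Xi2}" for u v
    by (rule wt_ge_mono[OF Suc.IH[OF wt_ge_mderiv[OF Suc.prems(1) that(1)]
            wt_ge_mderiv[OF Suc.prems(2) that(2)]]]) (simp add: diff_le_mono)
  show ?case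
    unfolding box_pow.simps by (intro wt_ge_add wt_ge_diff *) simp_all
qed

lemma box_pow_add_left: "box_pow k (f + f') g = box_pow k f g + box_pow k f' g"
  by (induction k arbitrary: f f' g) (simp_all add: mderiv_add algebra_simps)

lemma box_pow_add_right: "box_pow k f (g + g') = box_pow k f g + box_pow k f g'"
  by (induction k arbitrary: f g g') (simp_all add: mderiv_add algebra_simps)

lemma box_pow_0_left [simp]: "box_pow k 0 g = 0"
  by (induction k arbitrary: g) simp_all

lemma box_pow_0_right [simp]: "box_pow k f 0 = 0"
  by (induction k arbitrary: f) simp_all

text \<open>Lets the bracket with \<open>H20\<close> in the first slot be read off from the one with
  \<open>H20\<close> in the second.\<close>

lemma box_pow_antisym: "box_pow k f g = (-1) ^ k * box_pow k g f"
proof (induction k arbitrary: f g)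
  case 0
  then show ?case by (simp add: mult.commute)
next
  case (Suc k)
  show ?case
    unfolding box_pow.simps Suc[of "mderiv _ f"] by (simp add: algebra_simps)
qed

section \<open>The bracket\<close>

text \<open>The Taylor coefficients of 2 sin(t/2): 1 for k = 1 and 0 for even k.\<close>

definition moyal_coeff :: "nat \<Rightarrow> complex" where
  "moyal_coeff k = 2 * of_real (sin_coeff k) * (1/2) ^ k"

lemma moyal_term:
  "mconst (2 * of_real (sin_coeff k)) * (mconst (1/2) * mvar Hbar) ^ k * f
     = mconst (moyal_coeff k) * (mvar Hbar ^ k * f)"
  by (simp add: moyal_coeff_def power_mult_distrib mconst_power mconst_mult mult_ac)

lemma mcoeff_weyl_bracket:
  "mcoeff (weyl_bracket f g) m = - \<i> * (\<Sum>k\<le>m Hbar. moyal_coeff k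
      * mcoeff (box_pow k f g) (m(Hbar := m Hbar - k)))"
proof -
  have "(\<Sum>k. mcoeff (mconst (moyal_coeff k) * (mvar Hbar ^ k * box_pow k f g)) m)
      = (\<Sum>k\<le>m Hbar. mcoeff (mconst (moyal_coeff k) * (mvar Hbar ^ k * box_pow k f g)) m)"
    by (rule suminf_finite) (auto simp: mcoeff_mconst_mult mcoeff_mvar_power_mult)
  also have "\<dots> = (\<Sum>k\<le>m Hbar. moyal_coeff k * mcoeff (box_pow k f g) (m(Hbar := m Hbar - k)))"
    by (rule sum.cong) (auto simp: mcoeff_mconst_mult mcoeff_mvar_power_mult)
  finally show ?thesis
    by (simp add: weyl_bracket_def mcoeff_mconst_mult moyal_term)
qed

text \<open>Division by \<hbar> shifts the exponent, hence the range up to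
  \<open>Suc (m Hbar)\<close>; the factors \<i> and -\<i> cancel.\<close>

lemma mcoeff_ad_over_hbar:
  "mcoeff (ad_over_hbar f g) m = (\<Sum>k\<le>Suc (m Hbar). moyal_coeff k
      * mcoeff (box_pow k f g) (m(Hbar := Suc (m Hbar) - k)))"
  by (simp add: ad_over_hbar_def mdiv_var_def mcoeff_mconst_mult mcoeff_weyl_bracket)

lemma ad_over_hbar_add_left: "ad_over_hbar (f + f') g = ad_over_hbar f g + ad_over_hbar f' g"
  by (rule mfps_eqI) (simp add: mcoeff_ad_over_hbar box_pow_add_left algebra_simps sum.distrib)

lemma ad_over_hbar_add_right: "ad_over_hbar f (g + g') = ad_over_hbar f g + ad_over_hbar f g'"
  by (rule mfps_eqI) (simp add: mcoeff_ad_over_hbar box_pow_add_right algebra_simps sum.distrib)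

lemma ad_over_hbar_0 [simp]: "ad_over_hbar f 0 = 0" "ad_over_hbar 0 g = 0"
  by (rule mfps_eqI, simp add: mcoeff_ad_over_hbar)+

lemma ad_over_hbar_diff_left: "ad_over_hbar (f - f') g = ad_over_hbar f g - ad_over_hbar f' g"
  using ad_over_hbar_add_left[of "f - f'" f' g] by (simp add: algebra_simps)

lemma ad_over_hbar_diff_right: "ad_over_hbar f (g - g') = ad_over_hbar f g - ad_over_hbar f g'"
  using ad_over_hbar_add_right[of f "g - g'" g'] by (simp add: algebra_simps)

lemma moyal_coeff_0 [simp]: "moyal_coeff 0 = 0"
  by (simp add: moyal_coeff_def)

text \<open>The term k = 0 has coefficient 0 and every other one differentiates f, so f enters only
  through its phase space derivatives. This allows pure powers of \<epsilon> to be discarded from a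
  generator.\<close>

lemma ad_over_hbar_cong_left:
  assumes "\<And>v. v \<in> {X1, X2, Xi1, Xi2} \<Longrightarrow> mderiv v f = mderiv v f'"
  shows "ad_over_hbar f = ad_over_hbar f'"
proof -
  have "moyal_coeff k * mcoeff (box_pow k f g) m = moyal_coeff k * mcoeff (box_pow k f' g) m" for k g m
    using assms by (cases k) simp_all
  then show ?thesis
    by (intro ext mfps_eqI) (simp only: mcoeff_ad_over_hbar)
qed

text \<open>The k-th Moyal term loses 2 a k by its derivatives, regains it from \<hbar>^k and loses
  2 a by the division by \<hbar>; the net cost does not depend on k.\<close>

lemma wt_ge_ad_over_hbar:
  assumes "f \<in> wt_ge a b N" "g \<in> wt_ge a b M" "K + 2 * a \<le> N + M"
  shows "ad_over_hbar f g \<in> wt_ge a b K"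
proof (rule wt_geI)
  fix m assume m: "wt a b m < K"
  have "mcoeff (box_pow k f g) (m(Hbar := Suc (m Hbar) - k)) = 0" if "k \<le> Suc (m Hbar)" for k
  proof (rule wt_geD[OF wt_ge_box_pow[OF assms(1,2)]])
    have "wt a b (m(Hbar := Suc (m Hbar) - k)) + 2 * a * k = wt a b m + 2 * a"
    proof -
      \<comment> \<open>The exponent of \<hbar> that is left, which turns the truncated difference
        into a sum.\<close>
      obtain c where c: "Suc (m Hbar) = c + k"
        using \<open>k \<le> Suc (m Hbar)\<close> le_iff_add by (metis add.commute)
      have "2 * a * c + 2 * a * k = 2 * a * m Hbar + 2 * a"
        using arg_cong[OF c, of "\<lambda>n. 2 * a * n"] by (simp add: algebra_simps)
      with c wt_upd(1)[of a b m c] show ?thesis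
        by simp
    qed
    then show "wt a b (m(Hbar := Suc (m Hbar) - k)) < N + M - 2 * a * k"
      using m assms(3) by linarith
  qed
  then show "mcoeff (ad_over_hbar f g) m = 0"
    by (simp add: mcoeff_ad_over_hbar)
qed

section \<open>The exponential\<close>

lemma wt_ge_ad_power:
  assumes "A \<in> wt_ge a b (2 * a + s)" "P \<in> wt_ge a b N"
  shows "(ad_over_hbar A ^^ l) P \<in> wt_ge a b (N + l * s)"
proof (induction l)
  case (Suc l)
  show ?case
    using wt_ge_ad_over_hbar[OF assms(1) Suc, of "N + Suc l * s"] by (simp add: algebra_simps)
qed (use assms in simp)

lemma mcoeff_exp_ad:
  assumes "A \<in> ord_ge 3" "deg m \<le> n"
  shows "mcoeff (exp_ad A P) m = (\<Sum>l\<le>n. mcoeff ((ad_over_hbar A ^^ l) P) m / fact l)"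
proof -
  have "mcoeff ((ad_over_hbar A ^^ l) P) m = 0" if "l > n" for l
    using wt_geD[OF wt_ge_ad_power[of A 1 1 1 P 0 l], of m] assms that
    by (simp add: ord_ge_eq_wt_ge wt_def deg_def deg_xh_def numeral_3_eq_3)
  then show ?thesis
    unfolding exp_ad_def mcoeff_Abs by (intro suminf_finite) auto
qed

text \<open>Convergence comes from \<open>ord_ge 3\<close>, the estimate from a possibly different
  weight in which each application gains s. The value s = 0 is allowed and yields mere
  invariance.\<close>

lemma wt_ge_exp_ad_minus:
  assumes "A \<in> ord_ge 3" "A \<in> wt_ge a b (2 * a + s)" "P \<in> wt_ge a b N"
  shows "exp_ad A P - (\<Sum>l<j. mconst (1 / fact l) * (ad_over_hbar A ^^ l) P) \<in> wt_ge a b (N + j * s)"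
proof (rule wt_geI)
  fix m assume m: "wt a b m < N + j * s"
  have z: "mcoeff ((ad_over_hbar A ^^ l) P) m = 0" if "l \<ge> j" for l
    by (rule wt_geD[OF wt_ge_ad_power[OF assms(2,3)]])
      (use m that mult_le_mono1[OF that, of s] in linarith)
  \<comment> \<open>The bound \<open>deg m + j\<close> is large enough for the exponential to be
    complete at m and for the first j terms to be included.\<close>
  have "mcoeff (exp_ad A P) m = (\<Sum>l\<le>deg m + j. mcoeff ((ad_over_hbar A ^^ l) P) m / fact l)"
    using assms(1) by (rule mcoeff_exp_ad) simp
  also have "\<dots> = (\<Sum>l<j. mcoeff ((ad_over_hbar A ^^ l) P) m / fact l)"
    by (rule sum.mono_neutral_right) (auto simp: z)
  finally show "mcoeff (exp_ad A P - (\<Sum>l<j. mconst (1 / fact l) * (ad_over_hbar A ^^ l) P)) m = 0"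
    by (simp add: mcoeff_sum mcoeff_mconst_mult)
qed

lemma wt_ge_exp_ad:
  assumes "A \<in> ord_ge 3" "A \<in> wt_ge a b (2 * a)" "P \<in> wt_ge a b N"
  shows "exp_ad A P \<in> wt_ge a b N"
  using wt_ge_exp_ad_minus[of A a b 0 P N 0] assms by simp

lemma exp_ad_0: "exp_ad 0 P = P"
proof (rule mfps_eqI)
  fix m
  have "mcoeff ((ad_over_hbar 0 ^^ l) P) m / fact l = (if l = 0 then mcoeff P m else 0)" for l
    by (cases l) simp_all
  then show "mcoeff (exp_ad 0 P) m = mcoeff P m"
    by (subst mcoeff_exp_ad[OF _ order_refl]) (simp_all add: ord_ge_def)
qed

text \<open>Telescoping: \<open>A - A'\<close> applied to a power of order l + 2, plus A' applied to
  the previous difference. The order N + l - 1 starts harmlessly, since the difference at l = 0 is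
  zero.\<close>

lemma ad_power_diff:
  assumes "A \<in> ord_ge 3" "A' \<in> ord_ge 3" "A - A' \<in> ord_ge N" "P \<in> ord_ge 2"
  shows "(ad_over_hbar A ^^ l) P - (ad_over_hbar A' ^^ l) P \<in> ord_ge (N + l - 1)"
proof (induction l)
  case 0
  then show ?case by (simp add: ord_ge_eq_wt_ge)
next
  case (Suc l)
  let ?u = "(ad_over_hbar A ^^ l) P" and ?u' = "(ad_over_hbar A' ^^ l) P"
  note [simp] = ord_ge_eq_wt_ge
  have u: "?u \<in> wt_ge 1 1 (2 + l)"
    using wt_ge_ad_power[of A 1 1 1 P 2 l] assms by (simp add: numeral_3_eq_3)
  have "ad_over_hbar A ?u - ad_over_hbar A' ?u'
      = ad_over_hbar (A - A') ?u + ad_over_hbar A' (?u - ?u')"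
    by (simp add: ad_over_hbar_diff_left ad_over_hbar_diff_right)
  moreover have "ad_over_hbar (A - A') ?u \<in> wt_ge 1 1 (N + l)"
    by (rule wt_ge_ad_over_hbar[OF _ u, of _ N]) (use assms in simp_all)
  moreover have "ad_over_hbar A' (?u - ?u') \<in> wt_ge 1 1 (N + l)"
    by (rule wt_ge_ad_over_hbar[of _ 1 1 3 _ "N + l - 1"]) (use assms Suc in simp_all)
  ultimately show ?case
    by (simp add: wt_ge_add)
qed

text \<open>A change of the generator in order N is felt to leading order only through the bracket
  with H: the bracket with L and all powers from the second on have order at least N + 1. This
  drives both the induction on the degree and the passage to the limit.\<close>

lemma exp_ad_diff:
  assumes A: "A \<in> ord_ge 3" "A' \<in> ord_ge 3" "A - A' \<in> ord_ge N" and H: "H \<in> ord_ge 2" "L \<in> ord_ge 3"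
  shows "exp_ad A (H + L) - exp_ad A' (H + L) - ad_over_hbar (A - A') H \<in> ord_ge (N + 1)"
proof -
  let ?u = "\<lambda>l. (ad_over_hbar A ^^ l) (H + L)" and ?u' = "\<lambda>l. (ad_over_hbar A' ^^ l) (H + L)"
  let ?d = "ad_over_hbar (A - A')"
  note [simp] = ord_ge_eq_wt_ge
  have P: "H + L \<in> ord_ge 2"
    using H by (auto intro!: wt_ge_add elim: wt_ge_mono)
  show ?thesis
    unfolding ord_ge_eq_wt_ge
  proof (rule wt_geI)
    fix m assume m: "wt 1 1 m < N + 1"
    have dm: "wt 1 1 m = deg m"
      by (simp add: wt_def deg_def deg_xh_def)
    have z: "mcoeff (?u l) m / fact l - mcoeff (?u' l) m / fact l
        = (if l = 1 then mcoeff (?d H) m else 0)" for l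
    proof -
      consider "l = 0" | "l = 1" | "l \<ge> 2" by linarith
      then show ?thesis
      proof cases
        case 2
        have "?d L \<in> wt_ge 1 1 (N + 1)"
          by (rule wt_ge_ad_over_hbar[of _ _ _ N _ 3]) (use A H in auto)
        then have "mcoeff (?d L) m = 0"
          using m by (rule wt_geD)
        moreover have "mcoeff (?u 1) m - mcoeff (?u' 1) m = mcoeff (?d H) m + mcoeff (?d L) m"
          by (simp add: ad_over_hbar_diff_left ad_over_hbar_add_right)
        ultimately show ?thesis
          using 2 by simp
      next
        case 3
        have "mcoeff (?u l - ?u' l) m = 0"
          by (rule wt_geD[of _ 1 1 "N + l - 1"])
            (use ad_power_diff[OF A P, of l] m 3 in auto)
        with 3 show ?thesis
          by simp
      qed simp
    qed
    have "mcoeff (exp_ad A (H + L)) m - mcoeff (exp_ad A' (H + L)) m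
        = (\<Sum>l\<le>deg m + 1. mcoeff (?u l) m / fact l - mcoeff (?u' l) m / fact l)"
      by (subst (1 2) mcoeff_exp_ad[of _ _ "deg m + 1"]) (use A in \<open>simp_all add: sum_subtractf\<close>)
    also have "\<dots> = mcoeff (?d H) m"
      unfolding z by simp
    finally show "mcoeff (exp_ad A (H + L) - exp_ad A' (H + L) - ?d H) m = 0"
      by simp
  qed
qed

section \<open>The homological operator\<close>

definition hop :: "real \<Rightarrow> real \<Rightarrow> coord mfps \<Rightarrow> coord mfps" where
  "hop a b f = mconst (of_real a) * (mvar X1 * mderiv Xi1 f - mvar Xi1 * mderiv X1 f)
             + mconst (of_real b) * (mvar X2 * mderiv Xi2 f - mvar Xi2 * mderiv X2 f)"

lemma hop_0 [simp]: "hop a b 0 = 0"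
  by (simp add: hop_def)

lemma hop_add: "hop a b (f + g) = hop a b f + hop a b g"
  by (simp add: hop_def mderiv_add algebra_simps)

lemma hop_diff: "hop a b (f - g) = hop a b f - hop a b g"
  by (simp add: hop_def mderiv_diff algebra_simps)

lemma hop_mconst_mult: "hop a b (mconst c * f) = mconst c * hop a b f"
  unfolding hop_def mderiv_mconst_mult by (simp add: algebra_simps)

lemma hop_mult: "hop a b (f * g) = hop a b f * g + f * hop a b g"
  by (simp add: hop_def mderiv_mult algebra_simps)

lemma mderiv_mvar_power2: "mderiv v (mvar u ^ 2) = (if v = u then mconst 2 * mvar u else 0)"
  for u :: "'v::finite"
  by (simp add: power2_eq_square mderiv_mult mderiv_mvar mconst_numeral)

lemma mderiv_H20:
  "mderiv X1 (H20 a b) = mconst (of_real a) * mvar X1"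
  "mderiv Xi1 (H20 a b) = mconst (of_real a) * mvar Xi1"
  "mderiv X2 (H20 a b) = mconst (of_real b) * mvar X2"
  "mderiv Xi2 (H20 a b) = mconst (of_real b) * mvar Xi2"
  by (simp_all add: H20_def mderiv_add mderiv_mconst_mult mderiv_mvar_power2 mconst_mult_assoc)

lemma box_pow_H20_ge_3:
  assumes "k \<ge> 3"
  shows "box_pow k f (H20 a b) = 0"
proof -
  obtain j where "k = Suc (Suc (Suc j))"
    using assms by (metis Suc_le_D numeral_3_eq_3 Suc_le_mono)
  then show ?thesis
    by (simp add: mderiv_H20 mderiv_mconst_mult mderiv_mvar)
qed

lemma box_pow_1_H20: "box_pow (Suc 0) f (H20 a b) = hop a b f"
  by (simp add: mderiv_H20 hop_def algebra_simps)

text \<open>Even k have coefficient 0 and third derivatives of a quadratic polynomial vanish, so of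
  the whole Moyal series only the Poisson bracket survives.\<close>

lemma moyal_coeff_mult_box_pow_H20:
  "moyal_coeff k * mcoeff (box_pow k f (H20 a b)) m = (if k = 1 then mcoeff (hop a b f) m else 0)"
proof -
  consider "k = 0" | "k = 1" | "k = 2" | "k \<ge> 3" by linarith
  then show ?thesis
  proof cases
    case 2
    then show ?thesis
      by (simp only: One_nat_def box_pow_1_H20) (simp add: moyal_coeff_def sin_coeff_def)
  next
    case 3
    then show ?thesis by (simp add: moyal_coeff_def sin_coeff_def)
  next
    case 4
    then show ?thesis by (simp add: box_pow_H20_ge_3)
  qed simp
qed

lemma ad_over_hbar_H20: "ad_over_hbar f (H20 a b) = hop a b f"
  by (rule mfps_eqI) (simp add: mcoeff_ad_over_hbar moyal_coeff_mult_box_pow_H20 del: box_pow.simps sum.atMost_Suc)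

text \<open>The bracket is \<i> \<hbar> times \<open>hop a b f\<close>, and multiplication by
  \<hbar> is injective.\<close>

lemma weyl_bracket_H20_eq_0_iff: "weyl_bracket (H20 a b) f = 0 \<longleftrightarrow> hop a b f = 0"
proof -
  have "moyal_coeff k * mcoeff (box_pow k (H20 a b) f) m = - (if k = 1 then mcoeff (hop a b f) m else 0)"
    for k m
  proof -
    have "mcoeff ((-1) ^ k * g) m = (-1) ^ k * mcoeff g m" for g :: "coord mfps"
      by (cases "even k") simp_all
    then have "moyal_coeff k * mcoeff (box_pow k (H20 a b) f) m
        = (-1) ^ k * (moyal_coeff k * mcoeff (box_pow k f (H20 a b)) m)"
      by (subst box_pow_antisym) simp
    then show ?thesis
      unfolding moyal_coeff_mult_box_pow_H20 by simp
  qed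
  then have *: "mcoeff (weyl_bracket (H20 a b) f) m
      = (if m Hbar = 0 then 0 else \<i> * mcoeff (hop a b f) (m(Hbar := m Hbar - 1)))" for m
    by (simp add: mcoeff_weyl_bracket sum_negf)
  show ?thesis
  proof
    assume 0: "weyl_bracket (H20 a b) f = 0"
    show "hop a b f = 0"
    proof (rule mfps_eqI)
      fix m
      show "mcoeff (hop a b f) m = mcoeff 0 m"
        using *[of "m(Hbar := Suc (m Hbar))"] by (simp add: 0)
    qed
  next
    assume "hop a b f = 0"
    then show "weyl_bracket (H20 a b) f = 0"
      by (intro mfps_eqI) (simp add: *)
  qed
qed

lemma hop_H20: "hop a b (H20 a b) = 0"
  by (simp add: hop_def mderiv_H20 algebra_simps)

lemma mvar_wt_ge: "v \<in> {X1, X2, Xi1, Xi2} \<Longrightarrow> mvar v \<in> wt_ge a b a"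
  by (rule wt_geI) (auto simp: mvar_def wt_def deg_xh_def split: if_splits)

lemma H20_wt_ge: "H20 w w' \<in> wt_ge a b (2 * a)"
proof -
  have "mvar v ^ 2 \<in> wt_ge a b (2 * a)" if "v \<in> {X1, X2, Xi1, Xi2}" for v
    using wt_ge_mult[OF mvar_wt_ge mvar_wt_ge, OF that that, of a b]
    by (simp add: power2_eq_square mult_2)
  then show ?thesis
    unfolding H20_def by (intro wt_ge_add wt_ge_mconst_mult) auto
qed

lemma wt_ge_hop: "f \<in> wt_ge a b N \<Longrightarrow> hop w w' f \<in> wt_ge a b N"
  using wt_ge_ad_over_hbar[OF _ H20_wt_ge[of w w'], of f a b N N] by (simp add: ad_over_hbar_H20)

subsection \<open>Eigenvectors\<close>

text \<open>Only finite sums are generated; arbitrary series are reached through their homogeneous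
  parts.\<close>

inductive eigen_sum :: "real \<Rightarrow> real \<Rightarrow> coord mfps \<Rightarrow> bool" for a b where
  eigen: "hop a b f = mconst c * f \<Longrightarrow> eigen_sum a b f"
| add: "eigen_sum a b f \<Longrightarrow> eigen_sum a b g \<Longrightarrow> eigen_sum a b (f + g)"

lemma eigen_mult:
  assumes "hop a b f = mconst c * f" "hop a b g = mconst d * g"
  shows "hop a b (f * g) = mconst (c + d) * (f * g)"
  by (simp add: hop_mult assms mconst_add algebra_simps)

text \<open>Eigenvalues add under products because \<open>hop\<close> is a derivation. The finite
  sums of eigenvectors thus form an algebra, and to contain all polynomials it only has to contain
  the variables.\<close>

lemma eigen_sum_mult:
  assumes "eigen_sum a b f" "eigen_sum a b g"
  shows "eigen_sum a b (f * g)"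
  using assms(1)
proof induction
  case (eigen f c)
  show ?case
    using assms(2)
  proof induction
    case (eigen g d)
    show ?case
      by (rule eigen_sum.eigen[OF eigen_mult]) fact+
  next
    case (add g g')
    then show ?case
      by (simp add: distrib_left eigen_sum.add)
  qed
next
  case (add f f')
  then show ?case
    by (simp add: distrib_right eigen_sum.add)
qed

lemma hop_mconst: "hop a b (mconst c) = mconst 0 * mconst c"
  by (simp add: hop_def)

lemma eigen_sum_mconst: "eigen_sum a b (mconst c)"
  by (rule eigen_sum.eigen[OF hop_mconst])

lemma eigen_sum_power: "eigen_sum a b f \<Longrightarrow> eigen_sum a b (f ^ n)"
  by (induction n) (auto intro: eigen_sum_mult eigen_sum_mconst[of a b 1, simplified])

lemma eigen_sum_sum: "(\<And>x. x \<in> A \<Longrightarrow> eigen_sum a b (f x)) \<Longrightarrow> eigen_sum a b (sum f A)"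
  by (induction A rule: infinite_finite_induct)
    (auto intro: eigen_sum.add eigen_sum_mconst[of a b 0, simplified])

lemma mcnj_z: "mcnj z1 = mvar X1 - mconst \<i> * mvar Xi1" "mcnj z2 = mvar X2 - mconst \<i> * mvar Xi2"
  by (rule mfps_eqI; auto simp: mcnj_def z1_def z2_def mcoeff_mconst_mult mvar_def)+

lemma mconst_ii: "mconst \<i> * (mconst \<i> * f) = - (f :: 'v::finite mfps)"
  by (simp add: mconst_mult_assoc mconst_minus)

lemma hop_z:
  "hop a b z1 = mconst (\<i> * a) * z1" "hop a b (mcnj z1) = mconst (- \<i> * a) * mcnj z1"
  "hop a b z2 = mconst (\<i> * b) * z2" "hop a b (mcnj z2) = mconst (- \<i> * b) * mcnj z2"
  unfolding mcnj_z
  by (simp_all add: z1_def z2_def hop_def mderiv_add mderiv_diff mderiv_mconst_mult mderiv_mvar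
      algebra_simps mconst_mult mconst_minus mconst_ii)

lemma mvar_eq_z:
  "mvar X1 = mconst (1/2) * (z1 + mcnj z1)" "mvar Xi1 = mconst (- \<i>/2) * (z1 - mcnj z1)"
  "mvar X2 = mconst (1/2) * (z2 + mcnj z2)" "mvar Xi2 = mconst (- \<i>/2) * (z2 - mcnj z2)"
proof -
  have "z1 + mcnj z1 = mconst 2 * mvar X1" "z2 + mcnj z2 = mconst 2 * mvar X2"
    "z1 - mcnj z1 = mconst (2 * \<i>) * mvar Xi1" "z2 - mcnj z2 = mconst (2 * \<i>) * mvar Xi2"
    unfolding mcnj_z by (simp_all add: z1_def z2_def mconst_mult mconst_numeral)
  then show
    "mvar X1 = mconst (1/2) * (z1 + mcnj z1)" "mvar Xi1 = mconst (- \<i>/2) * (z1 - mcnj z1)"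
    "mvar X2 = mconst (1/2) * (z2 + mcnj z2)" "mvar Xi2 = mconst (- \<i>/2) * (z2 - mcnj z2)"
    by (simp_all add: mconst_mult_assoc)
qed

lemma eigen_sum_mvar: "eigen_sum a b (mvar v)"
proof (cases v)
  case X1
  show ?thesis
    unfolding X1 mvar_eq_z
    by (intro eigen_sum_mult eigen_sum_mconst eigen_sum.add eigen_sum.eigen[OF hop_z(1)] eigen_sum.eigen[OF hop_z(2)])
next
  case X2
  show ?thesis
    unfolding X2 mvar_eq_z
    by (intro eigen_sum_mult eigen_sum_mconst eigen_sum.add eigen_sum.eigen[OF hop_z(3)] eigen_sum.eigen[OF hop_z(4)])
next
  case Xi1
  \<comment> \<open>The difference is rewritten as a sum, the only combination for which
    \<open>eigen_sum\<close> has a rule.\<close>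
  have "mvar Xi1 = mconst (- \<i>/2) * (z1 + mconst (-1) * mcnj z1)"
    unfolding mvar_eq_z by (simp add: mconst_minus)
  then show ?thesis
    unfolding Xi1
    by (simp only:) (intro eigen_sum_mult eigen_sum_mconst eigen_sum.add eigen_sum.eigen[OF hop_z(1)] eigen_sum.eigen[OF hop_z(2)])
next
  case Xi2
  have "mvar Xi2 = mconst (- \<i>/2) * (z2 + mconst (-1) * mcnj z2)"
    unfolding mvar_eq_z by (simp add: mconst_minus)
  then show ?thesis
    unfolding Xi2
    by (simp only:) (intro eigen_sum_mult eigen_sum_mconst eigen_sum.add eigen_sum.eigen[OF hop_z(3)] eigen_sum.eigen[OF hop_z(4)])
qed (rule eigen_sum.eigen[of _ _ _ 0]; simp add: hop_def mderiv_mvar)+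

text \<open>A component with eigenvalue c \<noteq> 0 is the image of 1/c times itself; one with
  eigenvalue 0 lies in the kernel already.\<close>

lemma eigen_sum_decomp:
  assumes "eigen_sum a b f"
  shows "\<exists>g. hop a b (f - hop a b g) = 0"
  using assms
proof induction
  case (eigen f c)
  show ?case
  proof (cases "c = 0")
    case True
    with eigen show ?thesis
      by (intro exI[of _ 0]) simp
  next
    case False
    with eigen show ?thesis
      by (intro exI[of _ "mconst (1/c) * f"]) (simp add: hop_mconst_mult mconst_mult_assoc)
  qed
next
  case (add f f')
  then obtain g g' where "hop a b (f - hop a b g) = 0" "hop a b (f' - hop a b g') = 0"
    by blast
  then have "hop a b (f + f' - hop a b (g + g')) = 0"
    by (simp add: hop_add hop_diff)
  then show ?case ..
qed

section \<open>Semisimplicity of the eigenvalue 0\<close>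

definition hop_shift :: "real \<Rightarrow> real \<Rightarrow> complex \<Rightarrow> coord mfps \<Rightarrow> coord mfps" where
  "hop_shift a b c f = hop a b f - mconst c * f"

lemma hop_shift_commute: "hop_shift a b c (hop_shift a b d f) = hop_shift a b d (hop_shift a b c f)"
  unfolding hop_shift_def hop_diff hop_mconst_mult by (simp add: algebra_simps)

lemma hop_shift_add: "hop_shift a b c (f + g) = hop_shift a b c f + hop_shift a b c g"
  by (simp add: hop_shift_def hop_add algebra_simps)

lemma foldr_hop_shift_add:
  "foldr (hop_shift a b) cs (f + g) = foldr (hop_shift a b) cs f + foldr (hop_shift a b) cs g"
  by (induction cs) (simp_all add: hop_shift_add)

lemma foldr_hop_shift_0: "foldr (hop_shift a b) cs 0 = 0"
  using foldr_hop_shift_add[of a b cs 0 0] by simp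

lemma foldr_hop_shift_commute:
  "foldr (hop_shift a b) cs (foldr (hop_shift a b) ds f) = foldr (hop_shift a b) ds (foldr (hop_shift a b) cs f)"
proof (induction cs)
  case (Cons c cs)
  have "hop_shift a b c (foldr (hop_shift a b) ds f) = foldr (hop_shift a b) ds (hop_shift a b c f)" for f
    by (induction ds) (simp_all, metis hop_shift_commute)
  then show ?case
    by (simp add: Cons.IH)
qed simp

text \<open>A sum of eigenvectors is annihilated by a polynomial in \<^term>\<open>hop a b\<close> with at most a simple
  root at 0, so 0 is a semisimple eigenvalue.\<close>

lemma eigen_sum_annihilated:
  assumes "eigen_sum a b f"
  shows "\<exists>cs. 0 \<notin> set cs \<and> foldr (hop_shift a b) cs (hop a b f) = 0"
  using assms
proof induction
  case (eigen f c)
  show ?case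
  proof (cases "c = 0")
    case True
    with eigen show ?thesis
      by (intro exI[of _ "[]"]) simp
  next
    case False
    with eigen show ?thesis
      by (intro exI[of _ "[c]"]) (simp add: hop_shift_def hop_mconst_mult)
  qed
next
  case (add f f')
  then obtain cs cs' where "0 \<notin> set cs" "foldr (hop_shift a b) cs (hop a b f) = 0"
    "0 \<notin> set cs'" "foldr (hop_shift a b) cs' (hop a b f') = 0"
    by blast
  \<comment> \<open>The product of both polynomials works: its factors commute, so each polynomial
    can be applied first to the summand that it annihilates.\<close>
  then show ?case
    by (intro exI[of _ "cs @ cs'"])
      (simp add: hop_add foldr_hop_shift_add foldr_hop_shift_0,
        simp add: foldr_hop_shift_commute[of a b cs cs'] foldr_hop_shift_0)
qed

text \<open>On the kernel of \<open>hop\<close> the factor with root c is multiplication by -c. The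
  annihilating polynomial therefore multiplies \<open>hop a b f\<close> by a nonzero
  constant.\<close>

lemma hop_hop_eq_0:
  assumes "eigen_sum a b f" "hop a b (hop a b f) = 0"
  shows "hop a b f = 0"
proof -
  obtain cs where cs: "0 \<notin> set cs" "foldr (hop_shift a b) cs (hop a b f) = 0"
    using eigen_sum_annihilated[OF assms(1)] by blast
  have "foldr (hop_shift a b) cs u = mconst (\<Prod>c\<leftarrow>cs. - c) * u" if "hop a b u = 0" for u
    by (induction cs) (simp_all add: hop_shift_def hop_mconst_mult that mconst_mult_assoc mconst_minus)
  with cs(2) assms(2) have 0: "mconst (\<Prod>c\<leftarrow>cs. - c) * hop a b f = 0"
    by simp
  have "(\<Prod>c\<leftarrow>cs. - c) \<noteq> 0"
    using cs(1) by (induction cs) auto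
  with 0 show ?thesis
    by (intro mfps_eqI) (metis mcoeff_mconst_mult mcoeff_simps(1) mult_eq_0_iff)
qed

subsection \<open>Homogeneous parts\<close>

definition hpart :: "nat \<Rightarrow> coord mfps \<Rightarrow> coord mfps" where
  "hpart N f = Abs_mfps (\<lambda>m. if deg m = N then mcoeff f m else 0)"

lemma mcoeff_hpart: "mcoeff (hpart N f) m = (if deg m = N then mcoeff f m else 0)"
  by (simp add: hpart_def)

lemma mcoeff_mvar_mderiv:
  "mcoeff (mvar u * mderiv v f) m = (if m u = 0 then 0
     else of_nat (Suc ((m(u := m u - 1)) v)) * mcoeff f (m(u := m u - 1, v := Suc ((m(u := m u - 1)) v))))"
  by (simp add: mcoeff_mvar_mult)

text \<open>Each \<open>mvar u * mderiv v\<close> trades one phase space variable for another and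
  leaves the degree unchanged.\<close>

lemma hpart_hop: "hpart N (hop a b f) = hop a b (hpart N f)"
proof (rule mfps_eqI)
  fix m
  have "mcoeff (mvar u * mderiv v (hpart N f)) m
      = (if deg m = N then mcoeff (mvar u * mderiv v f) m else 0)"
    if "u \<in> {X1, X2, Xi1, Xi2}" "v \<in> {X1, X2, Xi1, Xi2}" for u v
  proof -
    have "deg (m(u := m u - 1, v := Suc ((m(u := m u - 1)) v))) = deg m" if "m u \<noteq> 0"
      using that \<open>u \<in> _\<close> \<open>v \<in> _\<close> by (auto simp: deg_def)
    then show ?thesis
      by (simp only: mcoeff_mvar_mderiv mcoeff_hpart) simp
  qed
  then show "mcoeff (hpart N (hop a b f)) m = mcoeff (hop a b (hpart N f)) m"
    by (simp add: mcoeff_hpart hop_def mcoeff_mconst_mult)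
qed

lemma hpart_add: "hpart N (f + g) = hpart N f + hpart N g"
  by (rule mfps_eqI) (simp add: mcoeff_hpart)

lemma hpart_diff: "hpart N (f - g) = hpart N f - hpart N g"
  by (rule mfps_eqI) (simp add: mcoeff_hpart)

lemma hpart_hpart: "hpart N (hpart N f) = hpart N f"
  by (rule mfps_eqI) (simp add: mcoeff_hpart)

lemma hpart_0 [simp]: "hpart N 0 = 0"
  by (rule mfps_eqI) (simp add: mcoeff_hpart)

lemma hpart_eq_0: "f \<in> ord_ge (Suc N) \<Longrightarrow> hpart N f = 0"
  by (rule mfps_eqI) (force simp: mcoeff_hpart ord_ge_def)

lemma hpart_in_ord_ge: "hpart N f \<in> ord_ge N"
  by (auto simp: ord_ge_def mcoeff_hpart)

lemma ord_ge_Suc_iff: "f \<in> ord_ge (Suc N) \<longleftrightarrow> f \<in> ord_ge N \<and> hpart N f = 0"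
proof
  assume "f \<in> ord_ge N \<and> hpart N f = 0"
  then have "mcoeff f m \<noteq> 0 \<longrightarrow> N \<le> deg m" "deg m = N \<longrightarrow> mcoeff f m = 0" for m
    using mcoeff_hpart[of N f m] by (auto simp: ord_ge_def)
  then show "f \<in> ord_ge (Suc N)"
    unfolding ord_ge_def by (simp add: Suc_le_eq) (metis le_neq_implies_less)
qed (auto simp: hpart_eq_0, auto simp: ord_ge_def)

text \<open>With the final factor 1 every power stands to the left of a product, so
  \<open>mcoeff_mvar_power_mult\<close> evaluates all of them.\<close>

definition mmonom :: "(coord \<Rightarrow> nat) \<Rightarrow> coord mfps" where
  "mmonom m = mvar X1 ^ m X1 * (mvar X2 ^ m X2 * (mvar Xi1 ^ m Xi1 * (mvar Xi2 ^ m Xi2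
     * (mvar Eps ^ m Eps * (mvar Hbar ^ m Hbar * 1)))))"

lemma coord_fun_eq_iff: "m = m' \<longleftrightarrow> m X1 = m' X1 \<and> m X2 = m' X2 \<and> m Xi1 = m' Xi1 \<and> m Xi2 = m' Xi2
    \<and> m Eps = m' Eps \<and> m Hbar = m' Hbar"
proof
  assume R: "m X1 = m' X1 \<and> m X2 = m' X2 \<and> m Xi1 = m' Xi1 \<and> m Xi2 = m' Xi2
    \<and> m Eps = m' Eps \<and> m Hbar = m' Hbar"
  show "m = m'"
  proof
    fix v show "m v = m' v" using R by (cases v) simp_all
  qed
qed simp

lemma mcoeff_mmonom: "mcoeff (mmonom m) m' = (if m' = m then 1 else 0)"
proof (cases "\<forall>v. m v \<le> m' v")
  case True
  then have le: "\<not> m' v < m v" for v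
    by (simp add: not_less)
  have "m'(X1 := m' X1 - m X1, X2 := m' X2 - m X2, Xi1 := m' Xi1 - m Xi1, Xi2 := m' Xi2 - m Xi2,
      Eps := m' Eps - m Eps, Hbar := m' Hbar - m Hbar) = (\<lambda>v. m' v - m v)"
    by (simp add: coord_fun_eq_iff)
  then have "mcoeff (mmonom m) m' = mcoeff 1 (\<lambda>v. m' v - m v)"
    by (simp add: mmonom_def mcoeff_mvar_power_mult le del: mult_1_right)
  also have "\<dots> = (if m' = m then 1 else 0)"
    using True by (auto simp: one_mfps_def fun_eq_iff intro: antisym)
  finally show ?thesis .
next
  case False
  then obtain v where v: "m' v < m v"
    by (auto simp: not_le)
  then have "mcoeff (mmonom m) m' = 0"
    by (cases v) (simp_all add: mmonom_def mcoeff_mvar_power_mult del: mult_1_right)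
  with v show ?thesis by auto
qed

lemma finite_deg_eq: "finite {m. deg m = N}"
proof (rule finite_subset)
  have "m v \<le> deg m" for m v
    by (cases v) (simp_all add: deg_def)
  then show "{m. deg m = N} \<subseteq> {m. \<forall>v. m v \<in> {..N}}"
    by auto
  show "finite {m :: coord \<Rightarrow> nat. \<forall>v. m v \<in> {..N}}"
    using finite_PiE[of "UNIV :: coord set" "\<lambda>v. {..N}"] by (simp add: PiE_UNIV_domain Pi_def)
qed

text \<open>Only finitely many monomials have degree N, so a homogeneous part is a polynomial in the
  variables.\<close>

lemma eigen_sum_hpart: "eigen_sum a b (hpart N f)"
proof -
  have "hpart N f = (\<Sum>m | deg m = N. mconst (mcoeff f m) * mmonom m)"
    by (rule mfps_eqI)
      (simp add: mcoeff_hpart mcoeff_sum mcoeff_mconst_mult mcoeff_mmonom finite_deg_eq if_distrib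
        cong: if_cong)
  also have "eigen_sum a b \<dots>"
    unfolding mmonom_def using eigen_sum_mconst[of a b 1]
    by (intro eigen_sum_sum eigen_sum_mult eigen_sum_power eigen_sum_mconst eigen_sum_mvar) simp_all
  finally show ?thesis .
qed

section \<open>Normal forms\<close>

text \<open>Subtracting G of degree N from the generator changes the exponential by
  \<open>- hop a b G\<close> modulo order N + 1. So G is taken to cancel the part of degree N that
  lies in the image, leaving a kernel element.\<close>

lemma normal_form_step:
  assumes L: "L \<in> ord_ge 3" and A: "A \<in> ord_ge 3"
    and n: "hop a b (exp_ad A (H20 a b + L)) \<in> ord_ge N" "N \<ge> 3"
  shows "\<exists>A'\<in>ord_ge 3. A' - A \<in> ord_ge N \<and> hop a b (exp_ad A' (H20 a b + L)) \<in> ord_ge (Suc N)"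
proof -
  let ?E = "\<lambda>A. exp_ad A (H20 a b + L)"
  note [simp] = ord_ge_eq_wt_ge
  obtain g where g: "hop a b (hpart N (?E A) - hop a b g) = 0"
    using eigen_sum_decomp[OF eigen_sum_hpart] by blast
  \<comment> \<open>Since \<open>hop\<close> preserves degrees, a preimage may be cut down to its
    part of degree N.\<close>
  define G where "G = hpart N g"
  define A' where "A' = A - G"
  have G: "G \<in> wt_ge 1 1 N"
    using hpart_in_ord_ge[of N g] by (simp add: G_def)
  \<comment> \<open>Written as a difference so that \<open>wt_ge_diff\<close> and
    \<open>hop_diff\<close> apply.\<close>
  have dA: "A' - A = 0 - G"
    by (simp add: A'_def)
  have dA': "A' - A \<in> ord_ge N"
    unfolding dA using G by (simp add: wt_ge_diff del: diff_0)
  have A': "A' \<in> ord_ge 3"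
    unfolding A'_def using A wt_ge_mono[OF G n(2)] by (simp add: wt_ge_diff)
  have "?E A' - ?E A - hop a b (A' - A) \<in> ord_ge (N + 1)"
    using exp_ad_diff[OF A' A dA' _ L, of "H20 a b"] H20_wt_ge[of a b 1 1]
    by (simp add: ad_over_hbar_H20)
  moreover have "hop a b (A' - A) = - hop a b G"
    unfolding dA hop_diff by simp
  ultimately have D: "?E A' - ?E A + hop a b G \<in> wt_ge 1 1 (Suc N)"
    by simp
  have "hpart N (hop a b (?E A')) = hpart N (hop a b (?E A' - ?E A + hop a b G))
      + (hpart N (hop a b (?E A)) - hpart N (hop a b (hop a b G)))"
    by (simp add: hop_add hop_diff hpart_add hpart_diff)
  also have "hpart N (hop a b (?E A' - ?E A + hop a b G)) = 0"
    by (rule hpart_eq_0) (use wt_ge_hop[OF D] in simp)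
  also have "hpart N (hop a b (?E A)) - hpart N (hop a b (hop a b G))
      = hpart N (hop a b (hpart N (?E A) - hop a b g))"
    by (simp add: hpart_hop G_def hop_diff hpart_diff hpart_hpart)
  finally have 0: "hpart N (hop a b (?E A')) = 0"
    by (simp add: g)
  have "?E A' - ?E A \<in> wt_ge 1 1 N"
    using wt_ge_diff[OF wt_ge_mono[OF D] wt_ge_hop[OF G], of a b] by simp
  then have "hop a b (?E A' - ?E A) + hop a b (?E A) \<in> wt_ge 1 1 N"
    using n by (intro wt_ge_add[OF wt_ge_hop]) simp_all
  then have "hop a b (?E A') \<in> ord_ge (Suc N)"
    unfolding ord_ge_Suc_iff by (simp add: 0 hop_diff)
  with A' dA' show ?thesis
    by blast
qed

text \<open>The corrections have increasing order, so the generators converge coefficientwise, and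
  by \<open>exp_ad_diff\<close> their exponentials follow them.\<close>

lemma normal_form_exists:
  assumes L: "L \<in> ord_ge 3"
  shows "\<exists>A\<in>ord_ge 3. hop a b (exp_ad A (H20 a b + L)) = 0"
proof -
  let ?E = "\<lambda>A. exp_ad A (H20 a b + L)"
  let ?P = "\<lambda>n A. A \<in> ord_ge 3 \<and> hop a b (?E A) \<in> ord_ge (n + 3)"
  have "?P 0 0"
    using L wt_ge_hop[of L 1 1 3 a b] by (simp add: ord_ge_eq_wt_ge exp_ad_0 hop_add hop_H20)
  then have "\<exists>F. \<forall>n. ?P n (F n) \<and> F (Suc n) - F n \<in> ord_ge (n + 3)"
  proof (intro dependent_nat_choice)
    fix A n assume "?P n A"
    then show "\<exists>A'. ?P (Suc n) A' \<and> A' - A \<in> ord_ge (n + 3)"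
      using normal_form_step[OF L, of A a b "n + 3"] by auto
  qed blast
  then obtain F where F: "F n \<in> ord_ge 3" "hop a b (?E (F n)) \<in> ord_ge (n + 3)"
    "F (Suc n) - F n \<in> ord_ge (n + 3)" for n
    by blast
  have const: "mcoeff (F (n + j)) m = mcoeff (F n) m" if "deg m \<le> n" for n j m
  proof (induction j)
    case (Suc j)
    have "mcoeff (F (Suc (n + j)) - F (n + j)) m = 0"
      using F(3)[of "n + j"] that by (force simp: ord_ge_def)
    with Suc show ?case by simp
  qed simp
  \<comment> \<open>From index \<open>deg m\<close> on the coefficient at m is constant, so this is
    the limit of the sequence.\<close>
  define A where "A = Abs_mfps (\<lambda>m. mcoeff (F (deg m)) m)"
  have A_eq: "mcoeff A m = mcoeff (F n) m" if "deg m \<le> n" for m n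
    using const[of m "deg m" "n - deg m"] that by (simp add: A_def)
  have A: "A \<in> ord_ge 3"
    using F(1) by (auto simp: ord_ge_def A_def)
  have dA: "A - F n \<in> ord_ge (Suc n)" for n
    using A_eq[of _ n] by (auto simp: ord_ge_def not_less_eq_eq[symmetric])
  have "hop a b (?E A) \<in> wt_ge 1 1 (Suc n)" for n
  proof -
    have "?E A - ?E (F n) - hop a b (A - F n) \<in> wt_ge 1 1 (Suc n)"
      using exp_ad_diff[OF A F(1) dA _ L, of "H20 a b" n] H20_wt_ge[of a b 1 1]
      by (auto simp: ad_over_hbar_H20 ord_ge_eq_wt_ge intro: wt_ge_mono)
    moreover have "hop a b (A - F n) \<in> wt_ge 1 1 (Suc n)"
      using wt_ge_hop dA by (simp add: ord_ge_eq_wt_ge)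
    ultimately have "?E A - ?E (F n) \<in> wt_ge 1 1 (Suc n)"
      by (rule wt_ge_diffD)
    then have "hop a b (?E A) - hop a b (?E (F n)) \<in> wt_ge 1 1 (Suc n)"
      unfolding hop_diff[symmetric] by (rule wt_ge_hop)
    moreover have "hop a b (?E (F n)) \<in> wt_ge 1 1 (Suc n)"
      using F(2)[of n] by (auto simp: ord_ge_eq_wt_ge intro: wt_ge_mono)
    ultimately show ?thesis
      by (rule wt_ge_diffD)
  qed
  then have "mcoeff (hop a b (?E A)) m = 0" for m
    using wt_geD lessI by blast
  then have "hop a b (?E A) = 0"
    by (intro mfps_eqI) simp
  with A show ?thesis
    by blast
qed

lemma quantum_BGNF_exists:
  assumes "L \<in> ord_ge 3"
  shows "\<exists>Q. quantum_BGNF a b (H20 a b + L) Q"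
proof -
  let ?P = "H20 a b + L"
  obtain A where A: "A \<in> ord_ge 3" "hop a b (exp_ad A ?P) = 0"
    using normal_form_exists[OF assms] by blast
  define K where "K = exp_ad A ?P - H20 a b"
  note [simp] = ord_ge_eq_wt_ge
  have "?P \<in> wt_ge 1 1 2"
    using H20_wt_ge[of a b 1 1] assms by (auto intro!: wt_ge_add elim: wt_ge_mono)
  then have "exp_ad A ?P - ?P \<in> wt_ge 1 1 3"
    using wt_ge_exp_ad_minus[of A 1 1 1 ?P 2 1] A(1) by simp
  then have "K \<in> ord_ge 3"
    using wt_ge_add[of "exp_ad A ?P - ?P" 1 1 3 L] assms by (simp add: K_def algebra_simps)
  moreover have "hop a b K = 0"
    by (simp add: K_def hop_diff A(2) hop_H20)
  ultimately show ?thesis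
    unfolding quantum_BGNF_def weyl_bracket_H20_eq_0_iff using assms A(1)
    by (intro exI[of _ "H20 a b + K"] bexI[of _ L] bexI[of _ K] conjI bexI[of _ A])
      (simp_all add: K_def)
qed

text \<open>Two applications raise the weight 2a of \<open>H20 + L\<close> by 2, and the bracket of
  A with L has weight at least (2a + 1) + (2a + 1) - 2a. The weight (1, 1) gives the cubic part of
  the normal form, the weight (k - 1, 1) its linear terms.\<close>

lemma exp_ad_H20_first_order:
  assumes "A \<in> ord_ge 3" "A \<in> wt_ge a b (2 * a + 1)" "L \<in> wt_ge a b (2 * a + 1)"
  shows "exp_ad A (H20 w w' + L) - (H20 w w' + L + hop w w' A) \<in> wt_ge a b (2 * a + 2)"
proof -
  have "H20 w w' + L \<in> wt_ge a b (2 * a)"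
    using H20_wt_ge wt_ge_mono[OF assms(3)] by (simp add: wt_ge_add)
  then have "exp_ad A (H20 w w' + L) - (H20 w w' + L + (hop w w' A + ad_over_hbar A L))
      \<in> wt_ge a b (2 * a + 2)"
    using wt_ge_exp_ad_minus[OF assms(1,2), of "H20 w w' + L" "2 * a" 2]
    by (simp add: numeral_2_eq_2 ad_over_hbar_add_right ad_over_hbar_H20)
  moreover have "ad_over_hbar A L \<in> wt_ge a b (2 * a + 2)"
    by (rule wt_ge_ad_over_hbar[OF assms(2,3)]) simp
  ultimately show ?thesis
    using wt_ge_diffD[of "exp_ad A (H20 w w' + L) - (H20 w w' + L + hop w w' A)" "ad_over_hbar A L"]
    by (simp only: diff_diff_eq add.assoc)
qed

text \<open>On the span of x_j \<epsilon>^k and \<xi>_j \<epsilon>^k the operator is a quarter turn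
  scaled by the j-th frequency, hence invertible.\<close>

lemma hop_linear_eq_0:
  assumes ab: "a \<noteq> 0" "b \<noteq> 0"
    and 0: "\<And>m. deg_xh m = 1 \<Longrightarrow> m Eps = k \<Longrightarrow> mcoeff (hop a b f) m = 0"
    and m: "deg_xh m = 1" "m Eps = k"
  shows "mcoeff f m = 0"
proof -
  let ?e = "\<lambda>v. (\<lambda>_. 0)(v := 1, Eps := k)"
  have "m = ?e X1 \<or> m = ?e X2 \<or> m = ?e Xi1 \<or> m = ?e Xi2"
    using m by (auto simp: coord_fun_eq_iff deg_xh_def add_is_1)
  moreover have upd: "(?e X1)(X1 := 0, Xi1 := 1) = ?e Xi1" "(?e Xi1)(Xi1 := 0, X1 := 1) = ?e X1"
    "(?e X2)(X2 := 0, Xi2 := 1) = ?e Xi2" "(?e Xi2)(Xi2 := 0, X2 := 1) = ?e X2"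
    by (simp_all add: coord_fun_eq_iff)
  have "mcoeff (hop a b f) (?e X1) = a * mcoeff f (?e Xi1)"
    "mcoeff (hop a b f) (?e Xi1) = - a * mcoeff f (?e X1)"
    "mcoeff (hop a b f) (?e X2) = b * mcoeff f (?e Xi2)"
    "mcoeff (hop a b f) (?e Xi2) = - b * mcoeff f (?e X2)"
    using upd by (simp_all add: hop_def mcoeff_mconst_mult mcoeff_mvar_mderiv)
  moreover have "mcoeff (hop a b f) (?e v) = 0" if "v \<in> {X1, X2, Xi1, Xi2}" for v
    using that by (intro 0) (auto simp: deg_xh_def)
  ultimately show ?thesis
    using ab by auto
qed

text \<open>The weight \<open>(k - 1) (|\<alpha>| + |\<beta>| + 2 \<ell>) + m\<close> isolates the terms of the generator that are linear in \<open>(x, \<xi>)\<close>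
  with factor \<open>\<epsilon>^k\<close>; to first order they produce linear terms in the normal form, and these
  are excluded because the homological operator is injective on linear terms.\<close>

lemma normal_form_xh:
  assumes ab: "a \<noteq> 0" "b \<noteq> 0"
    and L: "L \<in> ord_ge 3" "L \<in> ord_ge_xh 2" and A: "A \<in> ord_ge 3"
    and K: "hop a b K = 0" "exp_ad A (H20 a b + L) = H20 a b + K"
  shows "K \<in> ord_ge_xh 2"
proof -
  \<comment> \<open>Terms in \<epsilon> alone are central but may occur in A. They would violate the
    weight estimate below, so they are removed, which leaves the conjugation unchanged.\<close>
  define B where "B = Abs_mfps (\<lambda>m. if deg_xh m = 0 then 0 else mcoeff A m)"
  have mB: "mcoeff B m = (if deg_xh m = 0 then 0 else mcoeff A m)" for m
    by (simp add: B_def)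
  have "ad_over_hbar A = ad_over_hbar B"
  proof (rule ad_over_hbar_cong_left)
    fix v assume "v \<in> {X1, X2, Xi1, Xi2}"
    then show "mderiv v A = mderiv v B"
      by (intro mfps_eqI) (auto simp: mB deg_xh_def)
  qed
  then have EB: "exp_ad B (H20 a b + L) = H20 a b + K"
    using K(2) by (simp add: exp_ad_def)
  have B: "B \<in> ord_ge 3"
    using A by (auto simp: ord_ge_def mB)
  have K1: "mcoeff K m = 0" if "deg_xh m = 1" for m
    by (rule hop_linear_eq_0[OF ab, of "m Eps"]) (use that in \<open>simp_all add: K(1)\<close>)
  have B1: "mcoeff B m = 0" if "deg_xh m = 1" for m
    using that
  proof (induction "m Eps" arbitrary: m rule: less_induct)
    case less
    let ?k = "m Eps"
    show ?case
    \<comment> \<open>For k < 2 a linear term has degree below 3 and is excluded by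
      \<open>ord_ge 3\<close>; otherwise j = k - 1 is positive, as the weight (j, 1)
      requires.\<close>
    proof (cases "?k \<ge> 2")
      case False
      then show ?thesis
        using B less.prems by (force simp: ord_ge_def deg_def deg_xh_def)
    next
      case True
      define j where "j = ?k - 1"
      have j: "j \<ge> 1" "?k = j + 1"
        using True by (simp_all add: j_def)
      \<comment> \<open>The linear terms with \<epsilon>^k weigh j + k = 2j + 1. Nothing else is
        lighter: a term of order 2 carries an \<epsilon> because its degree is at least 3, and one
        of higher order weighs at least 3j.\<close>
      have gt: "2 * j + 1 \<le> wt j 1 n" if "deg_xh n \<ge> 2" "deg n \<ge> 3" for n
      proof (cases "deg_xh n = 2")
        case True
        then have "n Eps \<ge> 1"
          using that by (simp add: deg_def deg_xh_def)
        with True show ?thesis by (simp add: wt_def)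
      next
        case False
        then have "j * 3 \<le> j * deg_xh n"
          using that by (intro mult_le_mono2) linarith
        then show ?thesis
          using j(1) unfolding wt_def by linarith
      qed
      have "B \<in> wt_ge j 1 (2 * j + 1)"
      proof (unfold wt_ge_def, intro CollectI allI impI)
        fix n assume n: "mcoeff B n \<noteq> 0"
        then have "deg_xh n \<noteq> 0" "deg n \<ge> 3"
          using B by (auto simp: mB ord_ge_def split: if_splits)
        moreover have "n Eps \<ge> ?k" if "deg_xh n = 1"
          using less.hyps[of n] that n by (force simp: not_less[symmetric])
        ultimately show "2 * j + 1 \<le> wt j 1 n"
          using gt[of n] j by (cases "deg_xh n = 1") (force simp: wt_def)+
      qed
      moreover have "L \<in> wt_ge j 1 (2 * j + 1)"
        using L gt by (force simp: wt_ge_def ord_ge_def ord_ge_xh_def)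
      ultimately have "H20 a b + K - (H20 a b + L + hop a b B) \<in> wt_ge j 1 (2 * j + 2)"
        using exp_ad_H20_first_order[OF B, of j 1 L a b] by (simp only: EB)
      \<comment> \<open>At weight 2j + 1 the linear terms of K, L and \<open>hop a b B\<close> must
        balance, and those of K and L vanish.\<close>
      then have E: "K - (L + hop a b B) \<in> wt_ge j 1 (2 * j + 2)"
        by (simp only: add.assoc add_diff_cancel_left)
      show ?thesis
      proof (rule hop_linear_eq_0[OF ab, of ?k])
        fix n assume n: "deg_xh n = 1" "n Eps = ?k"
        have "mcoeff (K - (L + hop a b B)) n = 0"
          by (rule wt_geD[OF E]) (use n j in \<open>simp add: wt_def\<close>)
        moreover have "mcoeff L n = 0"
          using L(2) n by (force simp: ord_ge_xh_def)
        ultimately show "mcoeff (hop a b B) n = 0"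
          using K1[OF n(1)] by simp
      qed (use less.prems in simp_all)
    qed
  qed
  have "2 \<le> deg_xh m" if "mcoeff B m \<noteq> 0" for m
    using that B1[of m] mB[of m] by (cases "deg_xh m = 0"; cases "deg_xh m = 1") auto
  \<comment> \<open>Order 2 in (x, \<xi>, \<hbar>) is the threshold at which an application of the
    generator loses nothing.\<close>
  then have "B \<in> wt_ge 1 0 (2 * 1)"
    by (simp add: wt_ge_def wt_def)
  then have "H20 a b + K \<in> wt_ge 1 0 2"
    unfolding EB[symmetric] using B L H20_wt_ge[of a b 1 0]
    by (intro wt_ge_exp_ad wt_ge_add) (simp_all add: ord_ge_xh_eq_wt_ge)
  then show ?thesis
    unfolding ord_ge_xh_eq_wt_ge
    using wt_ge_diff[OF _ H20_wt_ge[of a b 1 0], of "H20 a b + K"] by simp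
qed

text \<open>In degree 3 the difference \<open>K - N\<close> is \<open>hop\<close> of the cubic part
  of \<open>g + A\<close>, and it also lies in the kernel, so it vanishes whatever A is.\<close>

lemma normal_form_cubic:
  assumes L: "L \<in> ord_ge 3" and A: "A \<in> ord_ge 3"
    and K: "K \<in> ord_ge 3" "hop a b K = 0" "exp_ad A (H20 a b + L) = H20 a b + K"
    and N: "N \<in> ord_ge 3" "hop a b N = 0" and g: "L - (N + hop a b g) \<in> ord_ge 4"
  shows "K - N \<in> ord_ge 4"
proof -
  have E: "K - (L + hop a b A) \<in> ord_ge (Suc 3)"
    using exp_ad_H20_first_order[of A 1 1 L a b] L A K(3)
    by (simp add: ord_ge_eq_wt_ge algebra_simps numeral_3_eq_3)
  let ?u = "hpart 3 (g + A)"
  have "hpart 3 (K - N) = hpart 3 (K - (L + hop a b A)) + hpart 3 (L - (N + hop a b g))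
      + hpart 3 (hop a b (g + A))"
    by (simp add: hpart_add hpart_diff hop_add)
  also have "\<dots> = hop a b ?u"
    using hpart_eq_0[OF E] hpart_eq_0[of "L - (N + hop a b g)" 3] g by (simp add: hpart_hop)
  finally have u: "hpart 3 (K - N) = hop a b ?u" .
  have "hop a b (hpart 3 (K - N)) = 0"
    by (simp add: hpart_hop[symmetric] hop_diff K N)
  then have "hop a b (hop a b ?u) = 0"
    by (simp only: u)
  then have "hop a b ?u = 0"
    by (rule hop_hop_eq_0[OF eigen_sum_hpart])
  then have "K - N \<in> ord_ge (Suc 3)"
    unfolding ord_ge_Suc_iff u using K(1) N(1) by (simp add: ord_ge_eq_wt_ge wt_ge_diff)
  then show ?thesis by simp
qed

section \<open>The resonant cubic terms\<close>

lemma mcnj_mcnj [simp]: "mcnj (mcnj f) = f"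
  by (rule mfps_eqI) (simp add: mcnj_def)

lemma mcnj_mult: "mcnj (f * g) = mcnj f * mcnj (g :: 'v::finite mfps)"
  by (rule mfps_eqI) (simp add: mcnj_def times_mfps_def case_prod_unfold)

lemma mcnj_power2: "mcnj (f ^ 2) = mcnj (f :: 'v::finite mfps) ^ 2"
  by (simp add: power2_eq_square mcnj_mult)

lemma z_mult_mcnj: "z1 * mcnj z1 = mvar X1 ^ 2 + mvar Xi1 ^ 2" "z2 * mcnj z2 = mvar X2 ^ 2 + mvar Xi2 ^ 2"
  unfolding mcnj_z by (simp_all add: z1_def z2_def algebra_simps mconst_ii power2_eq_square)

definition zmono :: "nat \<Rightarrow> nat \<Rightarrow> nat \<Rightarrow> nat \<Rightarrow> coord mfps" where
  "zmono p q r s = z1 ^ p * mcnj z1 ^ q * (z2 ^ r * mcnj z2 ^ s)"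

lemma eigen_power: "hop a b f = mconst c * f \<Longrightarrow> hop a b (f ^ n) = mconst (of_nat n * c) * f ^ n"
proof (induction n)
  case 0
  then show ?case using hop_mconst[of a b 1] by simp
next
  case (Suc n)
  then have "hop a b (f * f ^ n) = mconst (c + of_nat n * c) * (f * f ^ n)"
    by (intro eigen_mult) simp_all
  then show ?case by (simp add: algebra_simps)
qed

lemma hop_zmono:
  "hop a (2 * a) (zmono p q r s)
     = mconst (\<i> * a * of_int (int p + 2 * int r - int q - 2 * int s)) * zmono p q r s"
proof -
  have "hop a (2 * a) (zmono p q r s)
     = mconst (of_nat p * (\<i> * a) + of_nat q * (- \<i> * a)
         + (of_nat r * (\<i> * complex_of_real (2 * a)) + of_nat s * (- \<i> * complex_of_real (2 * a)))) * zmono p q r s"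
    unfolding zmono_def by (intro eigen_mult eigen_power hop_z)
  then show ?thesis by (simp add: algebra_simps)
qed

definition hop_image :: "real \<Rightarrow> real \<Rightarrow> coord mfps set" where
  "hop_image a b = range (hop a b)"

lemma hop_image_add: "f \<in> hop_image a b \<Longrightarrow> g \<in> hop_image a b \<Longrightarrow> f + g \<in> hop_image a b"
  unfolding hop_image_def by (auto simp flip: hop_add)

lemma hop_image_mconst_mult: "f \<in> hop_image a b \<Longrightarrow> mconst c * f \<in> hop_image a b"
  unfolding hop_image_def by (auto simp flip: hop_mconst_mult)

text \<open>The eigenvalue in \<open>hop_zmono\<close> is nonzero, so dividing by it gives a
  preimage. Among the cubic monomials only exponents (2, 0, 0, 1) and (0, 2, 1, 0) violate the
  second assumption.\<close>

lemma zmono_in_hop_image: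
  assumes "a \<noteq> 0" "p + 2 * r \<noteq> q + 2 * s"
  shows "zmono p q r s \<in> hop_image a (2 * a)"
proof -
  let ?c = "\<i> * a * of_int (int p + 2 * int r - int q - 2 * int s)"
  have "int p + 2 * int r - int q - 2 * int s \<noteq> 0"
    using assms(2) by linarith
  then have "of_int (int p + 2 * int r - int q - 2 * int s) \<noteq> (0 :: complex)"
    by (metis of_int_eq_0_iff)
  then have "?c \<noteq> 0"
    using assms(1) by simp
  moreover have "1 / c * c = 1" if "c \<noteq> 0" for c :: complex
    using that by simp
  ultimately have "1 / ?c * ?c = 1"
    by blast
  then have "hop a (2 * a) (mconst (1 / ?c) * zmono p q r s) = zmono p q r s"
    unfolding hop_mconst_mult hop_zmono mconst_mult_assoc by (simp only: mconst_1 mult_1)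
  then show ?thesis
    unfolding hop_image_def by (rule range_eqI[OF sym])
qed

lemma cubic_eq_zmono:
  "mvar X1 ^ 3 = mconst (1/8) * (zmono 3 0 0 0 + mconst 3 * zmono 2 1 0 0 + mconst 3 * zmono 1 2 0 0
     + zmono 0 3 0 0)"
  "mvar X1 * mvar X2 ^ 2 = mconst (1/8) * (zmono 1 0 2 0 + mconst 2 * zmono 1 0 1 1 + zmono 1 0 0 2
     + zmono 0 1 2 0 + mconst 2 * zmono 0 1 1 1 + zmono 0 1 0 2)"
  "mvar X2 ^ 3 = mconst (1/8) * (zmono 0 0 3 0 + mconst 3 * zmono 0 0 2 1 + mconst 3 * zmono 0 0 1 2
     + zmono 0 0 0 3)"
  "mvar X1 ^ 2 * mvar X2 = mconst (1/8) * (zmono 2 0 1 0 + mconst 2 * zmono 1 1 1 0 + zmono 0 2 1 0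
     + zmono 2 0 0 1 + mconst 2 * zmono 1 1 0 1 + zmono 0 2 0 1)"
proof -
  \<comment> \<open>Opaque names for the four factors, and 1/8 split into three halves, let both
    sides be expanded to the same polynomial.\<close>
  define x y u v where defs: "x = z1" "y = mcnj z1" "u = z2" "v = mcnj z2"
  have h: "mconst (1/8) = mconst (1/2) * mconst (1/2) * (mconst (1/2) :: coord mfps)"
    by (simp add: mconst_mult[symmetric])
  note simps = power3_eq_cube power2_eq_square mconst_numeral algebra_simps
  show "mvar X1 ^ 3 = mconst (1/8) * (zmono 3 0 0 0 + mconst 3 * zmono 2 1 0 0 + mconst 3 * zmono 1 2 0 0
     + zmono 0 3 0 0)"
    "mvar X1 * mvar X2 ^ 2 = mconst (1/8) * (zmono 1 0 2 0 + mconst 2 * zmono 1 0 1 1 + zmono 1 0 0 2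
     + zmono 0 1 2 0 + mconst 2 * zmono 0 1 1 1 + zmono 0 1 0 2)"
    "mvar X2 ^ 3 = mconst (1/8) * (zmono 0 0 3 0 + mconst 3 * zmono 0 0 2 1 + mconst 3 * zmono 0 0 1 2
     + zmono 0 0 0 3)"
    "mvar X1 ^ 2 * mvar X2 = mconst (1/8) * (zmono 2 0 1 0 + mconst 2 * zmono 1 1 1 0 + zmono 0 2 1 0
     + zmono 2 0 0 1 + mconst 2 * zmono 1 1 0 1 + zmono 0 2 0 1)"
    unfolding mvar_eq_z h zmono_def defs[symmetric] by (simp_all add: simps)
qed

lemma mRe_eq_zmono: "mRe (z1 ^ 2 * mcnj z2) = mconst (1/2) * (zmono 2 0 0 1 + zmono 0 2 1 0)"
  by (simp add: mRe_def mcnj_mult mcnj_power2 zmono_def)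

text \<open>Of the terms of 8 x_1^2 x_2 expanded in z and its conjugate, the two resonant ones sum
  to twice the real part of z_1^2 times the conjugate of z_2.\<close>

lemma resonant_part:
  "mconst 4 * (mvar X1 ^ 2 * mvar X2) = mRe (z1 ^ 2 * mcnj z2)
     + mconst (1/2) * (zmono 2 0 1 0 + mconst 2 * zmono 1 1 1 0 + mconst 2 * zmono 1 1 0 1 + zmono 0 2 0 1)"
  unfolding cubic_eq_zmono mRe_eq_zmono mconst_mult_assoc by (simp add: algebra_simps)

text \<open>The other three monomials in x have no resonant term, and the factor 4 m makes the
  resonant part of the remaining one exactly m times the real part.\<close>

lemma cubic_minus_resonant_in_hop_image:
  assumes "a \<noteq> 0"
  shows "mconst c * mvar X1 ^ 3 + mconst (4 * m) * (mvar X1 ^ 2 * mvar X2) + mconst d * (mvar X1 * mvar X2 ^ 2)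
      + mconst e * mvar X2 ^ 3 - mconst m * mRe (z1 ^ 2 * mcnj z2) \<in> hop_image a (2 * a)"
proof -
  let ?r = "mconst (1/2) * (zmono 2 0 1 0 + mconst 2 * zmono 1 1 1 0 + mconst 2 * zmono 1 1 0 1 + zmono 0 2 0 1)"
  note intros = hop_image_add hop_image_mconst_mult zmono_in_hop_image[OF assms]
  have "mconst c * mvar X1 ^ 3 + mconst m * ?r + mconst d * (mvar X1 * mvar X2 ^ 2) + mconst e * mvar X2 ^ 3
      \<in> hop_image a (2 * a)"
    unfolding cubic_eq_zmono by (intro intros) simp_all
  moreover have "mconst (4 * m) * (mvar X1 ^ 2 * mvar X2) = mconst m * (mRe (z1 ^ 2 * mcnj z2) + ?r)"
    unfolding resonant_part[symmetric] by (simp add: mconst_mult_assoc mult.commute)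
  ultimately show ?thesis
    by (simp add: algebra_simps)
qed

lemma K3_eq:
  "K3 w w' m = mconst (of_real (w/2)) * mvar Eps * (mvar X1 ^ 2 + mvar Xi1 ^ 2)
     + mconst (of_real (w'/2)) * mvar Eps * (mvar X2 ^ 2 + mvar Xi2 ^ 2)
     + mconst (of_real m) * mRe (z1 ^ 2 * mcnj z2)"
  by (simp add: K3_def z_mult_mcnj)

lemma hop_K3: "hop a (2 * a) (K3 w w' m) = 0"
proof -
  have "hop a (2 * a) (z1 * mcnj z1) = 0" "hop a (2 * a) (z2 * mcnj z2) = 0"
    using hop_zmono[of a 1 1 0 0] hop_zmono[of a 0 0 1 1] by (simp_all add: zmono_def)
  moreover have "hop a (2 * a) (mvar Eps) = 0"
    by (simp add: hop_def mderiv_mvar)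
  ultimately show ?thesis
    by (simp add: K3_def hop_add hop_mconst_mult hop_mult mRe_eq_zmono mult.assoc hop_zmono hop_mconst)
qed

lemma z_wt_ge: "z1 \<in> wt_ge a b a" "z2 \<in> wt_ge a b a" "mcnj z1 \<in> wt_ge a b a" "mcnj z2 \<in> wt_ge a b a"
  unfolding mcnj_z unfolding z1_def z2_def
  by (auto intro!: wt_ge_add wt_ge_diff wt_ge_mconst_mult mvar_wt_ge)

lemma K3_wt_ge:
  assumes "N \<le> 2 * a + b" "N \<le> 3 * a"
  shows "K3 w w' m \<in> wt_ge a b N"
proof -
  have e: "mvar Eps \<in> wt_ge a b b"
    by (rule wt_geI) (auto simp: mvar_def wt_def deg_xh_def split: if_splits)
  have "mvar Eps * (z1 * mcnj z1) \<in> wt_ge a b N" "mvar Eps * (z2 * mcnj z2) \<in> wt_ge a b N"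
    by (rule wt_ge_mono[OF wt_ge_mult[OF e wt_ge_mult[OF z_wt_ge(1,3)]]]
        wt_ge_mono[OF wt_ge_mult[OF e wt_ge_mult[OF z_wt_ge(2,4)]]]; use assms in linarith)+
  moreover have "zmono 2 0 0 1 \<in> wt_ge a b N" "zmono 0 2 1 0 \<in> wt_ge a b N"
    using wt_ge_mono[OF wt_ge_mult[OF wt_ge_mult[OF z_wt_ge(1,1)] z_wt_ge(4)], of N a b]
      wt_ge_mono[OF wt_ge_mult[OF wt_ge_mult[OF z_wt_ge(3,3)] z_wt_ge(2)], of N a b] assms
    by (simp_all add: zmono_def power2_eq_square)
  ultimately show ?thesis
    unfolding K3_def mRe_eq_zmono mult.assoc by (intro wt_ge_add wt_ge_mconst_mult)
qed

section \<open>Smooth functions\<close>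

lemma ddir_eqI: "(f has_derivative f') (at p) \<Longrightarrow> ddir b f p = f' b"
  by (metis ddir_def frechet_derivative_at)

lemma ddir_cong:
  assumes "open U" "p \<in> U" "\<And>q. q \<in> U \<Longrightarrow> f q = g q"
  shows "ddir b f p = ddir b g p"
proof -
  have "(f has_derivative f') (at p) \<longleftrightarrow> (g has_derivative f') (at p)" for f'
    using has_derivative_transform_within_open[OF _ assms(1,2)] assms(3) by metis
  then show ?thesis
    by (simp add: ddir_def frechet_derivative_def)
qed

lemma Ck_on_cong:
  assumes "open U" "\<And>q. q \<in> U \<Longrightarrow> f q = g q" "Ck_on k f U"
  shows "Ck_on k g U"
  using assms(2,3)
proof (induction k arbitrary: f g)
  case 0
  then show ?case
    using continuous_on_cong[of U U f g] by simp
next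
  case (Suc k)
  have "g differentiable_on U"
    using Suc.prems by (auto simp: differentiable_on_def intro: differentiable_transform_within[OF _ zero_less_one])
  moreover have "Ck_on k (ddir b g) U" if "b \<in> Basis" for b
  proof (rule Suc.IH[of "ddir b f"])
    show "ddir b f q = ddir b g q" if "q \<in> U" for q
      using ddir_cong[OF assms(1) that Suc.prems(1)] .
  qed (use Suc.prems(2) that in simp)
  ultimately show ?case
    by simp
qed

lemma Ck_on_Suc_imp: "Ck_on (Suc k) f U \<Longrightarrow> Ck_on k f U"
proof (induction k arbitrary: f)
  case 0
  then show ?case by (simp add: differentiable_imp_continuous_on)
next
  case (Suc k)
  then show ?case by (subst Ck_on.simps) (metis Ck_on.simps(2))
qed

lemma Ck_on_Suc_diff: "open U \<Longrightarrow> Ck_on (Suc k) f U \<Longrightarrow> p \<in> U \<Longrightarrow> f differentiable (at p)"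
  by (simp add: differentiable_on_eq_differentiable_at)

lemma Ck_on_subset: "Ck_on k f U \<Longrightarrow> V \<subseteq> U \<Longrightarrow> Ck_on k f V"
  by (induction k arbitrary: f) (auto intro: continuous_on_subset differentiable_on_subset)

lemma ddir_add:
  assumes "f differentiable (at p)" "g differentiable (at p)"
  shows "ddir b (\<lambda>q. f q + g q) p = ddir b f p + ddir b g p"
proof -
  have "((\<lambda>q. f q + g q) has_derivative
      (\<lambda>h. frechet_derivative f (at p) h + frechet_derivative g (at p) h)) (at p)"
    using assms by (intro has_derivative_add) (simp_all add: frechet_derivative_works)
  then show ?thesis
    by (subst ddir_eqI) (simp_all add: ddir_def)
qed

lemma ddir_mult:
  assumes "f differentiable (at p)" "g differentiable (at p)"
  shows "ddir b (\<lambda>q. f q * g q) p = f p * ddir b g p + ddir b f p * g p"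
proof -
  have "((\<lambda>q. f q * g q) has_derivative
      (\<lambda>h. f p * frechet_derivative g (at p) h + frechet_derivative f (at p) h * g p)) (at p)"
    using assms by (intro has_derivative_mult) (simp_all add: frechet_derivative_works)
  then show ?thesis
    by (subst ddir_eqI) (simp_all add: ddir_def)
qed

lemma Ck_on_add:
  assumes "open U" "Ck_on k f U" "Ck_on k g U"
  shows "Ck_on k (\<lambda>p. f p + g p) U"
  using assms(2,3)
proof (induction k arbitrary: f g)
  case 0
  then show ?case by (simp add: continuous_on_add)
next
  case (Suc k)
  have "Ck_on k (ddir b (\<lambda>p. f p + g p)) U" if "b \<in> Basis" for b
  proof (rule Ck_on_cong[OF assms(1)])
    show "Ck_on k (\<lambda>p. ddir b f p + ddir b g p) U"
      using Suc.prems that by (intro Suc.IH) auto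
    show "ddir b f q + ddir b g q = ddir b (\<lambda>p. f p + g p) q" if "q \<in> U" for q
      using Ck_on_Suc_diff[OF assms(1) _ that] Suc.prems by (intro ddir_add[symmetric])
  qed
  then show ?case
    using Suc.prems by (auto simp: differentiable_on_def)
qed

lemma Ck_on_mult:
  assumes "open U" "Ck_on k f U" "Ck_on k g U"
  shows "Ck_on k (\<lambda>p. f p * g p) U"
  using assms(2,3)
proof (induction k arbitrary: f g)
  case 0
  then show ?case by (simp add: continuous_on_mult)
next
  case (Suc k)
  have "Ck_on k (ddir b (\<lambda>p. f p * g p)) U" if "b \<in> Basis" for b
  proof (rule Ck_on_cong[OF assms(1)])
    show "Ck_on k (\<lambda>p. f p * ddir b g p + ddir b f p * g p) U"
      using Suc.prems that Suc.prems[THEN Ck_on_Suc_imp] by (intro Ck_on_add assms(1) Suc.IH) auto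
    show "f q * ddir b g q + ddir b f q * g q = ddir b (\<lambda>p. f p * g p) q" if "q \<in> U" for q
      using Ck_on_Suc_diff[OF assms(1) _ that] Suc.prems by (intro ddir_mult[symmetric])
  qed
  then show ?case
    using Suc.prems by (auto simp: differentiable_on_def)
qed

lemma ddir_const: "ddir b (\<lambda>_. c) = (\<lambda>_. 0)"
  by (rule ext) (rule ddir_eqI, rule has_derivative_const)

lemma Ck_on_const: "Ck_on k (\<lambda>_. c) U"
  by (induction k arbitrary: c) (simp_all add: ddir_const)

lemma Ck_on_sum:
  assumes "open U" "\<And>i. i \<in> I \<Longrightarrow> Ck_on k (f i) U"
  shows "Ck_on k (\<lambda>p. \<Sum>i\<in>I. f i p) U"
  using assms(2) by (induction I rule: infinite_finite_induct) (auto intro: Ck_on_const Ck_on_add[OF assms(1)])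

lemma ddir_compose_linear:
  assumes "bounded_linear L" "f differentiable (at (L p))"
  shows "ddir b (\<lambda>q. f (L q)) p = ddir (L b) f (L p)"
proof -
  have "((\<lambda>q. f (L q)) has_derivative (\<lambda>h. frechet_derivative f (at (L p)) (L h))) (at p)"
    by (rule has_derivative_compose[of L L])
      (use assms in \<open>simp_all add: bounded_linear_imp_has_derivative frechet_derivative_works\<close>)
  then show ?thesis
    by (subst ddir_eqI) (simp_all add: ddir_def)
qed

lemma ddir_linear_sum:
  assumes "f differentiable (at p)"
  shows "ddir v f p = (\<Sum>b\<in>Basis. (v \<bullet> b) * ddir b f p)"
proof -
  have "linear (frechet_derivative f (at p))"
    using assms linear_frechet_derivative by blast
  then have "frechet_derivative f (at p) (\<Sum>b\<in>Basis. (v \<bullet> b) *\<^sub>R b)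
      = (\<Sum>b\<in>Basis. (v \<bullet> b) *\<^sub>R frechet_derivative f (at p) b)"
    by (simp add: linear_sum linear_scale)
  then show ?thesis
    by (simp add: ddir_def euclidean_representation)
qed

text \<open>\<open>Ck_on\<close> speaks only of basis directions. Linearity of the derivative
  extends it to all directions, in particular to diagonals and to images of unit vectors under
  linear maps.\<close>

lemma Ck_on_ddir:
  assumes "open U" "Ck_on (Suc k) f U"
  shows "Ck_on k (ddir v f) U"
proof (rule Ck_on_cong[OF assms(1)])
  show "Ck_on k (\<lambda>p. \<Sum>b\<in>Basis. (v \<bullet> b) * ddir b f p) U"
    using assms by (intro Ck_on_sum Ck_on_mult Ck_on_const) auto
qed (simp add: ddir_linear_sum[OF Ck_on_Suc_diff[OF assms], symmetric])

lemma Ck_on_compose_linear: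
  fixes L :: "'b::euclidean_space \<Rightarrow> 'a::euclidean_space"
  assumes L: "bounded_linear L" and U: "open U" and f: "Ck_on k f U"
  shows "Ck_on k (\<lambda>p. f (L p)) (L -` U)"
  using f
proof (induction k arbitrary: f)
  case 0
  then show ?case
    using linear_continuous_on[OF L, of "L -` U"] by (auto intro: continuous_on_compose2)
next
  case (Suc k)
  have V: "open (L -` U)"
    using U linear_continuous_on[OF L, of UNIV] by (simp add: open_vimage)
  have d: "f differentiable (at (L p))" if "p \<in> L -` U" for p
    using Ck_on_Suc_diff[OF U Suc.prems] that by simp
  have "(\<lambda>p. f (L p)) differentiable_on (L -` U)"
    unfolding differentiable_on_eq_differentiable_at[OF V]
    using differentiable_chain_at[OF bounded_linear_imp_differentiable[OF L] d] by (auto simp: o_def)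
  moreover have "Ck_on k (ddir b (\<lambda>p. f (L p))) (L -` U)" for b
    by (rule Ck_on_cong[OF V _ Suc.IH[OF Ck_on_ddir[OF U Suc.prems, of "L b"]]])
      (simp add: ddir_compose_linear[OF L d])
  ultimately show ?case
    by simp
qed

section \<open>Infinitely differentiable functions on open sets\<close>

definition Cinf_on :: "('a::euclidean_space \<Rightarrow> real) \<Rightarrow> 'a set \<Rightarrow> bool" where
  "Cinf_on f U \<longleftrightarrow> open U \<and> (\<forall>k. Ck_on k f U)"

lemma Cinf_on_open: "Cinf_on f U \<Longrightarrow> open U"
  by (simp add: Cinf_on_def)

lemma Cinf_on_differentiable: "Cinf_on f U \<Longrightarrow> p \<in> U \<Longrightarrow> f differentiable (at p)"
  unfolding Cinf_on_def using Ck_on_Suc_diff[of U 0 f p] by blast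

lemma Cinf_on_continuous: "Cinf_on f U \<Longrightarrow> p \<in> U \<Longrightarrow> isCont f p"
  by (simp add: Cinf_on_differentiable differentiable_imp_continuous_within)

lemma Cinf_on_ddir: "Cinf_on f U \<Longrightarrow> Cinf_on (ddir v f) U"
  by (simp add: Cinf_on_def Ck_on_ddir)

lemma Cinf_on_subset: "Cinf_on f U \<Longrightarrow> open V \<Longrightarrow> V \<subseteq> U \<Longrightarrow> Cinf_on f V"
  by (simp add: Cinf_on_def Ck_on_subset[of _ f U V])

lemma Cinf_on_add: "Cinf_on f U \<Longrightarrow> Cinf_on g U \<Longrightarrow> Cinf_on (\<lambda>p. f p + g p) U"
  by (simp add: Cinf_on_def Ck_on_add)

lemma Cinf_on_mult: "Cinf_on f U \<Longrightarrow> Cinf_on g U \<Longrightarrow> Cinf_on (\<lambda>p. f p * g p) U"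
  by (simp add: Cinf_on_def Ck_on_mult)

lemma Cinf_on_const: "open U \<Longrightarrow> Cinf_on (\<lambda>_. c) U"
  by (simp add: Cinf_on_def Ck_on_const)

lemma Cinf_on_compose_linear:
  "bounded_linear L \<Longrightarrow> Cinf_on f U \<Longrightarrow> Cinf_on (\<lambda>p. f (L p)) (L -` U)"
  by (simp add: Cinf_on_def Ck_on_compose_linear open_vimage linear_continuous_on)

lemma Cinf_on_id: "Cinf_on (\<lambda>x::real. x) UNIV"
proof -
  have "Ck_on k (\<lambda>x::real. x) UNIV" for k
  proof (cases k)
    case (Suc j)
    have "ddir b (\<lambda>x::real. x) = (\<lambda>_. b)" for b
      by (rule ext) (rule ddir_eqI, rule has_derivative_ident)
    then show ?thesis
      by (simp add: Suc Ck_on_const)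
  qed simp
  then show ?thesis
    by (simp add: Cinf_on_def)
qed

lemma Cinf_on_prod:
  "open U \<Longrightarrow> (\<And>i. i \<in> I \<Longrightarrow> Cinf_on (f i) U) \<Longrightarrow> Cinf_on (\<lambda>p. \<Prod>i\<in>I. f i p) U"
  by (induction I rule: infinite_finite_induct) (auto intro: Cinf_on_const Cinf_on_mult)

subsection \<open>Iterated directional derivatives\<close>

lemma Cinf_on_foldr_ddir: "Cinf_on f U \<Longrightarrow> Cinf_on (foldr ddir bs f) U"
  by (induction bs) (simp_all add: Cinf_on_ddir)

lemma foldr_ddir_cong:
  assumes "open U" "\<And>q. q \<in> U \<Longrightarrow> f q = g q" "p \<in> U"
  shows "foldr ddir bs f p = foldr ddir bs g p"
  using assms(3) by (induction bs arbitrary: p) (auto simp: assms(2) intro: ddir_cong[OF assms(1)])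

lemma foldr_ddir_const_0: "foldr ddir bs (\<lambda>_. 0) = (\<lambda>_. 0)"
  by (induction bs) (simp_all add: ddir_const)

lemma foldr_ddir_eq_0:
  assumes "open U" "\<And>q. q \<in> U \<Longrightarrow> f q = 0" "p \<in> U"
  shows "foldr ddir bs f p = 0"
  using foldr_ddir_cong[OF assms(1) _ assms(3), of f "\<lambda>_. 0" bs] assms(2) by (simp add: foldr_ddir_const_0)

lemma foldr_ddir_add:
  assumes "Cinf_on f U" "Cinf_on g U" "p \<in> U"
  shows "foldr ddir bs (\<lambda>q. f q + g q) p = foldr ddir bs f p + foldr ddir bs g p"
  using assms(3)
proof (induction bs arbitrary: p)
  case (Cons b bs)
  have "ddir b (foldr ddir bs (\<lambda>q. f q + g q)) p = ddir b (\<lambda>q. foldr ddir bs f q + foldr ddir bs g q) p"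
    by (rule ddir_cong[OF Cinf_on_open[OF assms(1)]]) (use Cons in auto)
  also have "\<dots> = ddir b (foldr ddir bs f) p + ddir b (foldr ddir bs g) p"
    by (rule ddir_add[OF Cinf_on_differentiable[OF Cinf_on_foldr_ddir[OF assms(1)] Cons.prems]
          Cinf_on_differentiable[OF Cinf_on_foldr_ddir[OF assms(2)] Cons.prems]])
  finally show ?case by simp
qed simp

text \<open>The derivative of a linear map is constant, so the iterated chain rule only transports
  the directions.\<close>

lemma foldr_ddir_compose_linear:
  assumes L: "bounded_linear L" and f: "Cinf_on f U" and "L q \<in> U"
  shows "foldr ddir bs (\<lambda>p. f (L p)) q = foldr ddir (map L bs) f (L q)"
  using assms(3)
proof (induction bs arbitrary: q)
  case (Cons b bs)
  have V: "open (L -` U)"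
    using Cinf_on_open[OF Cinf_on_compose_linear[OF L f]] .
  have "ddir b (foldr ddir bs (\<lambda>p. f (L p))) q = ddir b (\<lambda>q. foldr ddir (map L bs) f (L q)) q"
    by (rule ddir_cong[OF V]) (use Cons in auto)
  also have "\<dots> = ddir (L b) (foldr ddir (map L bs) f) (L q)"
    by (rule ddir_compose_linear[OF L Cinf_on_differentiable[OF Cinf_on_foldr_ddir[OF f] Cons.prems]])
  finally show ?case by simp
qed simp

lemma ddir_line:
  assumes "f differentiable (at (p + t *\<^sub>R b))"
  shows "((\<lambda>s. f (p + s *\<^sub>R b)) has_real_derivative ddir b f (p + t *\<^sub>R b)) (at t)"
proof -
  let ?D = "frechet_derivative f (at (p + t *\<^sub>R b))"
  have "((\<lambda>s. p + s *\<^sub>R b) has_derivative (\<lambda>s. s *\<^sub>R b)) (at t)"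
    by (auto intro!: derivative_eq_intros)
  then have "((\<lambda>s. f (p + s *\<^sub>R b)) has_derivative (\<lambda>s. ?D (s *\<^sub>R b))) (at t)"
    by (rule has_derivative_compose) (use assms in \<open>simp add: frechet_derivative_works\<close>)
  moreover have "?D (s *\<^sub>R b) = ?D b * s" for s
    using linear_frechet_derivative[OF assms] by (simp add: linear_scale mult.commute)
  ultimately show ?thesis
    by (simp add: has_field_derivative_def ddir_def mult_commute_abs)
qed

subsection \<open>Symmetry of second derivatives\<close>

text \<open>The mean value theorem is used twice: in direction b for the increment of f along c,
  then in direction c for the derivative along b.\<close>

lemma second_difference:
  fixes p b c :: "'a::euclidean_space"
  assumes f: "Cinf_on f U" and B: "ball p r \<subseteq> U" and h: "h > 0" "h * (norm b + norm c) < r"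
  shows "\<exists>q. dist p q \<le> h * (norm b + norm c) \<and>
    f (p + h *\<^sub>R b + h *\<^sub>R c) - f (p + h *\<^sub>R b) - f (p + h *\<^sub>R c) + f p = h * (h * ddir c (ddir b f) q)"
proof -
  have in_U: "p + s *\<^sub>R b + t *\<^sub>R c \<in> U" and near: "dist p (p + s *\<^sub>R b + t *\<^sub>R c) \<le> h * (norm b + norm c)"
    if "0 \<le> s" "s \<le> h" "0 \<le> t" "t \<le> h" for s t
  proof -
    have "norm (s *\<^sub>R b + t *\<^sub>R c) \<le> s * norm b + t * norm c"
      using norm_triangle_ineq[of "s *\<^sub>R b" "t *\<^sub>R c"] that by simp
    also have "\<dots> \<le> h * norm b + h * norm c"
      using that by (intro add_mono mult_right_mono) auto
    finally show d: "dist p (p + s *\<^sub>R b + t *\<^sub>R c) \<le> h * (norm b + norm c)"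
      by (simp add: dist_norm algebra_simps norm_minus_commute add.commute)
    show "p + s *\<^sub>R b + t *\<^sub>R c \<in> U"
      using B d h(2) by (meson mem_ball order_le_less_trans subsetD)
  qed
  let ?g = "\<lambda>s. f (p + h *\<^sub>R c + s *\<^sub>R b) - f (p + s *\<^sub>R b)"
  have g: "(?g has_real_derivative ddir b f (p + h *\<^sub>R c + s *\<^sub>R b) - ddir b f (p + s *\<^sub>R b)) (at s)"
    if "0 \<le> s" "s \<le> h" for s
    using in_U[OF that, of h] in_U[OF that, of 0] h
    by (intro DERIV_diff ddir_line Cinf_on_differentiable[OF f]) (simp_all add: add_ac)
  obtain s where s: "0 < s" "s < h"
    "?g h - ?g 0 = (h - 0) * (ddir b f (p + h *\<^sub>R c + s *\<^sub>R b) - ddir b f (p + s *\<^sub>R b))"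
    using MVT2[OF h(1) g] by blast
  let ?k = "\<lambda>t. ddir b f (p + s *\<^sub>R b + t *\<^sub>R c)"
  have k: "(?k has_real_derivative ddir c (ddir b f) (p + s *\<^sub>R b + t *\<^sub>R c)) (at t)" if "0 \<le> t" "t \<le> h" for t
    using in_U[of s t] that s by (intro ddir_line Cinf_on_differentiable[OF Cinf_on_ddir[OF f]]) simp
  obtain t where t: "0 < t" "t < h" "?k h - ?k 0 = (h - 0) * ddir c (ddir b f) (p + s *\<^sub>R b + t *\<^sub>R c)"
    using MVT2[OF h(1) k] by blast
  show ?thesis
    by (rule exI[of _ "p + s *\<^sub>R b + t *\<^sub>R c"])
      (use near[of s t] s t in \<open>simp add: add_ac\<close>)
qed

text \<open>The second difference is symmetric in b and c, so the two mixed derivatives agree at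
  points arbitrarily near p; continuity does the rest.\<close>

lemma ddir_commute:
  assumes f: "Cinf_on f U" and p: "p \<in> U"
  shows "ddir b (ddir c f) p = ddir c (ddir b f) p"
proof (rule ccontr)
  let ?F = "ddir b (ddir c f)" and ?G = "ddir c (ddir b f)"
  assume "?F p \<noteq> ?G p"
  then have e: "dist (?F p) (?G p) / 2 > 0" (is "?e > 0")
    by simp
  have "isCont ?F p" "isCont ?G p"
    by (intro Cinf_on_continuous[OF _ p] Cinf_on_ddir f)+
  then obtain d1 d2 where d: "d1 > 0" "\<And>q. dist p q < d1 \<Longrightarrow> dist (?F p) (?F q) < ?e"
    "d2 > 0" "\<And>q. dist p q < d2 \<Longrightarrow> dist (?G p) (?G q) < ?e"
    using e unfolding continuous_at_eps_delta by (metis dist_commute)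
  obtain r where r: "r > 0" "ball p r \<subseteq> U"
    using Cinf_on_open[OF f] p openE by blast
  define R where "R = min r (min d1 d2)"
  define n where "n = norm b + norm c"
  \<comment> \<open>The shift by 1 keeps the denominator positive when both directions are
    zero.\<close>
  define h where "h = R / (2 * (n + 1))"
  have "R > 0" "n \<ge> 0"
    using r d by (simp_all add: R_def n_def)
  then have h: "h > 0" "h * n < R"
  proof -
    show "h > 0"
      using \<open>R > 0\<close> \<open>n \<ge> 0\<close> by (simp add: h_def)
    moreover have "h * (2 * (n + 1)) = R"
      using \<open>n \<ge> 0\<close> by (simp add: h_def)
    moreover have "n < 2 * (n + 1)"
      using \<open>n \<ge> 0\<close> by simp
    ultimately show "h * n < R"
      by (metis mult_strict_left_mono)
  qed
  have B: "ball p R \<subseteq> U"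
    using r by (auto simp: R_def)
  obtain q q' where q: "dist p q \<le> h * n" "dist p q' \<le> h * n"
    "f (p + h *\<^sub>R b + h *\<^sub>R c) - f (p + h *\<^sub>R b) - f (p + h *\<^sub>R c) + f p = h * (h * ?G q)"
    "f (p + h *\<^sub>R c + h *\<^sub>R b) - f (p + h *\<^sub>R c) - f (p + h *\<^sub>R b) + f p = h * (h * ?F q')"
    using second_difference[OF f B h(1), of b c] second_difference[OF f B h(1), of c b] h(2)
    by (auto simp: n_def add.commute)
  moreover have "p + h *\<^sub>R c + h *\<^sub>R b = p + h *\<^sub>R b + h *\<^sub>R c"
    by (simp add: add_ac)
  ultimately have "h * (h * ?G q) = h * (h * ?F q')"
    by (simp only:)
  then have "?G q = ?F q'"
    using h by simp
  moreover have "dist (?F p) (?F q') < ?e" "dist (?G p) (?G q) < ?e"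
    using d q(1,2) h(2) by (auto simp: R_def)
  ultimately have "dist (?F p) (?G p) < ?e + ?e"
    using dist_triangle_half_l by (smt (verit) dist_commute dist_triangle2)
  then show False
    by simp
qed

lemma foldr_ddir_rotate:
  assumes f: "Cinf_on f U" and "p \<in> U"
  shows "foldr ddir bs (ddir c f) p = ddir c (foldr ddir bs f) p"
  using assms(2)
proof (induction bs arbitrary: p)
  case (Cons b bs)
  have "ddir b (foldr ddir bs (ddir c f)) p = ddir b (ddir c (foldr ddir bs f)) p"
    by (rule ddir_cong[OF Cinf_on_open[OF f]]) (use Cons in auto)
  also have "\<dots> = ddir c (ddir b (foldr ddir bs f)) p"
    by (rule ddir_commute[OF Cinf_on_foldr_ddir[OF f] Cons.prems])
  finally show ?case by simp
qed simp

lemma foldr_ddir_append_commute: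
  assumes f: "Cinf_on f U" and "p \<in> U"
  shows "foldr ddir (bs @ cs) f p = foldr ddir (cs @ bs) f p"
  using assms(2)
proof (induction cs arbitrary: p)
  case (Cons c cs)
  have "foldr ddir (bs @ c # cs) f p = ddir c (foldr ddir (bs @ cs) f) p"
    using foldr_ddir_rotate[OF Cinf_on_foldr_ddir[OF f] Cons.prems] by simp
  also have "\<dots> = ddir c (foldr ddir (cs @ bs) f) p"
    by (rule ddir_cong[OF Cinf_on_open[OF f]]) (use Cons in auto)
  finally show ?case by simp
qed simp

lemma ddir_0: "f differentiable (at p) \<Longrightarrow> ddir 0 f p = 0"
  unfolding ddir_def using linear_frechet_derivative linear_0 by blast

text \<open>Meant for coordinates that a projection forgets: their unit vectors are sent to
  0.\<close>

lemma foldr_ddir_zero_direction: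
  assumes f: "Cinf_on f U" "p \<in> U" and "0 \<in> set bs"
  shows "foldr ddir bs f p = 0"
proof -
  obtain as cs where bs: "bs = as @ 0 # cs"
    using assms(3) split_list by metis
  have "foldr ddir bs f p = foldr ddir as (ddir 0 (foldr ddir cs f)) p"
    by (simp add: bs)
  also have "\<dots> = 0"
    by (rule foldr_ddir_eq_0[OF Cinf_on_open[OF f(1)] _ f(2)])
      (intro ddir_0 Cinf_on_differentiable[OF Cinf_on_foldr_ddir[OF f(1)]])
  finally show ?thesis .
qed

subsection \<open>Vanishing of derivatives\<close>

text \<open>Once the lower derivatives vanish, the j-th one at an intermediate point of the line is
  j! f / t^j, which is O(t^(N - j)); continuity transfers this to t = 0.\<close>

lemma ddir_power_eq_0:
  assumes f: "Cinf_on f U" and p: "p \<in> U" and j: "j < N"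
    and O: "\<forall>\<^sub>F t in nhds 0. \<bar>f (p + t *\<^sub>R v)\<bar> \<le> C * \<bar>t\<bar> ^ N"
  shows "(ddir v ^^ j) f p = 0"
  using j
proof (induction j rule: less_induct)
  case (less j)
  let ?D = "\<lambda>i t. (ddir v ^^ i) f (p + t *\<^sub>R v)"
  have smooth: "Cinf_on ((ddir v ^^ i) f) U" for i
    by (induction i) (simp_all add: f Cinf_on_ddir)
  have "\<forall>\<^sub>F t in nhds 0. p + t *\<^sub>R v \<in> U"
  proof -
    have "open ((\<lambda>t. p + t *\<^sub>R v) -` U)"
      by (intro open_vimage Cinf_on_open[OF f] continuous_intros)
    then show ?thesis
      using p unfolding eventually_nhds by (intro exI[of _ "(\<lambda>t. p + t *\<^sub>R v) -` U"]) simp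
  qed
  with O have "\<forall>\<^sub>F t in nhds 0. p + t *\<^sub>R v \<in> U \<and> \<bar>f (p + t *\<^sub>R v)\<bar> \<le> C * \<bar>t\<bar> ^ N"
    by eventually_elim simp
  then obtain d where d: "d > 0" and in_U: "\<And>t. \<bar>t\<bar> < d \<Longrightarrow> p + t *\<^sub>R v \<in> U"
    and bound: "\<And>t. \<bar>t\<bar> < d \<Longrightarrow> \<bar>f (p + t *\<^sub>R v)\<bar> \<le> C * \<bar>t\<bar> ^ N"
    unfolding eventually_nhds_metric by (auto simp: dist_norm)
  have C: "C \<ge> 0"
  proof (rule ccontr)
    assume "\<not> C \<ge> 0"
    then have "C * \<bar>d / 2\<bar> ^ N < 0"
      using d by (intro mult_neg_pos) auto
    with bound[of "d / 2"] d show False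
      by simp
  qed
  \<comment> \<open>The weak inequality admits \<tau> = 0 for the case j = 0, which Maclaurin's
    theorem does not cover. The power t^(N - j) is weakened to t.\<close>
  have ex: "\<exists>\<tau>. 0 \<le> \<tau> \<and> \<tau> \<le> t \<and> \<bar>?D j \<tau>\<bar> \<le> fact j * C * t" if t: "0 < t" "t < min d 1" for t
  proof (cases "j = 0")
    case True
    have "\<bar>f p\<bar> \<le> C * 0 ^ N"
      using bound[of 0] d by simp
    moreover have "(0::real) ^ N = 0"
      using less.prems by simp
    moreover have "0 \<le> C * t"
      using C t by simp
    ultimately show ?thesis
      using True t by (intro exI[of _ 0]) simp
  next
    case False
    have "\<forall>m s. m < j \<and> 0 \<le> s \<and> s \<le> t \<longrightarrow> (?D m has_real_derivative ?D (Suc m) s) (at s)"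
      using t in_U by (auto intro!: ddir_line Cinf_on_differentiable[OF smooth])
    then obtain \<tau> where \<tau>: "0 < \<tau>" "\<tau> < t"
      "?D 0 t = (\<Sum>m<j. ?D m 0 / fact m * t ^ m) + ?D j \<tau> / fact j * t ^ j"
      using Maclaurin[OF t(1), of j ?D "?D 0"] False by auto
    have "(\<Sum>m<j. ?D m 0 / fact m * t ^ m) = 0"
      using less by (intro sum.neutral) auto
    then have "?D j \<tau> = fact j * (f (p + t *\<^sub>R v) / t ^ j)"
      using \<tau>(3) t by simp
    then have "\<bar>?D j \<tau>\<bar> = fact j * (\<bar>f (p + t *\<^sub>R v)\<bar> / t ^ j)"
      using t by (simp add: abs_mult)
    also have "\<dots> \<le> fact j * (C * t ^ N / t ^ j)"
      using bound[of t] t by (intro mult_left_mono divide_right_mono) auto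
    also have "t ^ N = t ^ j * t ^ (N - j)"
      using less.prems by (simp flip: power_add)
    also have "fact j * (C * (t ^ j * t ^ (N - j)) / t ^ j) = fact j * C * t ^ (N - j)"
      using t by simp
    also have "\<dots> \<le> fact j * C * t"
    proof -
      have "t ^ (N - j) \<le> t ^ 1"
        using t less.prems by (intro power_decreasing) auto
      then show ?thesis
        using C by (simp add: mult_left_mono)
    qed
    finally show ?thesis
      using \<tau> by (intro exI[of _ \<tau>]) auto
  qed
  show ?case
  proof (rule ccontr)
    assume ne: "(ddir v ^^ j) f p \<noteq> 0"
    define e where "e = \<bar>?D j 0\<bar>"
    have "e > 0"
      using ne by (simp add: e_def)
    have "isCont (?D j) 0"
      using DERIV_isCont[OF ddir_line[OF Cinf_on_differentiable[OF smooth]], of p 0 v j] p by simp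
    then obtain d' where d': "d' > 0" "\<And>t. \<bar>t\<bar> < d' \<Longrightarrow> \<bar>?D j t - ?D j 0\<bar> < e / 2"
      unfolding continuous_at_eps_delta dist_norm real_norm_def diff_0_right
      using half_gt_zero[OF \<open>e > 0\<close>] by blast
    \<comment> \<open>Chosen so that j! C t < e/2 for t < E; the summand 1 covers C = 0.\<close>
    define E where "E = e / (2 * (fact j * \<bar>C\<bar> + 1))"
    define t where "t = min (min d 1) (min d' E) / 2"
    have pos: "fact j * \<bar>C\<bar> + 1 > 0"
      by (simp add: add_nonneg_pos)
    have "E > 0"
      using \<open>e > 0\<close> pos by (simp add: E_def)
    with d d'(1) have t: "0 < t" "t < min d 1" "t < d'" "t < E"
      by (simp_all add: t_def min_def)
    obtain \<tau> where \<tau>: "0 \<le> \<tau>" "\<tau> \<le> t" "\<bar>?D j \<tau>\<bar> \<le> fact j * C * t"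
      using ex[OF t(1,2)] by blast
    have "fact j * C * t \<le> (fact j * \<bar>C\<bar> + 1) * t"
    proof (rule mult_right_mono)
      have "fact j * C \<le> fact j * \<bar>C\<bar>"
        by (intro mult_left_mono) auto
      then show "fact j * C \<le> fact j * \<bar>C\<bar> + 1"
        by linarith
    qed (use t in simp)
    also have "\<dots> < e / 2"
      using t(4) pos by (simp add: E_def field_simps)
    finally have "\<bar>?D j \<tau>\<bar> < e / 2"
      using \<tau> by linarith
    moreover have "\<bar>?D j \<tau> - ?D j 0\<bar> < e / 2"
      using d'(2)[of \<tau>] \<tau> t by simp
    ultimately show False
      unfolding e_def by linarith
  qed
qed

lemma ddir_dir_add:
  assumes "f differentiable (at p)"
  shows "ddir (u + v) f p = ddir u f p + ddir v f p"
  unfolding ddir_def using linear_add[OF linear_frechet_derivative[OF assms]] .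

text \<open>The bound holds around every point (e, 0) near the origin, so the x-derivatives of order
  below 3 vanish along a piece of the \<epsilon>-axis, and so do all their
  \<epsilon>-derivatives.\<close>

lemma foldr_ddir_eq_0_of_cubic:
  fixes f :: "real \<times> real \<times> real \<Rightarrow> real"
  assumes f: "Cinf_on f U" "0 \<in> U"
    and O: "\<forall>\<^sub>F p in nhds 0. \<bar>f p\<bar> \<le> C * norm (snd p) ^ 3"
    and ab: "a + b < 3"
  shows "foldr ddir (replicate a (0, 1, 0) @ replicate b (0, 0, 1) @ replicate c (1, 0)) f 0 = 0"
proof -
  let ?u = "(0, 1, 0) :: real \<times> real \<times> real" and ?v = "(0, 0, 1) :: real \<times> real \<times> real"
  let ?xs = "replicate a ?u @ replicate b ?v"
  obtain W where W: "open W" "0 \<in> W" "\<And>p. p \<in> W \<Longrightarrow> \<bar>f p\<bar> \<le> C * norm (snd p) ^ 3"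
    using O unfolding eventually_nhds by blast
  define V where "V = U \<inter> W"
  have V: "open V" "0 \<in> V" "V \<subseteq> U"
    using W(1,2) f(2) Cinf_on_open[OF f(1)] by (auto simp: V_def)
  have line: "(ddir (0, y) ^^ j) f (e, 0) = 0" if q: "(e, 0) \<in> V" and "j < 3" for e y j
  proof (rule ddir_power_eq_0[OF f(1) _ that(2)])
    show "(e, 0) \<in> U"
      using q V by auto
    have "open ((\<lambda>t. (e, 0) + t *\<^sub>R (0, y)) -` W)"
      by (intro open_vimage W continuous_intros)
    then have "\<forall>\<^sub>F t in nhds 0. (e, 0) + t *\<^sub>R (0, y) \<in> W"
      unfolding eventually_nhds using q
      by (intro exI[of _ "(\<lambda>t. (e, 0) + t *\<^sub>R (0, y)) -` W"]) (simp add: V_def zero_prod_def)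
    then show "\<forall>\<^sub>F t in nhds 0. \<bar>f ((e, 0) + t *\<^sub>R (0, y))\<bar> \<le> (C * norm y ^ 3) * \<bar>t\<bar> ^ 3"
    proof eventually_elim
      case (elim t)
      have "snd ((e, 0) + t *\<^sub>R (0 :: real, y)) = t *\<^sub>R y"
        by simp
      with W(3)[OF elim] show ?case
        by (simp add: power_mult_distrib mult_ac)
    qed
  qed
  have G0: "foldr ddir ?xs f (e, 0) = 0" if q: "(e, 0) \<in> V" for e
  proof -
    have qU: "(e, 0) \<in> U"
      using q V by auto
    consider "b = 0" | "a = 0" | "a = 1" "b = 1"
      using ab by linarith
    then show ?thesis
    proof cases
      case 1
      then show ?thesis
        using line[OF q, of a "(1, 0)"] ab by simp
    next
      case 2
      then show ?thesis
        using line[OF q, of b "(0, 1)"] ab by simp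
    next
      case 3
      have d: "g differentiable (at (e, 0))" if "Cinf_on g U" for g
        using Cinf_on_differentiable[OF that qU] .
      note sm = Cinf_on_ddir[OF f(1)]
      have s: "(0, 1, 1) = ?u + ?v"
        by simp
      \<comment> \<open>Polarization: the second derivative along (1, 1) is the sum of the two pure
        ones and twice the mixed one.\<close>
      have "0 = ddir (?u + ?v) (ddir (?u + ?v) f) (e, 0)"
        using line[OF q, of 2 "(1, 1)"] unfolding s[symmetric] by (simp add: numeral_2_eq_2)
      also have "\<dots> = ddir (?u + ?v) (\<lambda>p. ddir ?u f p + ddir ?v f p) (e, 0)"
        by (rule ddir_cong[OF Cinf_on_open[OF f(1)] qU ddir_dir_add[OF Cinf_on_differentiable[OF f(1)]]])
      also have "\<dots> = ddir (?u + ?v) (ddir ?u f) (e, 0) + ddir (?u + ?v) (ddir ?v f) (e, 0)"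
        by (rule ddir_add[OF d[OF sm] d[OF sm]])
      also have "\<dots> = ddir ?u (ddir ?u f) (e, 0) + ddir ?v (ddir ?u f) (e, 0)
          + (ddir ?u (ddir ?v f) (e, 0) + ddir ?v (ddir ?v f) (e, 0))"
        by (simp only: ddir_dir_add[OF d[OF sm]])
      also have "ddir ?v (ddir ?u f) (e, 0) = ddir ?u (ddir ?v f) (e, 0)"
        by (rule ddir_commute[OF f(1) qU])
      finally have "0 = ddir ?u (ddir ?u f) (e, 0) + ddir ?u (ddir ?v f) (e, 0)
          + (ddir ?u (ddir ?v f) (e, 0) + ddir ?v (ddir ?v f) (e, 0))" .
      moreover have "ddir ?u (ddir ?u f) (e, 0) = 0" "ddir ?v (ddir ?v f) (e, 0) = 0"
        using line[OF q, of 2 "(1, 0)"] line[OF q, of 2 "(0, 1)"] by (simp_all add: numeral_2_eq_2)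
      ultimately show ?thesis
        by (simp add: 3)
    qed
  qed
  let ?L = "\<lambda>e. (e, 0) :: real \<times> real \<times> real"
  have L: "bounded_linear ?L"
    by (intro bounded_linear_Pair bounded_linear_ident bounded_linear_zero)
  \<comment> \<open>With the \<epsilon>-derivatives outermost, they act on a function restricted to
    the axis, where it is zero.\<close>
  have "foldr ddir (replicate a ?u @ replicate b ?v @ replicate c (1, 0)) f 0
      = foldr ddir (replicate c (1, 0) @ ?xs) f 0"
    using foldr_ddir_append_commute[OF f, of ?xs "replicate c (1, 0)"] by simp
  also have "\<dots> = foldr ddir (map ?L (replicate c 1)) (foldr ddir ?xs f) (?L 0)"
    by (simp add: zero_prod_def)
  also have "\<dots> = foldr ddir (replicate c 1) (\<lambda>e. foldr ddir ?xs f (?L e)) 0"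
    by (rule foldr_ddir_compose_linear[OF L Cinf_on_foldr_ddir[OF f(1)], symmetric])
      (use f(2) in \<open>simp add: zero_prod_def\<close>)
  also have "\<dots> = 0"
    by (rule foldr_ddir_eq_0[of "?L -` V"])
      (use V G0 in \<open>auto simp: zero_prod_def intro!: open_vimage continuous_intros\<close>)
  finally show ?thesis .
qed

text \<open>The c-th \<epsilon>-derivative vanishes on the hyperplane \<epsilon> = 0 near the
  origin, and the remaining derivatives are tangent to it.\<close>

lemma foldr_ddir_eq_0_of_flat:
  fixes f :: "real \<times> 'b::euclidean_space \<Rightarrow> real"
  assumes f: "Cinf_on f U" "0 \<in> U"
    and O: "\<forall>\<^sub>F p in nhds 0. \<bar>f p\<bar> \<le> C * \<bar>fst p\<bar> ^ Suc c"
  shows "foldr ddir (map (Pair 0) ys @ replicate c (1, 0)) f 0 = 0"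
proof -
  obtain W where W: "open W" "0 \<in> W" "\<And>p. p \<in> W \<Longrightarrow> \<bar>f p\<bar> \<le> C * \<bar>fst p\<bar> ^ Suc c"
    using O unfolding eventually_nhds by blast
  define V where "V = U \<inter> W"
  have V: "open V" "0 \<in> V" "V \<subseteq> U"
    using W(1,2) f(2) Cinf_on_open[OF f(1)] by (auto simp: V_def)
  let ?G = "foldr ddir (replicate c (1, 0)) f"
  have G0: "?G (0, y) = 0" if q: "(0, y) \<in> V" for y
  proof -
    have "(ddir (1, 0) ^^ c) f (0, y) = 0"
    proof (rule ddir_power_eq_0[OF f(1) _ lessI])
      show "(0, y) \<in> U"
        using q V by auto
      have "open ((\<lambda>t. (0, y) + t *\<^sub>R (1, 0)) -` W)"
        by (intro open_vimage W continuous_intros)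
      then have "\<forall>\<^sub>F t in nhds 0. (0, y) + t *\<^sub>R (1, 0) \<in> W"
        unfolding eventually_nhds using q
        by (intro exI[of _ "(\<lambda>t. (0, y) + t *\<^sub>R (1, 0)) -` W"]) (simp add: V_def)
      then show "\<forall>\<^sub>F t in nhds 0. \<bar>f ((0, y) + t *\<^sub>R (1, 0))\<bar> \<le> C * \<bar>t\<bar> ^ Suc c"
      proof eventually_elim
        case (elim t)
        with W(3)[OF elim] show ?case
          by simp
      qed
    qed
    then show ?thesis by simp
  qed
  have L: "bounded_linear (Pair 0 :: 'b \<Rightarrow> real \<times> 'b)"
    by (intro bounded_linear_Pair bounded_linear_ident bounded_linear_zero)
  have "foldr ddir (map (Pair 0) ys @ replicate c (1, 0)) f 0 = foldr ddir (map (Pair 0) ys) ?G (0, 0)"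
    by (simp add: zero_prod_def)
  also have "\<dots> = foldr ddir ys (\<lambda>y. ?G (0, y)) 0"
    by (rule foldr_ddir_compose_linear[OF L Cinf_on_foldr_ddir[OF f(1)], symmetric])
      (use f(2) in \<open>simp add: zero_prod_def\<close>)
  also have "\<dots> = 0"
    by (rule foldr_ddir_eq_0[of "Pair 0 -` V"])
      (use V G0 in \<open>auto simp: zero_prod_def intro!: open_vimage continuous_intros\<close>)
  finally show ?thesis .
qed

subsection \<open>Products of functions of one variable\<close>

text \<open>The terms w(\<epsilon>) x^2 / 2 have this shape, with factor 1 in the other variables;
  their partial derivatives then reduce to derivatives in one variable.\<close>

definition sepprod :: "('n::finite \<Rightarrow> real \<Rightarrow> real) \<Rightarrow> real ^ 'n \<Rightarrow> real" where
  "sepprod g p = (\<Prod>v\<in>UNIV. g v (p $ v))"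

lemma Cinf_on_sepprod:
  fixes g :: "'n::finite \<Rightarrow> real \<Rightarrow> real"
  assumes "\<And>v. Cinf_on (g v) (U v)"
  shows "Cinf_on (sepprod g) {p. \<forall>v. p $ v \<in> U v}"
proof -
  have eq: "{p :: real ^ 'n. \<forall>v. p $ v \<in> U v} = (\<Inter>v. (\<lambda>p. p $ v) -` U v)"
    by auto
  have op: "open {p :: real ^ 'n. \<forall>v. p $ v \<in> U v}"
    unfolding eq by (intro open_INT open_vimage continuous_intros ballI)
      (use Cinf_on_open[OF assms] in auto)
  have "Cinf_on (\<lambda>p. g v (p $ v)) {p. \<forall>v. p $ v \<in> U v}" for v
    by (rule Cinf_on_subset[OF Cinf_on_compose_linear[OF bounded_linear_vec_nth assms] op]) auto
  then show ?thesis
    unfolding sepprod_def by (intro Cinf_on_prod op)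
qed

lemma ddir_sepprod:
  fixes g :: "'n::finite \<Rightarrow> real \<Rightarrow> real"
  assumes g: "\<And>v. Cinf_on (g v) (U v)" and p: "\<And>v. p $ v \<in> U v"
  shows "ddir (axis u 1) (sepprod g) p = sepprod (g(u := ddir 1 (g u))) p"
proof -
  let ?c = "\<Prod>v\<in>UNIV - {u}. g v (p $ v)"
  have "sepprod g differentiable (at p)"
    using Cinf_on_differentiable[OF Cinf_on_sepprod[of g U], OF g] p by blast
  then have 1: "((\<lambda>s. sepprod g (p + s *\<^sub>R axis u 1)) has_real_derivative ddir (axis u 1) (sepprod g) p) (at 0)"
    using ddir_line[of "sepprod g" p 0 "axis u 1"] by simp
  have "sepprod g (p + s *\<^sub>R axis u 1) = g u (p $ u + s *\<^sub>R 1) * ?c" for s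
  proof -
    have "sepprod g (p + s *\<^sub>R axis u 1) = g u (p $ u + s)
        * (\<Prod>v\<in>UNIV - {u}. g v ((p + s *\<^sub>R axis u 1) $ v))"
      unfolding sepprod_def by (subst prod.remove[of _ u]) (simp_all add: axis_def)
    also have "(\<Prod>v\<in>UNIV - {u}. g v ((p + s *\<^sub>R axis u 1) $ v)) = ?c"
      by (rule prod.cong) (auto simp: axis_def)
    finally show ?thesis by simp
  qed
  moreover have "((\<lambda>s. g u (p $ u + s *\<^sub>R 1) * ?c) has_real_derivative ddir 1 (g u) (p $ u) * ?c) (at 0)"
    using ddir_line[of "g u" "p $ u" 0 1] Cinf_on_differentiable[OF g p]
    by (intro DERIV_cmult_right) simp
  ultimately have "ddir (axis u 1) (sepprod g) p = ddir 1 (g u) (p $ u) * ?c"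
    using 1 DERIV_unique by simp
  also have "\<dots> = sepprod (g(u := ddir 1 (g u))) p"
    unfolding sepprod_def by (subst prod.remove[of UNIV u]) simp_all
  finally show ?thesis .
qed

lemma Cinf_on_ddir_power: "Cinf_on f U \<Longrightarrow> Cinf_on ((ddir v ^^ n) f) U"
  by (induction n) (simp_all add: Cinf_on_ddir)

text \<open>F need only agree with the product on the domain, so the lemma can be iterated over the
  coordinates.\<close>

lemma ddir_power_sepprod:
  fixes g :: "'n::finite \<Rightarrow> real \<Rightarrow> real"
  assumes g: "\<And>v. Cinf_on (g v) (U v)" and F: "\<And>p. (\<forall>v. p $ v \<in> U v) \<Longrightarrow> F p = sepprod g p"
    and "\<forall>v. p $ v \<in> U v"
  shows "(ddir (axis u 1) ^^ n) F p = sepprod (g(u := (ddir 1 ^^ n) (g u))) p"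
  using assms(3)
proof (induction n arbitrary: p)
  case 0
  then show ?case by (simp add: F)
next
  case (Suc n)
  let ?g = "g(u := (ddir 1 ^^ n) (g u))"
  have g': "Cinf_on (?g v) (U v)" for v
    using g by (simp add: Cinf_on_ddir_power)
  have "ddir (axis u 1) ((ddir (axis u 1) ^^ n) F) p = ddir (axis u 1) (sepprod ?g) p"
  proof (rule ddir_cong[OF Cinf_on_open[OF Cinf_on_sepprod[of g U, OF g]]])
    show "(ddir (axis u 1) ^^ n) F q = sepprod ?g q" if "q \<in> {p. \<forall>v. p $ v \<in> U v}" for q
      using Suc.IH that by (simp only: mem_Collect_eq)
  qed (use Suc.prems in simp)
  also have "\<dots> = sepprod (?g(u := ddir 1 (?g u))) p"
    by (rule ddir_sepprod[OF g']) (use Suc.prems in blast)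
  finally show ?case by (simp only: funpow.simps o_apply fun_upd_upd fun_upd_same)
qed

lemma mpartial_sepprod:
  fixes g :: "coord \<Rightarrow> real \<Rightarrow> real"
  assumes g: "\<And>v. Cinf_on (g v) (U v)" and p: "\<forall>v. p $ v \<in> U v"
  shows "mpartial m (sepprod g) p = sepprod (\<lambda>v. (ddir 1 ^^ m v) (g v)) p"
proof -
  let ?d = "\<lambda>g u. g(u := (ddir 1 ^^ m u) (g u))"
  let ?D = "\<lambda>u F. (ddir (axis u 1) ^^ m u) F"
  have sm: "Cinf_on (?d g u v) (U v)" if "\<And>v. Cinf_on (g v) (U v)" for g u v
    using that by (simp add: Cinf_on_ddir_power)
  note step = ddir_power_sepprod[where U = U]
  have "mpartial m (sepprod g) p
      = sepprod (?d (?d (?d (?d (?d (?d g Hbar) Eps) Xi2) Xi1) X2) X1) p"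
    unfolding mpartial_def using p
    by (intro step sm g refl)
  also have "?d (?d (?d (?d (?d (?d g Hbar) Eps) Xi2) Xi1) X2) X1 = (\<lambda>v. (ddir 1 ^^ m v) (g v))"
  proof
    fix v show "?d (?d (?d (?d (?d (?d g Hbar) Eps) Xi2) Xi1) X2) X1 v = (ddir 1 ^^ m v) (g v)"
      by (cases v) simp_all
  qed
  finally show ?thesis .
qed

lemma ddir_power_const: "(ddir b ^^ n) (\<lambda>_. c) = (\<lambda>_. if n = 0 then c else 0)"
  by (induction n) (simp_all add: ddir_const)

lemma ddir_half_square: "ddir 1 (\<lambda>x::real. x ^ 2 / 2) = (\<lambda>x. x)" "ddir 1 (\<lambda>x::real. x) = (\<lambda>_. 1)"
proof -
  have "((\<lambda>x::real. x ^ 2 / 2) has_derivative (\<lambda>h. x * h)) (at x)" for x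
    by (auto intro!: derivative_eq_intros)
  then show "ddir 1 (\<lambda>x::real. x ^ 2 / 2) = (\<lambda>x. x)"
    by (intro ext) (metis ddir_eqI mult_1_right)
  show "ddir 1 (\<lambda>x::real. x) = (\<lambda>_. 1)"
    by (intro ext) (simp add: ddir_eqI[OF has_derivative_ident])
qed

lemma ddir_power_half_square: "(ddir 1 ^^ n) (\<lambda>x::real. x ^ 2 / 2) 0 = (if n = 2 then 1 else 0)"
proof -
  consider "n = 0" | "n = 1" | k where "n = k + 2"
    by (metis One_nat_def add_2_eq_Suc' not0_implies_Suc)
  then show ?thesis
  proof cases
    case 3
    have "(ddir 1 ^^ n) (\<lambda>x::real. x ^ 2 / 2) = (ddir 1 ^^ k) (\<lambda>_. 1)"
      unfolding 3 funpow_add by (simp only: numeral_2_eq_2 funpow.simps o_apply id_apply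
          ddir_half_square[unfolded numeral_2_eq_2])
    then show ?thesis
      by (simp add: 3 ddir_power_const)
  qed (simp_all add: ddir_half_square)
qed

section \<open>The quadratic terms of the Hamiltonian\<close>

definition quad :: "(real \<Rightarrow> real) \<Rightarrow> coord \<Rightarrow> real ^ coord \<Rightarrow> real" where
  "quad w v p = w (p $ Eps) * ((p $ v)\<^sup>2 / 2)"

lemma quad_eq_sepprod:
  assumes "v \<noteq> Eps"
  shows "quad w v = sepprod (\<lambda>u. if u = Eps then w else if u = v then (\<lambda>x. x\<^sup>2 / 2) else (\<lambda>_. 1))"
proof
  fix p
  show "quad w v p = sepprod (\<lambda>u. if u = Eps then w else if u = v then (\<lambda>x. x\<^sup>2 / 2) else (\<lambda>_. 1)) p"
    using assms by (cases v) (simp_all add: sepprod_def quad_def UNIV_coord)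
qed

lemma Cinf_on_quad_factor:
  assumes "Cinf_on w U"
  shows "Cinf_on ((\<lambda>u. if u = Eps then w else if u = v then (\<lambda>x. x\<^sup>2 / 2) else (\<lambda>_. 1)) u)
      (if u = Eps then U else UNIV)"
proof -
  have "Cinf_on (\<lambda>x::real. x * x * (1 / 2)) UNIV"
    by (intro Cinf_on_mult Cinf_on_id Cinf_on_const) simp
  then have "Cinf_on (\<lambda>x::real. x\<^sup>2 / 2) UNIV"
    by (simp add: power2_eq_square)
  with assms show ?thesis
    by (simp add: Cinf_on_const)
qed

lemma Cinf_on_quad:
  assumes "Cinf_on w U" "v \<noteq> Eps"
  shows "Cinf_on (quad w v) {p. p $ Eps \<in> U}"
proof -
  have "{p :: real ^ coord. \<forall>u. p $ u \<in> (if u = Eps then U else UNIV)} = {p. p $ Eps \<in> U}"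
    by auto
  moreover have "Cinf_on (sepprod (\<lambda>u. if u = Eps then w else if u = v then (\<lambda>x. x\<^sup>2 / 2) else (\<lambda>_. 1)))
      {p. \<forall>u. p $ u \<in> (if u = Eps then U else UNIV)}"
    by (rule Cinf_on_sepprod[of _ "\<lambda>u. if u = Eps then U else UNIV"]) (rule Cinf_on_quad_factor[OF assms(1)])
  ultimately show ?thesis
    by (simp only: quad_eq_sepprod[OF assms(2)])
qed

lemma mpartial_quad:
  assumes w: "Cinf_on w U" "0 \<in> U" and v: "v \<in> {X1, X2, Xi1, Xi2}"
  shows "mpartial m (quad w v) 0
    = (if m = (\<lambda>_. 0)(v := 2, Eps := m Eps) then (ddir 1 ^^ m Eps) w 0 else 0)"
proof -
  have ne: "v \<noteq> Eps"
    using v by auto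
  let ?g = "\<lambda>u. if u = Eps then w else if u = v then (\<lambda>x. x\<^sup>2 / 2) else (\<lambda>_. 1)"
  have "mpartial m (quad w v) 0 = sepprod (\<lambda>u. (ddir 1 ^^ m u) (?g u)) 0"
    unfolding quad_eq_sepprod[OF ne]
    by (rule mpartial_sepprod[OF Cinf_on_quad_factor[OF w(1)]]) (use w(2) in auto)
  also have "\<dots> = (\<Prod>u\<in>UNIV. if u = Eps then (ddir 1 ^^ m Eps) w 0
      else if m u = (if u = v then 2 else 0) then 1 else 0)"
    unfolding sepprod_def by (rule prod.cong) (simp_all add: ddir_power_half_square ddir_power_const)
  also have "\<dots> = (if m = (\<lambda>_. 0)(v := 2, Eps := m Eps) then (ddir 1 ^^ m Eps) w 0 else 0)"
  proof (cases "m = (\<lambda>_. 0)(v := 2, Eps := m Eps)")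
    case True
    then have "m u = (if u = v then 2 else 0)" if "u \<noteq> Eps" for u
      using that by (metis fun_upd_apply)
    then have "(\<Prod>u\<in>UNIV. if u = Eps then (ddir 1 ^^ m Eps) w 0
        else if m u = (if u = v then 2 else 0) then 1 else 0)
        = (\<Prod>u\<in>UNIV. if u = Eps then (ddir 1 ^^ m Eps) w 0 else 1)"
      by (intro prod.cong) auto
    with True show ?thesis
      by simp
  next
    case False
    then obtain u where u: "m u \<noteq> ((\<lambda>_. 0)(v := 2, Eps := m Eps)) u"
      by blast
    then have "u \<noteq> Eps" "m u \<noteq> (if u = v then 2 else 0)"
      by (auto split: if_splits)
    then have "(\<Prod>u\<in>UNIV. if u = Eps then (ddir 1 ^^ m Eps) w 0
        else if m u = (if u = v then 2 else 0) then 1 else 0) = 0"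
      by (intro prod_zero bexI[of _ u]) auto
    with False show ?thesis
      by simp
  qed
  finally show ?thesis .
qed

section \<open>The Taylor series of the Hamiltonian\<close>

definition dirs :: "(coord \<Rightarrow> nat) \<Rightarrow> (real ^ coord) list" where
  "dirs m = replicate (m X1) (axis X1 1) @ replicate (m X2) (axis X2 1) @ replicate (m Xi1) (axis Xi1 1)
     @ replicate (m Xi2) (axis Xi2 1) @ replicate (m Eps) (axis Eps 1) @ replicate (m Hbar) (axis Hbar 1)"

lemma mpartial_eq_foldr: "mpartial m f = foldr ddir (dirs m) f"
  by (simp add: mpartial_def dirs_def)

lemma mpartial_add:
  assumes "Cinf_on f U" "Cinf_on g U" "p \<in> U"
  shows "mpartial m (\<lambda>q. f q + g q) p = mpartial m f p + mpartial m g p"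
  unfolding mpartial_eq_foldr by (rule foldr_ddir_add[OF assms])

definition pr_R :: "real ^ coord \<Rightarrow> real \<times> real \<times> real" where
  "pr_R p = (p $ Eps, p $ X1, p $ X2)"

definition pr_rho :: "real ^ coord \<Rightarrow> real \<times> (real \<times> real) \<times> (real \<times> real)" where
  "pr_rho p = (p $ Eps, (p $ X1, p $ X2), (p $ Xi1, p $ Xi2))"

lemma bounded_linear_pr_R: "bounded_linear pr_R"
  unfolding pr_R_def[abs_def] by (intro bounded_linear_Pair bounded_linear_vec_nth)

lemma bounded_linear_pr_rho: "bounded_linear pr_rho"
  unfolding pr_rho_def[abs_def] by (intro bounded_linear_Pair bounded_linear_vec_nth)

lemma map_pr_R_dirs:
  "map pr_R (dirs m) = replicate (m X1) (0, 1, 0) @ replicate (m X2) (0, 0, 1) @ replicate (m Xi1) 0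
     @ replicate (m Xi2) 0 @ replicate (m Eps) (1, 0) @ replicate (m Hbar) 0"
  by (simp add: dirs_def pr_R_def axis_def zero_prod_def)

lemma map_pr_rho_dirs:
  "map pr_rho (dirs m) = map (Pair 0) (replicate (m X1) ((1, 0), 0) @ replicate (m X2) ((0, 1), 0)
     @ replicate (m Xi1) (0, (1, 0)) @ replicate (m Xi2) (0, (0, 1)))
     @ replicate (m Eps) (1, 0) @ replicate (m Hbar) 0"
  by (simp add: dirs_def pr_rho_def axis_def zero_prod_def)

lemma mpartial_flat:
  assumes f: "Cinf_on f U" "0 \<in> U"
    and O: "\<And>N. \<exists>C. \<forall>\<^sub>F p in nhds 0. \<bar>f p\<bar> \<le> C * \<bar>fst p\<bar> ^ N"
  shows "mpartial m (\<lambda>p. f (pr_rho p)) 0 = 0"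
proof -
  have 0: "pr_rho 0 = 0"
    by (simp add: pr_rho_def zero_prod_def)
  have "mpartial m (\<lambda>p. f (pr_rho p)) 0 = foldr ddir (map pr_rho (dirs m)) f 0"
    unfolding mpartial_eq_foldr
    using foldr_ddir_compose_linear[OF bounded_linear_pr_rho f(1), of 0 "dirs m"] f(2) by (simp add: 0)
  also have "\<dots> = 0"
  proof (cases "m Hbar = 0")
    case True
    \<comment> \<open>For a given m, flatness of one order more than the number of
      \<epsilon>-derivatives is what is used.\<close>
    obtain C where "\<forall>\<^sub>F p in nhds 0. \<bar>f p\<bar> \<le> C * \<bar>fst p\<bar> ^ Suc (m Eps)"
      using O by blast
    then show ?thesis
      unfolding map_pr_rho_dirs True replicate_0 append_Nil2
      by (rule foldr_ddir_eq_0_of_flat[OF f])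
  next
    case False
    then show ?thesis
      by (intro foldr_ddir_zero_direction[OF f]) (simp add: map_pr_rho_dirs)
  qed
  finally show ?thesis .
qed

lemma mpartial_cubic:
  assumes f: "Cinf_on f U" "0 \<in> U" and O: "\<forall>\<^sub>F p in nhds 0. \<bar>f p\<bar> \<le> C * norm (snd p) ^ 3"
  shows "m X1 + m X2 < 3 \<or> m Xi1 \<noteq> 0 \<or> m Xi2 \<noteq> 0 \<or> m Hbar \<noteq> 0 \<Longrightarrow> mpartial m (\<lambda>p. f (pr_R p)) 0 = 0"
    and "m Xi1 = 0 \<Longrightarrow> m Xi2 = 0 \<Longrightarrow> m Hbar = 0 \<Longrightarrow> m Eps = 0 \<Longrightarrow> mpartial m (\<lambda>p. f (pr_R p)) 0
      = (ddir (1, 0) ^^ m X1) ((ddir (0, 1) ^^ m X2) (\<lambda>x. f (0, x))) (0, 0)"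
proof -
  have 0: "pr_R 0 = 0"
    by (simp add: pr_R_def zero_prod_def)
  have eq: "mpartial m (\<lambda>p. f (pr_R p)) 0 = foldr ddir (map pr_R (dirs m)) f 0"
    unfolding mpartial_eq_foldr
    using foldr_ddir_compose_linear[OF bounded_linear_pr_R f(1), of 0 "dirs m"] f(2) by (simp add: 0)
  show "mpartial m (\<lambda>p. f (pr_R p)) 0 = 0"
    if "m X1 + m X2 < 3 \<or> m Xi1 \<noteq> 0 \<or> m Xi2 \<noteq> 0 \<or> m Hbar \<noteq> 0"
  proof (cases "m Xi1 = 0 \<and> m Xi2 = 0 \<and> m Hbar = 0")
    case True
    then show ?thesis
      unfolding eq map_pr_R_dirs using foldr_ddir_eq_0_of_cubic[OF f O, of "m X1" "m X2" "m Eps"] that by simp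
  next
    case False
    then show ?thesis
      unfolding eq by (intro foldr_ddir_zero_direction[OF f]) (auto simp: map_pr_R_dirs)
  qed
  assume m: "m Xi1 = 0" "m Xi2 = 0" "m Hbar = 0" "m Eps = 0"
  let ?bs = "replicate (m X1) (1, 0) @ replicate (m X2) (0, 1) :: (real \<times> real) list"
  have L: "bounded_linear (Pair 0 :: real \<times> real \<Rightarrow> real \<times> real \<times> real)"
    by (intro bounded_linear_Pair bounded_linear_ident bounded_linear_zero)
  have "mpartial m (\<lambda>p. f (pr_R p)) 0 = foldr ddir (map (Pair 0) ?bs) f (0, 0)"
    unfolding eq map_pr_R_dirs by (simp add: m zero_prod_def)
  also have "\<dots> = foldr ddir ?bs (\<lambda>x. f (0, x)) 0"
    by (rule foldr_ddir_compose_linear[OF L f(1), symmetric]) (use f(2) in \<open>simp add: zero_prod_def\<close>)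
  finally show "mpartial m (\<lambda>p. f (pr_R p)) 0
      = (ddir (1, 0) ^^ m X1) ((ddir (0, 1) ^^ m X2) (\<lambda>x. f (0, x))) (0, 0)"
    by (simp add: zero_prod_def)
qed

text \<open>The function minus its affine part is O(e^2), so its first derivative vanishes by
  \<open>ddir_power_eq_0\<close>.\<close>

lemma ddir_eq_of_bigo:
  assumes w: "Cinf_on w U" "0 \<in> U" and O: "(\<lambda>e. w e - (w 0 + e * c)) \<in> O[nhds 0](\<lambda>e. e\<^sup>2)"
  shows "ddir 1 w 0 = c"
proof -
  let ?l = "\<lambda>e. - w 0 + - c * e"
  have l: "Cinf_on ?l U"
    by (intro Cinf_on_add Cinf_on_mult Cinf_on_const Cinf_on_open[OF w(1)]
        Cinf_on_subset[OF Cinf_on_id Cinf_on_open[OF w(1)]]) simp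
  obtain C where C: "\<forall>\<^sub>F e in nhds 0. norm (w e - (w 0 + e * c)) \<le> C * norm (e\<^sup>2)"
    using O by (elim landau_o.bigE)
  have "(ddir 1 ^^ 1) (\<lambda>e. w e + ?l e) 0 = 0"
  proof (rule ddir_power_eq_0[OF Cinf_on_add[OF w(1) l] w(2)])
    show "\<forall>\<^sub>F t in nhds 0. \<bar>w (0 + t *\<^sub>R 1) + ?l (0 + t *\<^sub>R 1)\<bar> \<le> C * \<bar>t\<bar> ^ 2"
      using C by eventually_elim (simp add: algebra_simps)
  qed simp
  then have "ddir 1 w 0 + ddir 1 ?l 0 = 0"
    using ddir_add[OF Cinf_on_differentiable[OF w] Cinf_on_differentiable[OF l w(2)], of 1] by simp
  moreover have l': "(?l has_derivative (\<lambda>h. - c * h)) (at 0)"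
    by (auto intro!: derivative_eq_intros)
  have "ddir 1 ?l 0 = - c"
    using ddir_eqI[OF l', of 1] by simp
  ultimately show ?thesis
    by simp
qed

lemma mmonom_simps:
  "mmonom ((\<lambda>_. 0)(X1 := a, X2 := b)) = mvar X1 ^ a * mvar X2 ^ b"
  "v \<in> {X1, X2, Xi1, Xi2} \<Longrightarrow> mmonom ((\<lambda>_. 0)(v := 2, Eps := k)) = mvar Eps ^ k * mvar v ^ 2"
  by (auto simp: mmonom_def)

text \<open>All monomials are x_v^2 \<epsilon>^k, of degree k + 2, so below degree 4 only k = 0 and
  k = 1 are left.\<close>

lemma taylor_quad:
  assumes w: "Cinf_on w U" "0 \<in> U" "ddir 1 w 0 = c" and v: "v \<in> {X1, X2, Xi1, Xi2}"
  shows "taylor (quad w v) \<in> ord_ge_xh 2"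
    and "taylor (quad w v) - (mconst (of_real (w 0 / 2)) * mvar v ^ 2
      + mconst (of_real (c / 2)) * mvar Eps * mvar v ^ 2) \<in> ord_ge 4"
proof -
  let ?e = "\<lambda>k. (\<lambda>_. 0 :: nat)(v := 2, Eps := k)"
  have ne: "v \<noteq> Eps"
    using v by auto
  have fact: "(\<Prod>u\<in>UNIV. fact (?e k u)) = (2 * fact k :: real)" for k
    using v by (auto simp: UNIV_coord)
  have coeff: "mcoeff (taylor (quad w v)) m
      = (if m = ?e (m Eps) then of_real ((ddir 1 ^^ m Eps) w 0 / (2 * fact (m Eps))) else 0)" for m
  proof (cases "m = ?e (m Eps)")
    case True
    then have "(\<Prod>u\<in>UNIV. fact (m u)) = (2 * fact (m Eps) :: real)"
      using fact[of "m Eps"] by metis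
    with True show ?thesis
      by (simp only: taylor_def mcoeff_Abs mpartial_quad[OF w(1,2) v] simp_thms if_True)
  next
    case False
    then show ?thesis
      by (simp add: taylor_def mpartial_quad[OF w(1,2) v])
  qed
  have deg: "deg_xh (?e k) = 2" "deg (?e k) = 2 + k" for k
    using v by (auto simp: deg_xh_def deg_def)
  show "taylor (quad w v) \<in> ord_ge_xh 2"
    unfolding ord_ge_xh_def
  proof (intro CollectI allI impI)
    fix m assume "mcoeff (taylor (quad w v)) m \<noteq> 0"
    then have "m = ?e (m Eps)"
      by (simp add: coeff split: if_splits)
    then show "2 \<le> deg_xh m"
      using deg(1)[of "m Eps"] by simp
  qed
  have "mconst (of_real (w 0 / 2)) * mvar v ^ 2 + mconst (of_real (c / 2)) * mvar Eps * mvar v ^ 2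
      = mconst (of_real (w 0 / 2)) * mmonom (?e 0) + mconst (of_real (c / 2)) * mmonom (?e 1)"
    using mmonom_simps(2)[OF v, of 0] mmonom_simps(2)[OF v, of 1] by (simp add: mult.assoc)
  moreover have "taylor (quad w v) - (mconst (of_real (w 0 / 2)) * mmonom (?e 0)
      + mconst (of_real (c / 2)) * mmonom (?e 1)) \<in> ord_ge 4" (is "?D \<in> _")
    unfolding ord_ge_eq_wt_ge
  proof (rule wt_geI)
    fix m assume "wt 1 1 m < 4"
    then have m: "deg m < 4"
      by (simp add: wt_def deg_def deg_xh_def)
    show "mcoeff ?D m = 0"
    proof (cases "m = ?e (m Eps)")
      case True
      then have "m Eps = 0 \<or> m Eps = 1"
        using m deg(2)[of "m Eps"] by simp linarith
      moreover have "?e 0 \<noteq> ?e 1"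
        by (metis fun_upd_apply zero_neq_one)
      ultimately show ?thesis
        using True w(3) by (auto simp: coeff mcoeff_mconst_mult mcoeff_mmonom)
    next
      case False
      then have "m \<noteq> ?e 0" "m \<noteq> ?e 1"
        by (metis fun_upd_apply)+
      with False show ?thesis
        by (simp add: coeff mcoeff_mconst_mult mcoeff_mmonom)
    qed
  qed
  ultimately show "taylor (quad w v) - (mconst (of_real (w 0 / 2)) * mvar v ^ 2
      + mconst (of_real (c / 2)) * mvar Eps * mvar v ^ 2) \<in> ord_ge 4"
    by simp
qed

text \<open>Every monomial has degree at least 3 in x, so below degree 4 there is no room for
  \<epsilon> and only the function at \<epsilon> = 0 contributes.\<close>

lemma taylor_cubic:
  assumes f: "Cinf_on f U" "0 \<in> U" and O: "\<forall>\<^sub>F p in nhds 0. \<bar>f p\<bar> \<le> C * norm (snd p) ^ 3"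
    and T_def: "T = (\<lambda>a b. (ddir (1, 0) ^^ a) ((ddir (0, 1) ^^ b) (\<lambda>x. f (0, x))) (0, 0))"
  shows "taylor (\<lambda>p. f (pr_R p)) \<in> ord_ge_xh 2"
    and "taylor (\<lambda>p. f (pr_R p)) - (mconst (of_real (T 3 0 / 6)) * mvar X1 ^ 3
      + mconst (of_real (T 2 1 / 2)) * (mvar X1 ^ 2 * mvar X2)
      + mconst (of_real (T 1 2 / 2)) * (mvar X1 * mvar X2 ^ 2)
      + mconst (of_real (T 0 3 / 6)) * mvar X2 ^ 3) \<in> ord_ge 4"
proof -
  let ?t = "taylor (\<lambda>p. f (pr_R p))"
  let ?e = "\<lambda>a b. (\<lambda>_. 0 :: nat)(X1 := a, X2 := b)"
  have zero: "mcoeff ?t m = 0" if "m X1 + m X2 < 3 \<or> m Xi1 \<noteq> 0 \<or> m Xi2 \<noteq> 0 \<or> m Hbar \<noteq> 0" for m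
    using mpartial_cubic(1)[OF f O that] by (simp add: taylor_def)
  have val: "mcoeff ?t (?e a b) = of_real (T a b / (fact a * fact b))" for a b
    using mpartial_cubic(2)[OF f O, of "?e a b"] by (simp add: taylor_def T_def UNIV_coord)
  show "?t \<in> ord_ge_xh 2"
    unfolding ord_ge_xh_def
  proof (intro CollectI allI impI)
    fix m assume "mcoeff ?t m \<noteq> 0"
    then have "\<not> m X1 + m X2 < 3"
      using zero[of m] by blast
    then show "2 \<le> deg_xh m"
      by (simp add: deg_xh_def)
  qed
  let ?P = "mconst (of_real (T 3 0 / 6)) * mmonom (?e 3 0) + mconst (of_real (T 2 1 / 2)) * mmonom (?e 2 1)
      + mconst (of_real (T 1 2 / 2)) * mmonom (?e 1 2) + mconst (of_real (T 0 3 / 6)) * mmonom (?e 0 3)"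
  have "?t - ?P \<in> ord_ge 4"
    unfolding ord_ge_eq_wt_ge
  proof (rule wt_geI)
    fix m assume "wt 1 1 m < 4"
    then have m: "deg m < 4"
      by (simp add: wt_def deg_def deg_xh_def)
    have e_eq: "?e a b = ?e a' b' \<longleftrightarrow> a = a' \<and> b = b'" for a b a' b'
      by (simp add: coord_fun_eq_iff)
    show "mcoeff (?t - ?P) m = 0"
    proof (cases "m X1 + m X2 < 3 \<or> m Xi1 \<noteq> 0 \<or> m Xi2 \<noteq> 0 \<or> m Hbar \<noteq> 0")
      case True
      then have "m \<noteq> ?e a b" if "a + b = 3" for a b
        using that by auto
      with zero[OF True] show ?thesis
        by (simp add: mcoeff_mconst_mult mcoeff_mmonom)
    next
      case False
      then have e: "m = ?e (m X1) (m X2)" and s: "m X1 + m X2 = 3"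
        using m by (auto simp: coord_fun_eq_iff deg_def)
      define a where "a = m X1"
      define b where "b = m X2"
      have mab: "m = ?e a b"
        using e by (simp add: a_def b_def)
      have "(a = 3 \<and> b = 0) \<or> (a = 2 \<and> b = 1) \<or> (a = 1 \<and> b = 2) \<or> (a = 0 \<and> b = 3)"
        using s unfolding a_def b_def by linarith
      moreover have "mcoeff (?t - ?P) (?e a b) = 0" if "(a = 3 \<and> b = 0) \<or> (a = 2 \<and> b = 1) \<or> (a = 1 \<and> b = 2) \<or> (a = 0 \<and> b = 3)" for a b
        using that by (elim disjE conjE) (simp_all add: val mcoeff_mconst_mult mcoeff_mmonom e_eq fact_numeral del: fun_upd_apply)
      ultimately show ?thesis
        unfolding mab by blast
    qed
  qed
  then show "?t - (mconst (of_real (T 3 0 / 6)) * mvar X1 ^ 3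
      + mconst (of_real (T 2 1 / 2)) * (mvar X1 ^ 2 * mvar X2)
      + mconst (of_real (T 1 2 / 2)) * (mvar X1 * mvar X2 ^ 2)
      + mconst (of_real (T 0 3 / 6)) * mvar X2 ^ 3) \<in> ord_ge 4"
    unfolding mmonom_simps by simp
qed

text \<open>The factor 2 from differentiating x_1^2 x_2 cancels the division by
  \<open>fact 2 * fact 1\<close>.\<close>

lemma ddir_taylor_hom2:
  "ddir (1, 0) (ddir (1, 0) (ddir (0, 1) (taylor_hom2 3 f))) (0, 0)
     = (ddir (1, 0) ^^ 2) ((ddir (0, 1) ^^ 1) f) (0, 0)"
proof -
  let ?T = "\<lambda>a b. (ddir (1, 0) ^^ a) ((ddir (0, 1) ^^ b) f) (0, 0)"
  define c0 c1 c2 c3 where c: "c0 = ?T 0 3 / 6" "c1 = ?T 1 2 / 2" "c2 = ?T 2 1 / 2" "c3 = ?T 3 0 / 6"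
  have hom: "taylor_hom2 3 f = (\<lambda>p. c0 * snd p ^ 3 + c1 * fst p * snd p ^ 2 + c2 * fst p ^ 2 * snd p + c3 * fst p ^ 3)"
    by (auto simp: taylor_hom2_def c numeral_3_eq_3 fun_eq_iff case_prod_unfold)
      (simp_all add: numeral_eq_Suc fact_numeral algebra_simps)
  have "((\<lambda>p. c0 * snd p ^ 3 + c1 * fst p * snd p ^ 2 + c2 * fst p ^ 2 * snd p + c3 * fst p ^ 3) has_derivative
      (\<lambda>h. 3 * c0 * snd p ^ 2 * snd h + (c1 * fst h * snd p ^ 2 + 2 * c1 * fst p * snd p * snd h)
        + (2 * c2 * fst p * fst h * snd p + c2 * fst p ^ 2 * snd h) + 3 * c3 * fst p ^ 2 * fst h)) (at p)" for p :: "real \<times> real"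
    by (auto intro!: derivative_eq_intros simp: algebra_simps power2_eq_square)
  then have 1: "ddir (0, 1) (taylor_hom2 3 f)
      = (\<lambda>p. 3 * c0 * snd p ^ 2 + 2 * c1 * fst p * snd p + c2 * fst p ^ 2)"
    unfolding hom by (intro ext) (subst ddir_eqI, assumption, simp)
  have "((\<lambda>p. 3 * c0 * snd p ^ 2 + 2 * c1 * fst p * snd p + c2 * fst p ^ 2) has_derivative
      (\<lambda>h. 6 * c0 * snd p * snd h + (2 * c1 * fst h * snd p + 2 * c1 * fst p * snd h)
        + 2 * c2 * fst p * fst h)) (at p)" for p :: "real \<times> real"
    by (auto intro!: derivative_eq_intros simp: algebra_simps power2_eq_square)
  then have 2: "ddir (1, 0) (\<lambda>p. 3 * c0 * snd p ^ 2 + 2 * c1 * fst p * snd p + c2 * fst p ^ 2)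
      = (\<lambda>p. 2 * c1 * snd p + 2 * c2 * fst p)"
    by (intro ext) (subst ddir_eqI, assumption, simp)
  have 3: "((\<lambda>p. 2 * c1 * snd p + 2 * c2 * fst p) has_derivative (\<lambda>h. 2 * c1 * snd h + 2 * c2 * fst h)) (at p)"
    for p :: "real \<times> real"
    by (auto intro!: derivative_eq_intros)
  have "ddir (1, 0) (\<lambda>p. 2 * c1 * snd p + 2 * c2 * fst p) (0, 0) = 2 * c2"
    using ddir_eqI[OF 3, of "(1, 0)"] by simp
  then show ?thesis
    unfolding 1 2 by (simp add: c)
qed

lemma taylor_add:
  assumes "Cinf_on f U" "Cinf_on g U" "0 \<in> U"
  shows "taylor (\<lambda>p. f p + g p) = taylor f + taylor g"
  by (rule mfps_eqI) (simp add: taylor_def mpartial_add[OF assms] add_divide_distrib)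

lemma smooth_near_0_Cinf: "smooth_near_0 f \<longleftrightarrow> (\<exists>U. 0 \<in> U \<and> Cinf_on f U)"
  by (auto simp: smooth_near_0_def Cinf_on_def)

lemma cubic_wt_ge:
  "mconst c * mvar X1 ^ 3 + mconst d * (mvar X1 ^ 2 * mvar X2) + mconst e * (mvar X1 * mvar X2 ^ 2)
     + mconst f * mvar X2 ^ 3 \<in> ord_ge 3"
proof -
  have "mvar u * mvar v * mvar v' \<in> wt_ge 1 1 (1 + 1 + 1)" if "{u, v, v'} \<subseteq> {X1, X2}" for u v v'
    using that by (intro wt_ge_mult mvar_wt_ge) auto
  from this[of X1 X1 X1] this[of X1 X1 X2] this[of X1 X2 X2] this[of X2 X2 X2] show ?thesis
    unfolding ord_ge_eq_wt_ge power3_eq_cube power2_eq_square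
    by (intro wt_ge_add wt_ge_mconst_mult) (simp_all add: numeral_3_eq_3 mult.assoc)
qed

text \<open>Near the origin |x| \<le> 1, so the factor |x|^2 can be bounded by 1.\<close>

lemma flat_bound:
  assumes "(\<lambda>(e, x, \<xi>). \<rho> e x \<xi>) \<in> O[nhds 0](\<lambda>(e, x, \<xi>). e ^ N * (norm x)\<^sup>2)"
  shows "\<exists>C. \<forall>\<^sub>F p in nhds (0 :: real \<times> 'a::real_normed_vector \<times> 'b::real_normed_vector).
    \<bar>(\<lambda>(e, x, \<xi>). \<rho> e x \<xi>) p\<bar> \<le> C * \<bar>fst p\<bar> ^ N"
proof -
  obtain C where C: "C > 0" "\<forall>\<^sub>F p in nhds (0 :: real \<times> 'a \<times> 'b). norm ((\<lambda>(e, x, \<xi>). \<rho> e x \<xi>) p)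
      \<le> C * norm ((\<lambda>(e, x, \<xi>). e ^ N * (norm x)\<^sup>2) p)"
    using assms by (elim landau_o.bigE)
  have "\<forall>\<^sub>F p in nhds (0 :: real \<times> 'a \<times> 'b). norm p < 1"
    unfolding eventually_nhds_metric by (intro exI[of _ 1]) (simp add: dist_norm)
  with C(2) have "\<forall>\<^sub>F p in nhds (0 :: real \<times> 'a \<times> 'b). \<bar>(\<lambda>(e, x, \<xi>). \<rho> e x \<xi>) p\<bar> \<le> C * \<bar>fst p\<bar> ^ N"
  proof eventually_elim
    case (elim p)
    obtain e x y where p: "p = (e, x, y)"
      by (metis prod.exhaust)
    have "norm x \<le> 1"
      using elim(2) norm_fst_le[of x y] norm_snd_le[of "(x, y)" e] by (simp add: p)
    then have "(norm x)\<^sup>2 \<le> 1"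
      by (simp add: power_le_one)
    then have "\<bar>e\<bar> ^ N * (norm x)\<^sup>2 \<le> \<bar>e\<bar> ^ N * 1"
      by (intro mult_left_mono) auto
    then have "C * (\<bar>e\<bar> ^ N * (norm x)\<^sup>2) \<le> C * \<bar>e\<bar> ^ N"
      using C(1) by simp
    with elim(1) show ?case
      by (simp add: p abs_mult power_abs)
  qed
  then show ?thesis ..
qed

theorem theorem3p5:
  fixes w1 w2 :: "real \<Rightarrow> real" and w11 w21 :: real
    and \<rho> :: "real \<Rightarrow> real \<times> real \<Rightarrow> real \<times> real \<Rightarrow> real"
    and R :: "real \<Rightarrow> real \<times> real \<Rightarrow> real"
    and \<mu> :: real
  assumes "smooth_near_0 w1" and "smooth_near_0 w2"
    and "\<forall>\<^sub>F e in nhds 0. w1 e > 0" and "\<forall>\<^sub>F e in nhds 0. w2 e > 0"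
    and "(\<lambda>e. w1 e - (w1 0 + e * w11)) \<in> O[nhds 0](\<lambda>e. e\<^sup>2)"
    and "(\<lambda>e. w2 e - (w2 0 + e * w21)) \<in> O[nhds 0](\<lambda>e. e\<^sup>2)"
    and "w2 0 = 2 * w1 0"
    and "smooth_near_0 (\<lambda>(e, x, \<xi>). \<rho> e x \<xi>)"
    and "\<forall>N. (\<lambda>(e, x, \<xi>). \<rho> e x \<xi>) \<in> O[nhds 0](\<lambda>(e, x, \<xi>). e ^ N * (norm x)\<^sup>2)"
    and "smooth_near_0 (\<lambda>(e, x). R e x)"
    and "(\<lambda>(e, x). R e x) \<in> O[nhds 0](\<lambda>(e, x). norm x ^ 3)"
    and "\<mu> = 1/8 * ddir (1, 0) (ddir (1, 0) (ddir (0, 1) (taylor_hom2 3 (R 0)))) (0, 0)"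
  shows "(\<exists>Q. quantum_BGNF (w1 0) (w2 0)
            (taylor (\<lambda>p. H2 w1 w2 \<rho> p + R (p $ Eps) (p $ X1, p $ X2))) Q) \<and>
         (\<forall>Q. quantum_BGNF (w1 0) (w2 0)
            (taylor (\<lambda>p. H2 w1 w2 \<rho> p + R (p $ Eps) (p $ X1, p $ X2))) Q \<longrightarrow>
            (\<exists>r. Q = H20 (w1 0) (w2 0) + K3 w11 w21 \<mu> + r \<and> r \<in> ord_ge 4 \<and> r \<in> ord_ge_xh 2))"
proof -
  let ?H = "H20 (w1 0) (w2 0)"
  let ?P = "taylor (\<lambda>p. H2 w1 w2 \<rho> p + R (p $ Eps) (p $ X1, p $ X2))"
  define f where "f = (\<lambda>(e, x). R e x)"
  define g where "g = (\<lambda>(e, x, \<xi>). \<rho> e x \<xi>)"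
  obtain U1 U2 Ug Uf where U1: "Cinf_on w1 U1" "0 \<in> U1" and U2: "Cinf_on w2 U2" "0 \<in> U2"
    and Ug: "Cinf_on g Ug" "0 \<in> Ug" and Uf: "Cinf_on f Uf" "0 \<in> Uf"
    using assms(1,2,8,10) unfolding smooth_near_0_Cinf f_def g_def by blast
  have d1: "ddir 1 w1 0 = w11" and d2: "ddir 1 w2 0 = w21"
    using ddir_eq_of_bigo[OF U1 assms(5)] ddir_eq_of_bigo[OF U2 assms(6)] .
  have w_pos: "w1 0 > 0"
    using assms(3) by (rule eventually_nhds_x_imp_x)
  obtain C where Of: "\<forall>\<^sub>F p in nhds 0. \<bar>f p\<bar> \<le> C * norm (snd p) ^ 3"
  proof -
    obtain C where C: "\<forall>\<^sub>F p in nhds 0. norm (f p) \<le> C * norm ((\<lambda>(e :: real, x :: real \<times> real). norm x ^ 3) p)"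
      using assms(11) unfolding f_def[symmetric] by (elim landau_o.bigE)
    have "\<forall>\<^sub>F p in nhds 0. \<bar>f p\<bar> \<le> C * norm (snd p) ^ 3"
      using C by eventually_elim (simp add: case_prod_unfold)
    then show thesis ..
  qed
  have Og: "\<exists>C. \<forall>\<^sub>F p in nhds 0. \<bar>g p\<bar> \<le> C * \<bar>fst p\<bar> ^ N" for N
    unfolding g_def using assms(9) by (intro flat_bound) blast

  \<comment> \<open>A common neighbourhood of 0 on which all six summands of the Hamiltonian are
    smooth.\<close>
  define V where "V = {p :: real ^ coord. p $ Eps \<in> U1} \<inter> {p. p $ Eps \<in> U2} \<inter> (pr_rho -` Ug \<inter> pr_R -` Uf)"
  note sq1 = Cinf_on_quad[OF U1(1)] and sq2 = Cinf_on_quad[OF U2(1)]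
  note sg = Cinf_on_compose_linear[OF bounded_linear_pr_rho Ug(1)]
    and sf = Cinf_on_compose_linear[OF bounded_linear_pr_R Uf(1)]
  have V: "open V" "0 \<in> V"
    using U1 U2 Ug Uf Cinf_on_open[OF sq1[of X1]] Cinf_on_open[OF sq2[of X1]] Cinf_on_open[OF sg] Cinf_on_open[OF sf]
    by (auto simp: V_def pr_rho_def pr_R_def zero_prod_def)
  have sV: "Cinf_on (quad w1 Xi1) V" "Cinf_on (quad w1 X1) V" "Cinf_on (quad w2 Xi2) V" "Cinf_on (quad w2 X2) V"
    "Cinf_on (\<lambda>p. g (pr_rho p)) V" "Cinf_on (\<lambda>p. f (pr_R p)) V"
    by (rule Cinf_on_subset[OF sq1 V(1)] Cinf_on_subset[OF sq2 V(1)] Cinf_on_subset[OF sg V(1)]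
        Cinf_on_subset[OF sf V(1)]; force simp: V_def)+
  have "(\<lambda>p. H2 w1 w2 \<rho> p + R (p $ Eps) (p $ X1, p $ X2)) = (\<lambda>p. quad w1 Xi1 p + (quad w1 X1 p
      + (quad w2 Xi2 p + (quad w2 X2 p + (g (pr_rho p) + f (pr_R p))))))"
    by (rule ext) (simp add: H2_def quad_def f_def g_def pr_rho_def pr_R_def field_simps)
  then have "?P = taylor (quad w1 Xi1) + (taylor (quad w1 X1) + (taylor (quad w2 Xi2) + (taylor (quad w2 X2)
      + (taylor (\<lambda>p. g (pr_rho p)) + taylor (\<lambda>p. f (pr_R p))))))"
    by (simp add: taylor_add[OF _ _ V(2)] Cinf_on_add sV)
  moreover have "taylor (\<lambda>p. g (pr_rho p)) = 0"
    by (rule mfps_eqI) (simp add: taylor_def mpartial_flat[OF Ug Og])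
  ultimately have P: "?P = taylor (quad w1 Xi1) + taylor (quad w1 X1) + taylor (quad w2 Xi2) + taylor (quad w2 X2)
      + taylor (\<lambda>p. f (pr_R p))"
    by (simp add: add.assoc)

  define T where "T = (\<lambda>a b. (ddir (1, 0) ^^ a) ((ddir (0, 1) ^^ b) (\<lambda>x. f (0, x))) (0, 0))"
  have "(\<lambda>x. f (0, x)) = R 0"
    by (simp add: f_def)
  then have \<mu>: "T 2 1 / 2 = 4 * \<mu>"
    using assms(12) unfolding ddir_taylor_hom2 by (simp add: T_def)
  define Cub where "Cub = mconst (of_real (T 3 0 / 6)) * mvar X1 ^ 3 + mconst (4 * of_real \<mu>) * (mvar X1 ^ 2 * mvar X2)
      + mconst (of_real (T 1 2 / 2)) * (mvar X1 * mvar X2 ^ 2) + mconst (of_real (T 0 3 / 6)) * mvar X2 ^ 3"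
  have tf: "taylor (\<lambda>p. f (pr_R p)) \<in> ord_ge_xh 2" "taylor (\<lambda>p. f (pr_R p)) - Cub \<in> ord_ge 4"
    using taylor_cubic[OF Uf Of T_def] unfolding \<mu> by (simp_all add: Cub_def)
  \<comment> \<open>h witnesses that the nonresonant part of the cubic Taylor polynomial is
    removable by conjugation.\<close>
  obtain h where h: "hop (w1 0) (w2 0) h = Cub - mconst (of_real \<mu>) * mRe (z1 ^ 2 * mcnj z2)"
  proof -
    have "Cub - mconst (of_real \<mu>) * mRe (z1 ^ 2 * mcnj z2) \<in> hop_image (w1 0) (w2 0)"
      unfolding Cub_def assms(7) by (rule cubic_minus_resonant_in_hop_image) (use w_pos in simp)
    then show thesis
      using that by (auto simp: hop_image_def)
  qed

  define L where "L = ?P - ?H"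
  define N where "N = K3 w11 w21 \<mu>"
  note tq1 = taylor_quad[OF U1 d1] and tq2 = taylor_quad[OF U2 d2]
  let ?D = "\<lambda>w c v. taylor (quad w v) - (mconst (of_real (w 0 / 2)) * mvar v ^ 2
      + mconst (of_real (c / 2)) * mvar Eps * mvar v ^ 2)"
  \<comment> \<open>The quadratic terms without \<epsilon> cancel against \<open>H20\<close> and
    those linear in \<epsilon> against \<open>K3\<close>, leaving Taylor remainders only.\<close>
  have "L - (N + hop (w1 0) (w2 0) h) = ?D w1 w11 Xi1 + ?D w1 w11 X1 + ?D w2 w21 Xi2 + ?D w2 w21 X2
      + (taylor (\<lambda>p. f (pr_R p)) - Cub)"
    unfolding h by (simp add: L_def N_def K3_eq P H20_def algebra_simps)
  also have "\<dots> \<in> ord_ge 4"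
    using tq1(2) tq2(2) tf(2) by (auto simp: ord_ge_eq_wt_ge intro!: wt_ge_add)
  finally have L4: "L - (N + hop (w1 0) (w2 0) h) \<in> ord_ge 4" .
  have N3: "N \<in> ord_ge 3" and N2: "N \<in> ord_ge_xh 2"
    unfolding N_def ord_ge_eq_wt_ge ord_ge_xh_eq_wt_ge by (rule K3_wt_ge; simp)+
  \<comment> \<open>With both slopes set to 0, \<open>K3\<close> reduces to its resonant cubic term,
    whose order is wanted here.\<close>
  have "K3 0 0 \<mu> \<in> ord_ge 3"
    unfolding ord_ge_eq_wt_ge by (rule K3_wt_ge) simp_all
  then have "hop (w1 0) (w2 0) h \<in> ord_ge 3"
    unfolding h using cubic_wt_ge by (auto simp: ord_ge_eq_wt_ge Cub_def K3_def intro!: wt_ge_diff)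
  with N3 have "N + hop (w1 0) (w2 0) h \<in> wt_ge 1 1 3"
    by (simp add: ord_ge_eq_wt_ge wt_ge_add)
  moreover have "L - (N + hop (w1 0) (w2 0) h) \<in> wt_ge 1 1 3"
    using wt_ge_mono[OF L4[unfolded ord_ge_eq_wt_ge], of 3] by simp
  ultimately have L3: "L \<in> ord_ge 3"
    unfolding ord_ge_eq_wt_ge using wt_ge_diffD by blast
  have L2: "L \<in> ord_ge_xh 2"
    unfolding L_def P ord_ge_xh_eq_wt_ge
    using tq1(1) tq2(1) tf(1) H20_wt_ge[of "w1 0" "w2 0" 1 0]
    by (intro wt_ge_diff wt_ge_add) (auto simp: ord_ge_xh_eq_wt_ge)
  have N0: "hop (w1 0) (w2 0) N = 0"
    unfolding N_def assms(7) by (rule hop_K3)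
  have PL: "?P = ?H + L"
    by (simp add: L_def)
  have "\<exists>r. Q = ?H + N + r \<and> r \<in> ord_ge 4 \<and> r \<in> ord_ge_xh 2"
    if Q: "quantum_BGNF (w1 0) (w2 0) ?P Q" for Q
  proof -
    obtain L' K A where "L' \<in> ord_ge 3" and K: "K \<in> ord_ge 3" "Q = ?H + K" "hop (w1 0) (w2 0) K = 0"
      and A: "A \<in> ord_ge 3" and eq: "?P = ?H + L'" "exp_ad A (?H + L') = ?H + K"
      using Q unfolding quantum_BGNF_def weyl_bracket_H20_eq_0_iff by blast
    \<comment> \<open>The Taylor series determines its part beyond \<open>H20\<close>, so the
      estimates for L apply to every normal form Q.\<close>
    have "L' = L"
      using eq(1) by (simp add: L_def)
    with eq have E: "exp_ad A (?H + L) = ?H + K"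
      by simp
    have "K - N \<in> ord_ge 4"
      by (rule normal_form_cubic[OF L3 A K(1,3) E N3 N0 L4])
    moreover have "K \<in> ord_ge_xh 2"
      by (rule normal_form_xh[OF _ _ L3 L2 A K(3) E]) (use w_pos assms(7) in simp_all)
    then have "K - N \<in> ord_ge_xh 2"
      using N2 by (simp add: ord_ge_xh_eq_wt_ge wt_ge_diff)
    ultimately show ?thesis
      using K(2) by (intro exI[of _ "K - N"]) simp
  qed
  then show ?thesis
    using quantum_BGNF_exists[OF L3, of "w1 0" "w2 0"] unfolding PL[symmetric] N_def by blast
qed

end
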